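(* Let $d\ge1$ and let $X_1,X_2,\dots$ be i.i.d. random vectors in $\mathbb{R}^d$ with density $f\in\mathcal{P}_{C,4}$ for some $C<\infty$. Let $p$ be a clipping function with derivatives of orders $1,\dots,5$ bounded and uniformly continuous on $\mathbb{R}$, and set $\alpha(f(t))=c\,p^{1/2}(c^{-2}f(t))$ for some $c>0$, i.e. $\alpha(s)=c\,p^{1/2}(s/c^2)$. Suppose that the kernel $K$ on $\mathbb{R}^d$ has the form $K(t)=\Phi(\|t\|^2)$ for some real function $\Phi$ with uniformly bounded second order derivative and with support contained in $[0,T]$, $T<\infty$, and that $K$ is non-negative and integrates to $1$. Define $$\hat f(t;h_{1,n},h_{2,n})=\frac{1}{nh_{2,n}^d}\sum_{i=1}^{n}K\left(\frac{t-X_i}{h_{2,n}}\alpha(\hat f(X_i;h_{1,n}))\right)\alpha^d(\hat f(X_i;h_{1,n})),\qquad \hat f(t;h_{1,n})=\frac{1}{nh_{1,n}^d}\sum_{i=1}^nK\left(\frac{t-X_i}{h_{1,n}}\right).$$ Let $U(h_{1,n})=\sqrt{\frac{\log h_{1,n}^{-1}}{nh_{1,n}^d}}+h_{1,n}^2$ and assume that $U(h_{1,n})=o(h_{2,n}^2)$. Then as $h_{2,n}\to0$ (with $n\to\infty$), for every $r>0$ and every $t\in\mathcal{D}_r$, $$\mathbb{E}\bigl(\hat f(t;h_{1,n},h_{2,n})\bigr)-f(t)=\left(\sum_{|v|=4}\frac{\tau_vD_v(1/f)(t)}{v!}\right)h_{2,n}^4+o(h_{2,n}^4).$$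
   Context: $\mathcal{P}_{C,k}$ is the set of probability densities on $\mathbb{R}^d$ which, together with all their partial derivatives of order $k$ or lower, are bounded by $C<\infty$ and are uniformly continuous. A clipping function is a function $p:\mathbb{R}\to\mathbb{R}$ with $p(x)\ge1$ for all $x$ and $p(x)=x$ for all $x\ge t_0$, for some $1\le t_0<\infty$. $\mathcal{D}_r=\{t\in\mathbb{R}^d: f(t)>r>t_0c^2,\ \|t\|<1/r\}$ (empty unless $r>t_0c^2$). $\alpha^d(s)$ means $(\alpha(s))^d$. For a multi-index $v=(v_1,\dots,v_d)\in(\mathbb{N}\cup\{0\})^d$: $|v|=\sum_iv_i$, $v!=v_1!\cdots v_d!$, $u^v=u_1^{v_1}\cdots u_d^{v_d}$, $D_v$ is the partial derivative of order $v_i$ in the $i$-th coordinate for each $i$, and $\tau_v=\int_{\mathbb{R}^d}u^vK(u)\,du$. $\Phi$ is regarded as a function on $[0,\infty)$. Bandwidth sequences are positive, with $h_{1,n}\to0$ and $nh_{1,n}^d\to\infty$. *)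

theory Defs
  imports "HOL-Probability.Probability" "HOL-Library.Landau_Symbols"
begin

definition partial_deriv :: "'d \<Rightarrow> (real ^ 'd \<Rightarrow> real) \<Rightarrow> real ^ 'd \<Rightarrow> real"
  where "partial_deriv i g x = deriv (\<lambda>s. g (x + s *\<^sub>R axis i 1)) 0"

definition has_partial_at :: "'d \<Rightarrow> (real ^ 'd \<Rightarrow> real) \<Rightarrow> real ^ 'd \<Rightarrow> bool"
  where "has_partial_at i g x \<longleftrightarrow> (\<lambda>s. g (x + s *\<^sub>R axis i 1)) differentiable (at 0)"

fun iter_partial :: "'d list \<Rightarrow> (real ^ 'd \<Rightarrow> real) \<Rightarrow> real ^ 'd \<Rightarrow> real"
  where
    "iter_partial [] g = g"
  | "iter_partial (i # is) g = partial_deriv i (iter_partial is g)"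

text \<open>
  The predicate asks for the partial derivatives of order at most \<open>k\<close> taken in every order of
  the coordinates; their existence is required separately because \<open>deriv\<close> is total.
\<close>

definition smooth_densities :: "real \<Rightarrow> nat \<Rightarrow> (real ^ 'd::finite \<Rightarrow> real) set"
  where "smooth_densities C k =
    {f. (\<forall>x. 0 \<le> f x) \<and> has_bochner_integral lborel f 1 \<and>
        (\<forall>is. length is < k \<longrightarrow> (\<forall>i x. has_partial_at i (iter_partial is f) x)) \<and>
        (\<forall>is. length is \<le> k \<longrightarrow>
           (\<forall>x. \<bar>iter_partial is f x\<bar> \<le> C) \<and> uniformly_continuous_on UNIV (iter_partial is f))}"

definition mi_order :: "('d::finite \<Rightarrow> nat) \<Rightarrow> nat"
  where "mi_order v = (\<Sum>i\<in>UNIV. v i)"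

definition mi_fact :: "('d::finite \<Rightarrow> nat) \<Rightarrow> real"
  where "mi_fact v = (\<Prod>i\<in>UNIV. fact (v i))"

definition mi_power :: "real ^ 'd::finite \<Rightarrow> ('d \<Rightarrow> nat) \<Rightarrow> real"
  where "mi_power u v = (\<Prod>i\<in>UNIV. (u $ i) ^ v i)"

text \<open>
  An index type of class \<open>finite\<close> carries no canonical enumeration, so some list containing each
  coordinate \<open>i\<close> exactly \<open>v i\<close> times is chosen. The choice is immaterial wherever the partial
  derivatives up to order \<open>|v|\<close> are continuous.
\<close>

definition mi_deriv :: "('d::finite \<Rightarrow> nat) \<Rightarrow> (real ^ 'd \<Rightarrow> real) \<Rightarrow> real ^ 'd \<Rightarrow> real"
  where "mi_deriv v g = iter_partial (SOME is. \<forall>i. count_list is i = v i) g"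

definition kernel_moment :: "(real ^ 'd::finite \<Rightarrow> real) \<Rightarrow> ('d \<Rightarrow> nat) \<Rightarrow> real"
  where "kernel_moment K v = (\<integral>u. mi_power u v * K u \<partial>lborel)"

definition clipping :: "(real \<Rightarrow> real) \<Rightarrow> real \<Rightarrow> bool"
  where "clipping p t0 \<longleftrightarrow> 1 \<le> t0 \<and> (\<forall>x. 1 \<le> p x) \<and> (\<forall>x\<ge>t0. p x = x)"

definition smooth_derivs :: "nat \<Rightarrow> (real \<Rightarrow> real) \<Rightarrow> bool"
  where "smooth_derivs k p \<longleftrightarrow>
    (\<forall>j<k. \<forall>x. (deriv ^^ j) p differentiable (at x)) \<and>
    (\<forall>j\<in>{1..k}. bounded (range ((deriv ^^ j) p)) \<and> uniformly_continuous_on UNIV ((deriv ^^ j) p))"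

definition clip_scale :: "real \<Rightarrow> (real \<Rightarrow> real) \<Rightarrow> real \<Rightarrow> real"
  where "clip_scale c p s = c * sqrt (p (s / c\<^sup>2))"

text \<open>\<open>\<Phi>\<close> lives on the half-line: its derivatives at \<open>0\<close> are one-sided and its values at
  negative arguments are irrelevant.\<close>

definition bounded_second_deriv :: "(real \<Rightarrow> real) \<Rightarrow> bool"
  where "bounded_second_deriv \<Phi> \<longleftrightarrow>
    (\<exists>\<Phi>' \<Phi>'' B. \<forall>s\<ge>0.
       (\<Phi> has_real_derivative \<Phi>' s) (at s within {0..}) \<and>
       (\<Phi>' has_real_derivative \<Phi>'' s) (at s within {0..}) \<and> \<bar>\<Phi>'' s\<bar> \<le> B)"

definition region :: "(real ^ 'd::finite \<Rightarrow> real) \<Rightarrow> real \<Rightarrow> real \<Rightarrow> real \<Rightarrow> (real ^ 'd) set"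
  where "region f t0 c r = {t. f t > r \<and> r > t0 * c\<^sup>2 \<and> norm t < 1 / r}"

text \<open>In the two estimators \<open>x 1, \<dots>, x n\<close> is the sample; \<open>x 0\<close> is not used.\<close>

definition kde :: "(real ^ 'd::finite \<Rightarrow> real) \<Rightarrow> nat \<Rightarrow> real \<Rightarrow> (nat \<Rightarrow> real ^ 'd) \<Rightarrow> real ^ 'd \<Rightarrow> real"
  where "kde K n h x t =
    1 / (real n * h ^ CARD('d)) * (\<Sum>i=1..n. K ((1 / h) *\<^sub>R (t - x i)))"

definition variable_kde ::
    "(real ^ 'd::finite \<Rightarrow> real) \<Rightarrow> (real \<Rightarrow> real) \<Rightarrow> nat \<Rightarrow> real \<Rightarrow> real \<Rightarrow>
      (nat \<Rightarrow> real ^ 'd) \<Rightarrow> real ^ 'd \<Rightarrow> real"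
  where "variable_kde K \<alpha> n h1 h2 x t =
    1 / (real n * h2 ^ CARD('d)) *
      (\<Sum>i=1..n. K ((\<alpha> (kde K n h1 x (x i)) / h2) *\<^sub>R (t - x i)) * \<alpha> (kde K n h1 x (x i)) ^ CARD('d))"

definition pilot_rate :: "nat \<Rightarrow> nat \<Rightarrow> real \<Rightarrow> real"
  where "pilot_rate d n h = sqrt (ln (1 / h) / (real n * h ^ d)) + h\<^sup>2"

end

theory Submission
  imports Defs
begin

text \<open>
  By exchangeability the expectation is an integral over the position \<open>y\<close> of one sample point, the
  pilot value \<open>D\<close> at \<open>y\<close> depending on the other points. Near \<open>t\<close> the clipping is inactive
  and the summand is expanded to first order in \<open>D - f(y)\<close>. The quadratic remainder is \<open>O(E(D - f)\<^sup>2) = O(1/(n h\<^sub>1\<^sup>d) + h\<^sub>1\<^sup>4) = O(U(h\<^sub>1)\<^sup>2)\<close>, hence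
  \<open>o(h\<^sub>2\<^sup>4)\<close>; an exponential moment bound takes care of large values of \<open>D\<close>. The linear term
  carries the bias of \<open>D\<close>, of order \<open>h\<^sub>1\<^sup>2\<close> with \<open>C\<^sup>2\<close> bounds, against a kernel that is
  even with integral 0, so it is \<open>O(h\<^sub>1\<^sup>2 h\<^sub>2\<^sup>2)\<close>. The zeroth-order term
  \<open>\<integral> K(u f(t + hu)\<^sup>1\<^sup>/\<^sup>2) f(t + hu)\<^sup>d\<^sup>/\<^sup>2\<^sup>+\<^sup>1 du\<close> is compared with
  \<open>\<integral> K(z) P(hz) dz\<close> through the substitution \<open>z = u f(t + hu)\<^sup>1\<^sup>/\<^sup>2\<close>, where by Lagrange inversion the
  polynomial \<open>P\<close> has the homogeneous parts of order \<open>n\<close> of \<open>f\<^sup>1\<^sup>-\<^sup>n\<^sup>/\<^sup>2\<close>: the odd ones integrate to 0, the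
  one of order 2 vanishes, and the one of order 4 comes from \<open>1/f\<close>.
\<close>

section \<open>Functions with continuous partial derivatives\<close>

text \<open>The profile \<Phi> has just two derivatives, so the smoothing integral cannot be
  expanded to order four in \<open>h\<close> through the kernel. The substitution removes this
  obstacle: in the variable \<open>z\<close> the kernel is a fixed bounded continuous weight, and
  all smoothness is demanded of \<open>f\<close>. The two derivatives of \<Phi> are spent on the
  dependence on the pilot value, where the linear and the quadratic term use them. The four
  derivatives of \<open>f\<close> are shared in the bias term: two for the second difference of step
  \<open>h1\<close>, two for its expansion around \<open>t\<close> on the scale \<open>h2\<close>.
  Since \<open>f(t) > r > t0 c^2\<close>, there is a gap \<eta> between \<open>f\<close> near
  \<open>t\<close> and the clipping level. A pilot value in the clipped range has therefore missed
  \<open>f\<close> by at least \<eta>, and a constant times its squared error pays for it. Since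
  \<alpha> is at least \<open>c\<close>, sample points farther than a multiple of \<open>h2\<close>
  from \<open>t\<close> contribute nothing, which makes the whole argument local. As the claim
  concerns an expectation, mean square errors at each fixed \<open>y\<close> suffice; they are of
  order \<open>U(h1)^2\<close> as soon as \<open>log(1/h1) \<ge> 1\<close>.\<close>

fun C_diff :: "nat \<Rightarrow> (real ^ 'd::finite) set \<Rightarrow> (real ^ 'd \<Rightarrow> real) \<Rightarrow> bool"
  where
    "C_diff 0 U g = continuous_on U g"
  | "C_diff (Suc k) U g = (continuous_on U g \<and>
      (\<forall>i. (\<forall>x\<in>U. has_partial_at i g x) \<and> C_diff k U (partial_deriv i g)))"

lemma C_diff_imp_continuous_on: "C_diff k U g \<Longrightarrow> continuous_on U g"
  by (cases k) auto

lemma C_diff_subset: "C_diff k V g \<Longrightarrow> W \<subseteq> V \<Longrightarrow> C_diff k W g"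
  by (induction k arbitrary: g) (auto intro: continuous_on_subset)

lemma C_diff_SucD: "C_diff (Suc k) U g \<Longrightarrow> C_diff k U g"
  by (induction k arbitrary: g) auto

lemma C_diff_mono: "C_diff k U g \<Longrightarrow> j \<le> k \<Longrightarrow> C_diff j U g"
  by (induction k) (auto simp: le_Suc_eq simp del: C_diff.simps(2) dest: C_diff_SucD)

lemma eventually_axis_in_open:
  fixes x :: "real ^ 'd::finite"
  assumes "open U" "x \<in> U"
  shows "eventually (\<lambda>s. x + s *\<^sub>R axis i 1 \<in> U) (nhds 0)"
proof -
  have "((\<lambda>s. x + s *\<^sub>R axis i 1) \<longlongrightarrow> x + 0 *\<^sub>R axis i 1) (nhds 0)"
    by (intro tendsto_intros filterlim_ident)
  then show ?thesis
    using assms by (auto dest: topological_tendstoD)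
qed

lemma has_partial_at_cong:
  assumes "open U" "x \<in> U" "\<And>y. y \<in> U \<Longrightarrow> g y = g' y"
  shows "has_partial_at i g x \<longleftrightarrow> has_partial_at i g' x"
proof -
  have ev: "eventually (\<lambda>s. g (x + s *\<^sub>R axis i 1) = g' (x + s *\<^sub>R axis i 1)) (nhds 0)"
    using eventually_axis_in_open[OF assms(1,2), of i] by (rule eventually_mono) (simp add: assms)
  have "((\<lambda>s. g (x + s *\<^sub>R axis i 1)) has_field_derivative D) (at 0)
    \<longleftrightarrow> ((\<lambda>s. g' (x + s *\<^sub>R axis i 1)) has_field_derivative D) (at 0)" for D
    by (rule DERIV_cong_ev) (use ev in auto)
  then show ?thesis unfolding has_partial_at_def real_differentiable_def by simp
qed

lemma partial_deriv_cong:
  assumes "open U" "x \<in> U" "\<And>y. y \<in> U \<Longrightarrow> g y = g' y"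
  shows "partial_deriv i g x = partial_deriv i g' x"
proof -
  have ev: "eventually (\<lambda>s. g (x + s *\<^sub>R axis i 1) = g' (x + s *\<^sub>R axis i 1)) (nhds 0)"
    using eventually_axis_in_open[OF assms(1,2), of i] by (rule eventually_mono) (simp add: assms)
  show ?thesis unfolding partial_deriv_def by (rule deriv_cong_ev) (use ev in auto)
qed

text \<open>A partial derivative at a point of an open set is determined by the values on that set.
  Smoothness is taken relative to a set because \<open>1 / f\<close> and the square root of
  \<open>f\<close> are smooth only where the density is positive.\<close>

lemma C_diff_cong:
  assumes "open U" "\<And>y. y \<in> U \<Longrightarrow> g y = g' y" "C_diff k U g"
  shows "C_diff k U g'"
  using assms(2,3)
proof (induction k arbitrary: g g')
  case 0
  then show ?case using continuous_on_eq[of U g g'] by simp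
next
  case (Suc k)
  have "C_diff k U (partial_deriv i g')" for i
  proof (rule Suc.IH)
    show "partial_deriv i g y = partial_deriv i g' y" if "y \<in> U" for y
      by (rule partial_deriv_cong[OF assms(1) that Suc.prems(1)])
    show "C_diff k U (partial_deriv i g)" using Suc.prems(2) by simp
  qed
  moreover have "continuous_on U g'"
    using continuous_on_eq[of U g g'] Suc.prems by simp
  moreover have "has_partial_at i g' x" if "x \<in> U" for i x
    by (rule iffD1[OF has_partial_at_cong[OF assms(1) that Suc.prems(1)]]) (use Suc.prems(2) that in auto)
  ultimately show ?case by auto
qed

lemma has_partial_at_DERIV:
  "has_partial_at i g x \<Longrightarrow>
    ((\<lambda>s. g (x + s *\<^sub>R axis i 1)) has_real_derivative partial_deriv i g x) (at 0)"
  unfolding has_partial_at_def partial_deriv_def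
  by (simp add: DERIV_deriv_iff_real_differentiable)

lemma partial_derivI:
  assumes "((\<lambda>s. g (x + s *\<^sub>R axis i 1)) has_real_derivative D) (at 0)"
  shows "has_partial_at i g x" "partial_deriv i g x = D"
  using assms unfolding has_partial_at_def partial_deriv_def real_differentiable_def
  by (auto intro: DERIV_imp_deriv)

text \<open>The derivative enters as an explicit formula \<open>g'\<close>, so that the closure
  rules can apply their induction hypothesis to it; the congruence rule exchanges it for
  \<open>partial_deriv\<close>.\<close>

lemma C_diff_SucI:
  assumes "open U" "continuous_on U g"
    and "\<And>i x. x \<in> U \<Longrightarrow> ((\<lambda>s. g (x + s *\<^sub>R axis i 1)) has_real_derivative g' i x) (at 0)"
    and "\<And>i. C_diff k U (g' i)"
  shows "C_diff (Suc k) U g"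
proof -
  have "C_diff k U (partial_deriv i g)" for i
    by (rule C_diff_cong[OF assms(1) _ assms(4)[of i]]) (use partial_derivI(2)[OF assms(3)] in auto)
  then show ?thesis using assms(2) partial_derivI(1)[OF assms(3)] by auto
qed

lemma C_diff_SucE:
  assumes "C_diff (Suc k) U g"
  shows "continuous_on U g" "C_diff k U (partial_deriv i g)"
    "x \<in> U \<Longrightarrow> ((\<lambda>s. g (x + s *\<^sub>R axis i 1)) has_real_derivative partial_deriv i g x) (at 0)"
  using assms by (auto intro: has_partial_at_DERIV)

lemma C_diff_add:
  "open U \<Longrightarrow> C_diff k U g \<Longrightarrow> C_diff k U h \<Longrightarrow> C_diff k U (\<lambda>x. g x + h x)"
proof (induction k arbitrary: g h)
  case 0
  then show ?case by (auto intro: continuous_intros)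
next
  case (Suc k)
  note g = C_diff_SucE[OF Suc.prems(2)] and h = C_diff_SucE[OF Suc.prems(3)]
  show ?case
    by (rule C_diff_SucI[OF Suc.prems(1), of _ "\<lambda>i x. partial_deriv i g x + partial_deriv i h x"])
      (use Suc.IH[OF Suc.prems(1) g(2) h(2)] in \<open>auto intro!: derivative_eq_intros continuous_intros g h\<close>)
qed

lemma C_diff_mult:
  "open U \<Longrightarrow> C_diff k U g \<Longrightarrow> C_diff k U h \<Longrightarrow> C_diff k U (\<lambda>x. g x * h x)"
proof (induction k arbitrary: g h)
  case 0
  then show ?case by (auto intro: continuous_intros)
next
  case (Suc k)
  note g = C_diff_SucE[OF Suc.prems(2)] and h = C_diff_SucE[OF Suc.prems(3)]
  have "C_diff k U (\<lambda>x. partial_deriv i g x * h x + g x * partial_deriv i h x)" for i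
    by (intro C_diff_add Suc.IH C_diff_SucD[OF Suc.prems(2)] C_diff_SucD[OF Suc.prems(3)] Suc.prems(1) g(2) h(2))
  then show ?case
    by (intro C_diff_SucI[OF Suc.prems(1), of _ "\<lambda>i x. partial_deriv i g x * h x + g x * partial_deriv i h x"])
      (auto intro!: derivative_eq_intros continuous_intros g h)
qed

lemma C_diff_const: "open U \<Longrightarrow> C_diff k U (\<lambda>x. c)"
proof (induction k arbitrary: c)
  case (Suc k)
  then show ?case by (intro C_diff_SucI[where g' = "\<lambda>i x. 0"]) auto
qed auto

text \<open>The derivative \<open>- g' / g^2\<close> again contains the reciprocal, but one order
  less of it is required, which the induction hypothesis provides. The square root below is treated
  in the same way.\<close>

lemma C_diff_inverse:
  "open U \<Longrightarrow> C_diff k U g \<Longrightarrow> (\<And>x. x \<in> U \<Longrightarrow> g x \<noteq> 0) \<Longrightarrow> C_diff k U (\<lambda>x. inverse (g x))"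
proof (induction k arbitrary: g)
  case 0
  then show ?case by (auto intro: continuous_intros)
next
  case (Suc k)
  note g = C_diff_SucE[OF Suc.prems(2)]
  have "C_diff k U (\<lambda>x. (-1 * partial_deriv i g x) * (inverse (g x) * inverse (g x)))" for i
    by (intro C_diff_mult Suc.IH C_diff_const C_diff_SucD[OF Suc.prems(2)] Suc.prems g(2)) auto
  then show ?case
    by (intro C_diff_SucI[OF Suc.prems(1), of _ "\<lambda>i x. (-1 * partial_deriv i g x) * (inverse (g x) * inverse (g x))"])
      (auto intro!: derivative_eq_intros continuous_intros g Suc.prems)
qed

lemma C_diff_sqrt:
  "open U \<Longrightarrow> C_diff k U g \<Longrightarrow> (\<And>x. x \<in> U \<Longrightarrow> g x > 0) \<Longrightarrow> C_diff k U (\<lambda>x. sqrt (g x))"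
proof (induction k arbitrary: g)
  case 0
  then show ?case by (auto intro: continuous_intros)
next
  case (Suc k)
  note g = C_diff_SucE[OF Suc.prems(2)]
  have nz: "sqrt (g x) \<noteq> 0" if "x \<in> U" for x using Suc.prems(3)[OF that] by simp
  have "C_diff k U (\<lambda>x. (1/2 * partial_deriv i g x) * inverse (sqrt (g x)))" for i
    by (intro C_diff_mult C_diff_inverse Suc.IH C_diff_const C_diff_SucD[OF Suc.prems(2)] Suc.prems g(2) nz) auto
  then show ?case
    by (intro C_diff_SucI[OF Suc.prems(1), of _ "\<lambda>i x. (1/2 * partial_deriv i g x) * inverse (sqrt (g x))"])
      (auto intro!: derivative_eq_intros continuous_intros g simp: field_simps dest: Suc.prems(3))
qed

section \<open>Iterated partial derivatives\<close>

lemma iter_partial_snoc: "iter_partial (is @ [i]) g = iter_partial is (partial_deriv i g)"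
  by (induction "is") auto

lemma C_diff_iter_partial:
  "C_diff k U g \<Longrightarrow> length is \<le> k \<Longrightarrow> C_diff (k - length is) U (iter_partial is g)"
proof (induction "is")
  case (Cons i "is")
  then obtain m where m: "k - length is = Suc m" "m = k - length (i # is)"
    by (metis Suc_diff_le diff_Suc_Suc length_Cons)
  from Cons have "C_diff (k - length is) U (iter_partial is g)" by auto
  then show ?case using m by auto
qed auto

text \<open>\<open>C_diff\<close> strips the derivative taken first, which is the last entry of the
  list, while \<open>iter_partial\<close> unfolds at the head; hence the induction passes from
  \<open>is\<close> to \<open>is @ [i]\<close>.\<close>

lemma C_diffI_iter_partial:
  assumes "\<And>is. length is < k \<Longrightarrow> \<forall>i. \<forall>x\<in>U. has_partial_at i (iter_partial is g) x"
    and "\<And>is. length is \<le> k \<Longrightarrow> continuous_on U (iter_partial is g)"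
  shows "C_diff k U g"
  using assms
proof (induction k arbitrary: g)
  case 0
  from 0(2)[of "[]"] show ?case by auto
next
  case (Suc k)
  have "C_diff k U (partial_deriv i g)" for i
  proof (rule Suc.IH)
    fix "is" :: "'a list"
    assume "length is < k"
    then show "\<forall>j. \<forall>x\<in>U. has_partial_at j (iter_partial is (partial_deriv i g)) x"
      using Suc.prems(1)[of "is @ [i]"] by (simp add: iter_partial_snoc)
  next
    fix "is" :: "'a list"
    assume "length is \<le> k"
    then show "continuous_on U (iter_partial is (partial_deriv i g))"
      using Suc.prems(2)[of "is @ [i]"] by (simp add: iter_partial_snoc)
  qed
  then show ?case using Suc.prems(1)[of "[]"] Suc.prems(2)[of "[]"] by auto
qed

section \<open>Total differentiability and derivatives along lines\<close>

lemma DERIV_partial_line: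
  assumes "has_partial_at i g (x + s *\<^sub>R axis i 1)"
  shows "((\<lambda>r. g (x + r *\<^sub>R axis i 1)) has_real_derivative partial_deriv i g (x + s *\<^sub>R axis i 1)) (at s)"
proof -
  have "((\<lambda>r. g ((x + s *\<^sub>R axis i 1) + r *\<^sub>R axis i 1)) has_real_derivative
      partial_deriv i g (x + s *\<^sub>R axis i 1)) (at 0)"
    by (rule has_partial_at_DERIV[OF assms])
  then have "((\<lambda>r. g (x + (r + s) *\<^sub>R axis i 1)) has_real_derivative
      partial_deriv i g (x + s *\<^sub>R axis i 1)) (at 0)"
    by (simp add: algebra_simps)
  then show ?thesis
    using DERIV_shift[of "\<lambda>r. g (x + r *\<^sub>R axis i 1)" _ 0 s] by (simp add: add.commute)
qed

text \<open>Keeps the corners of an axis-parallel path from \<open>x\<close> to \<open>x + v\<close>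
  inside the ball of radius \<open>norm v\<close> around \<open>x\<close>, where the partial
  derivatives are controlled.\<close>

lemma norm_coord_sum_le:
  fixes v :: "real ^ 'd::finite"
  assumes "\<And>i. \<bar>c i\<bar> \<le> \<bar>v $ i\<bar>"
  shows "norm (\<Sum>i\<in>S. c i *\<^sub>R axis i 1 :: real ^ 'd) \<le> norm v"
proof (rule norm_le_componentwise_cart)
  fix j
  have "(\<Sum>i\<in>S. c i *\<^sub>R axis i 1 :: real ^ 'd) $ j = (\<Sum>i\<in>S. if i = j then c j else 0)"
    unfolding sum_component by (rule sum.cong) (auto simp: axis_def)
  also have "\<bar>\<dots>\<bar> \<le> \<bar>v $ j\<bar>" using assms[of j] by (simp add: sum.delta)
  finally show "norm ((\<Sum>i\<in>S. c i *\<^sub>R axis i 1 :: real ^ 'd) $ j) \<le> norm (v $ j)" by simp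
qed

lemma partial_deriv_mvt:
  assumes hp: "\<And>s. \<bar>s\<bar> \<le> \<bar>r\<bar> \<Longrightarrow> has_partial_at i g (z + s *\<^sub>R axis i 1)"
  shows "\<exists>s. \<bar>s\<bar> \<le> \<bar>r\<bar> \<and> g (z + r *\<^sub>R axis i 1) - g z = r * partial_deriv i g (z + s *\<^sub>R axis i 1)"
proof (cases r "0 :: real" rule: linorder_cases)
  case equal
  then show ?thesis by auto
next
  case greater
  have "\<exists>s. 0 < s \<and> s < r \<and> g (z + r *\<^sub>R axis i 1) - g (z + 0 *\<^sub>R axis i 1) = (r - 0) * partial_deriv i g (z + s *\<^sub>R axis i 1)"
    by (rule MVT2[OF greater]) (rule DERIV_partial_line, rule hp, use greater in simp)
  then obtain s where "0 < s" "s < r" "g (z + r *\<^sub>R axis i 1) - g z = r * partial_deriv i g (z + s *\<^sub>R axis i 1)"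
    by auto
  then show ?thesis by (intro exI[of _ s]) simp
next
  case less
  have "\<exists>s. r < s \<and> s < 0 \<and> g (z + 0 *\<^sub>R axis i 1) - g (z + r *\<^sub>R axis i 1) = (0 - r) * partial_deriv i g (z + s *\<^sub>R axis i 1)"
    by (rule MVT2[OF less]) (rule DERIV_partial_line, rule hp, use less in simp)
  then obtain s where "r < s" "s < 0" "g z - g (z + r *\<^sub>R axis i 1) = - (r * partial_deriv i g (z + s *\<^sub>R axis i 1))"
    by auto
  then show ?thesis by (intro exI[of _ s]) (simp add: less)
qed

text \<open>The increment is split along an axis-parallel path. On each edge the mean value theorem
  produces a partial derivative at a nearby point, and continuity compares it with the one at
  \<open>x\<close>.\<close>

lemma C_diff_has_derivative:
  fixes g :: "real ^ 'd::finite \<Rightarrow> real"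
  assumes U: "open U" "x \<in> U" and g: "C_diff (Suc k) U g"
  shows "(g has_derivative (\<lambda>v. \<Sum>i\<in>UNIV. v $ i * partial_deriv i g x)) (at x)"
  unfolding has_derivative_at_alt
proof (intro conjI allI impI)
  show "bounded_linear (\<lambda>v. \<Sum>i\<in>UNIV. v $ i * partial_deriv i g x)"
    by (intro bounded_linear_sum bounded_linear_mult_left bounded_linear_compose[OF bounded_linear_mult_left bounded_linear_vec_nth])
next
  fix e :: real
  assume "e > 0"
  \<comment> \<open>One edge per coordinate contributes an error of at most
    \<open>e' * norm v\<close>.\<close>
  define e' where "e' = e / (CARD('d))"
  have e': "e' > 0" using \<open>e > 0\<close> by (simp add: e'_def)
  note gE = C_diff_SucE[OF g]
  have "\<exists>d>0. \<forall>y. dist y x < d \<longrightarrow> y \<in> U \<and> \<bar>partial_deriv i g y - partial_deriv i g x\<bar> \<le> e'" for i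
  proof -
    have "continuous (at x) (partial_deriv i g)"
      using C_diff_imp_continuous_on[OF gE(2)] U continuous_on_eq_continuous_at by blast
    then obtain d1 where d1: "d1 > 0" "\<And>y. dist y x < d1 \<Longrightarrow> dist (partial_deriv i g y) (partial_deriv i g x) < e'"
      using e' unfolding continuous_at_eps_delta by blast
    obtain d2 where d2: "d2 > 0" "\<And>y. dist y x < d2 \<Longrightarrow> y \<in> U"
      using U unfolding open_dist by blast
    show ?thesis
      by (rule exI[of _ "min d1 d2"]) (use d1 d2 in \<open>force simp: dist_real_def\<close>)
  qed
  then obtain dd where dd: "\<And>i. dd i > 0"
    "\<And>i y. dist y x < dd i \<Longrightarrow> y \<in> U \<and> \<bar>partial_deriv i g y - partial_deriv i g x\<bar> \<le> e'"
    by metis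
  define d where "d = Min (range dd)"
  have d0: "d > 0" unfolding d_def using dd(1) by simp
  have dle: "d \<le> dd i" for i unfolding d_def by simp
  show "\<exists>d>0. \<forall>y. norm (y - x) < d \<longrightarrow>
      norm (g y - g x - (\<Sum>i\<in>UNIV. (y - x) $ i * partial_deriv i g x)) \<le> e * norm (y - x)"
  proof (intro exI[of _ d] conjI allI impI d0)
    fix y
    assume y: "norm (y - x) < d"
    define v where "v = y - x"
    have close: "x + w \<in> U \<and> \<bar>partial_deriv i g (x + w) - partial_deriv i g x\<bar> \<le> e'"
      if "norm w \<le> norm v" for w i
      using dd(2)[of "x + w" i] that y dle[of i] unfolding v_def by (simp add: dist_norm)
    \<comment> \<open>Induction over the set \<open>S\<close> of coordinates that have been moved
      already.\<close>
    have "\<bar>g (x + (\<Sum>i\<in>S. (v $ i) *\<^sub>R axis i 1)) - g x - (\<Sum>i\<in>S. v $ i * partial_deriv i g x)\<bar>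
        \<le> card S * (e' * norm v)" for S :: "'d set"
    proof (use finite[of S] in \<open>induction S rule: finite_induct\<close>)
      case empty
      then show ?case by simp
    next
      case (insert i S)
      define z where "z = x + (\<Sum>i\<in>S. (v $ i) *\<^sub>R axis i 1)"
      have nrm: "norm ((\<Sum>i\<in>S. (v $ i) *\<^sub>R axis i 1) + s *\<^sub>R axis i 1 :: real ^ 'd) \<le> norm v" if "\<bar>s\<bar> \<le> \<bar>v $ i\<bar>" for s
      proof -
        have "(\<Sum>j\<in>S. (v $ j) *\<^sub>R axis j 1) + s *\<^sub>R axis i 1
            = (\<Sum>j\<in>insert i S. (if j = i then s else v $ j) *\<^sub>R axis j 1 :: real ^ 'd)"
        proof -
          have "(\<Sum>j\<in>S. (if j = i then s else v $ j) *\<^sub>R axis j 1) = (\<Sum>j\<in>S. (v $ j) *\<^sub>R axis j 1 :: real ^ 'd)"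
            by (rule sum.cong) (use insert(2) in auto)
          then show ?thesis using insert(1,2) by (simp add: add.commute)
        qed
        also have "norm \<dots> \<le> norm v"
          using norm_coord_sum_le[of "\<lambda>j. if j = i then s else v $ j" v "insert i S"] that by auto
        finally show ?thesis .
      qed
      have in_U: "z + s *\<^sub>R axis i 1 \<in> U \<and> \<bar>partial_deriv i g (z + s *\<^sub>R axis i 1) - partial_deriv i g x\<bar> \<le> e'"
        if "\<bar>s\<bar> \<le> \<bar>v $ i\<bar>" for s
        using close[OF nrm[OF that]] by (simp add: z_def add.assoc)
      have hp: "has_partial_at i g (z + s *\<^sub>R axis i 1)" if "\<bar>s\<bar> \<le> \<bar>v $ i\<bar>" for s
        using in_U[OF that] g by auto
      have "\<exists>s. \<bar>s\<bar> \<le> \<bar>v $ i\<bar> \<and> g (z + (v $ i) *\<^sub>R axis i 1) - g z = v $ i * partial_deriv i g (z + s *\<^sub>R axis i 1)"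
        by (rule partial_deriv_mvt) (rule hp)
      then obtain s where s: "\<bar>s\<bar> \<le> \<bar>v $ i\<bar>"
        "g (z + (v $ i) *\<^sub>R axis i 1) - g z = v $ i * partial_deriv i g (z + s *\<^sub>R axis i 1)" by blast
      have "\<bar>v $ i * partial_deriv i g (z + s *\<^sub>R axis i 1) - v $ i * partial_deriv i g x\<bar> \<le> norm v * e'"
        using in_U[OF s(1)] component_le_norm_cart[of v i] e'
        by (auto simp: right_diff_distrib[symmetric] abs_mult intro!: mult_mono)
      moreover have "g (x + (\<Sum>i\<in>insert i S. (v $ i) *\<^sub>R axis i 1)) = g (z + (v $ i) *\<^sub>R axis i 1)"
        using insert(1,2) by (simp add: z_def add_ac)
      moreover have "(\<Sum>i\<in>insert i S. v $ i * partial_deriv i g x) = v $ i * partial_deriv i g x + (\<Sum>i\<in>S. v $ i * partial_deriv i g x)"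
        using insert(1,2) by simp
      moreover have "real (card (insert i S)) * (e' * norm v) = real (card S) * (e' * norm v) + norm v * e'"
        using insert(1,2) by (simp add: algebra_simps)
      ultimately show ?case using insert(3) s(2) unfolding z_def[symmetric] by linarith
    qed
    from this[of UNIV] have "\<bar>g (x + v) - g x - (\<Sum>i\<in>UNIV. v $ i * partial_deriv i g x)\<bar> \<le> CARD('d) * (e' * norm v)"
      by (simp add: basis_expansion[of v, unfolded scalar_mult_eq_scaleR])
    then show "norm (g y - g x - (\<Sum>i\<in>UNIV. (y - x) $ i * partial_deriv i g x)) \<le> e * norm (y - x)"
      by (simp add: v_def e'_def)
  qed
qed

lemma C_diff_DERIV_line:
  fixes g :: "real ^ 'd::finite \<Rightarrow> real"
  assumes "open U" "x + s *\<^sub>R v \<in> U" "C_diff (Suc k) U g"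
  shows "((\<lambda>s. g (x + s *\<^sub>R v)) has_real_derivative (\<Sum>i\<in>UNIV. v $ i * partial_deriv i g (x + s *\<^sub>R v))) (at s)"
proof -
  have "((\<lambda>s. g (x + s *\<^sub>R v)) has_derivative (\<lambda>r. \<Sum>i\<in>UNIV. (r *\<^sub>R v) $ i * partial_deriv i g (x + s *\<^sub>R v))) (at s)"
    by (rule has_derivative_compose[where f = "\<lambda>s. x + s *\<^sub>R v", OF _ C_diff_has_derivative[OF assms]]) (auto intro!: derivative_eq_intros)
  then show ?thesis
    unfolding has_field_derivative_def
    by (rule has_derivative_eq_rhs) (auto simp: sum_distrib_left mult_ac intro!: sum.cong)
qed

section \<open>Symmetry of partial derivatives and directional derivatives\<close>

text \<open>The second difference is the increment in direction \<open>i\<close> of an increment in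
  direction \<open>j\<close>. The mean value theorem in \<open>i\<close> and then in
  \<open>j\<close> turns it into \<open>h^2\<close> times the mixed derivative at a nearby point,
  which continuity compares with the one at \<open>x\<close>.\<close>

lemma mixed_difference_mvt:
  assumes "e > 0" "open U" "x \<in> U" "C_diff 2 U g"
  shows "\<exists>\<delta>>0. \<forall>h. 0 < h \<and> h < \<delta> \<longrightarrow>
    \<bar>(g (x + h *\<^sub>R axis i 1 + h *\<^sub>R axis j 1) - g (x + h *\<^sub>R axis i 1) - g (x + h *\<^sub>R axis j 1) + g x) / h\<^sup>2
      - partial_deriv j (partial_deriv i g) x\<bar> < e"
proof -
  have g: "\<And>i y. y \<in> U \<Longrightarrow> has_partial_at i g y"
    "\<And>i j y. y \<in> U \<Longrightarrow> has_partial_at j (partial_deriv i g) y"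
    "continuous_on U (partial_deriv j (partial_deriv i g))"
    using assms(4) by (auto simp: numeral_2_eq_2)
  have "continuous (at x) (partial_deriv j (partial_deriv i g))"
    using g(3) assms(2,3) continuous_on_eq_continuous_at by blast
  then obtain d1 where d1: "d1 > 0"
    "\<And>y. dist y x < d1 \<Longrightarrow> dist (partial_deriv j (partial_deriv i g) y) (partial_deriv j (partial_deriv i g) x) < e"
    using assms(1) unfolding continuous_at_eps_delta by blast
  obtain d2 where d2: "d2 > 0" "\<And>y. dist y x < d2 \<Longrightarrow> y \<in> U"
    using assms(2,3) unfolding open_dist by blast
  \<comment> \<open>The points carry one displacement along each of two axes, each allowed half of
    the radius.\<close>
  define \<delta> where "\<delta> = min d1 d2 / 2"
  have near: "dist (x + s *\<^sub>R axis i 1 + r *\<^sub>R axis j 1) x < min d1 d2"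
    if "\<bar>s\<bar> < \<delta>" "\<bar>r\<bar> < \<delta>" for s r
  proof -
    have "norm (s *\<^sub>R axis i 1 + r *\<^sub>R axis j 1 :: real ^ 'a) \<le> \<bar>s\<bar> + \<bar>r\<bar>"
      by (rule order_trans[OF norm_triangle_ineq]) simp
    then show ?thesis using that by (simp add: dist_norm \<delta>_def add.assoc)
  qed
  show ?thesis
  proof (intro exI[of _ \<delta>] conjI allI impI)
    show "\<delta> > 0" using d1 d2 by (simp add: \<delta>_def)
    fix h :: real
    assume h: "0 < h \<and> h < \<delta>"
    define q where "q s = g (x + s *\<^sub>R axis i 1 + h *\<^sub>R axis j 1) - g (x + s *\<^sub>R axis i 1)" for s
    have in_U: "x + s *\<^sub>R axis i 1 + r *\<^sub>R axis j 1 \<in> U" if "\<bar>s\<bar> < \<delta>" "\<bar>r\<bar> < \<delta>" for s r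
      using near[OF that] d2 by auto
    have "\<exists>s. 0 < s \<and> s < h \<and> q h - q 0 = (h - 0) * (partial_deriv i g (x + s *\<^sub>R axis i 1 + h *\<^sub>R axis j 1)
        - partial_deriv i g (x + s *\<^sub>R axis i 1))"
    proof (rule MVT2)
      fix s :: real assume s: "0 \<le> s" "s \<le> h"
      have e: "x + r *\<^sub>R axis i 1 + h *\<^sub>R axis j 1 = (x + h *\<^sub>R axis j 1) + r *\<^sub>R axis i 1" for r
        by simp
      have "has_partial_at i g (x + s *\<^sub>R axis i 1 + h *\<^sub>R axis j 1)" "has_partial_at i g (x + s *\<^sub>R axis i 1)"
        using g(1) in_U[of s h] in_U[of s 0] s h by auto
      then show "(q has_real_derivative partial_deriv i g (x + s *\<^sub>R axis i 1 + h *\<^sub>R axis j 1)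
          - partial_deriv i g (x + s *\<^sub>R axis i 1)) (at s)"
        unfolding q_def e by (intro DERIV_diff DERIV_partial_line)
    qed (use h in simp)
    then obtain s where s: "0 < s" "s < h" "q h - q 0 = h * (partial_deriv i g (x + s *\<^sub>R axis i 1 + h *\<^sub>R axis j 1)
        - partial_deriv i g (x + s *\<^sub>R axis i 1))" by auto
    have "\<exists>r. \<bar>r\<bar> \<le> \<bar>h\<bar> \<and> partial_deriv i g (x + s *\<^sub>R axis i 1 + h *\<^sub>R axis j 1) - partial_deriv i g (x + s *\<^sub>R axis i 1)
        = h * partial_deriv j (partial_deriv i g) (x + s *\<^sub>R axis i 1 + r *\<^sub>R axis j 1)"
      by (rule partial_deriv_mvt) (use g(2) in_U s h in auto)
    then obtain r where r: "\<bar>r\<bar> \<le> h" "q h - q 0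
        = h\<^sup>2 * partial_deriv j (partial_deriv i g) (x + s *\<^sub>R axis i 1 + r *\<^sub>R axis j 1)"
      using s h by (auto simp: power2_eq_square)
    have "dist (partial_deriv j (partial_deriv i g) (x + s *\<^sub>R axis i 1 + r *\<^sub>R axis j 1)) (partial_deriv j (partial_deriv i g) x) < e"
      using d1(2) near[of s r] s r h by auto
    moreover have "(q h - q 0) / h\<^sup>2 = partial_deriv j (partial_deriv i g) (x + s *\<^sub>R axis i 1 + r *\<^sub>R axis j 1)"
      using r(2) h by simp
    ultimately show "\<bar>(g (x + h *\<^sub>R axis i 1 + h *\<^sub>R axis j 1) - g (x + h *\<^sub>R axis i 1) - g (x + h *\<^sub>R axis j 1) + g x) / h\<^sup>2
      - partial_deriv j (partial_deriv i g) x\<bar> < e"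
      by (simp add: q_def dist_real_def algebra_simps)
  qed
qed

text \<open>The second difference quotient is symmetric in the two directions, while its limit is
  the mixed derivative in either order.\<close>

lemma partial_deriv_commute:
  assumes "open U" "x \<in> U" "C_diff 2 U g"
  shows "partial_deriv i (partial_deriv j g) x = partial_deriv j (partial_deriv i g) x"
proof -
  define Q where "Q i j h = (g (x + h *\<^sub>R axis i 1 + h *\<^sub>R axis j 1) - g (x + h *\<^sub>R axis i 1)
    - g (x + h *\<^sub>R axis j 1) + g x) / h\<^sup>2" for i j h
  have lim: "(Q i j \<longlongrightarrow> partial_deriv j (partial_deriv i g) x) (at_right 0)" for i j
    unfolding tendsto_iff
  proof (intro allI impI)
    fix e :: real assume "e > 0"
    from mixed_difference_mvt[OF this assms, of i j] obtain \<delta> where "\<delta> > 0"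
      "\<And>h. 0 < h \<Longrightarrow> h < \<delta> \<Longrightarrow> \<bar>Q i j h - partial_deriv j (partial_deriv i g) x\<bar> < e"
      unfolding Q_def by blast
    then show "eventually (\<lambda>h. dist (Q i j h) (partial_deriv j (partial_deriv i g) x) < e) (at_right 0)"
      unfolding eventually_at_right_field by (intro exI[of _ \<delta>]) (auto simp: dist_real_def)
  qed
  have "Q i j = Q j i" unfolding Q_def by (auto simp: fun_eq_iff add_ac)
  then show ?thesis
    using tendsto_unique[OF _ lim[of j i]] lim[of i j] by simp
qed

text \<open>One transposition per list entry suffices: \<open>i\<close> has reached the front of the
  tail and is swapped with \<open>a\<close>, both acting on a function that still has two continuous
  derivatives.\<close>

lemma iter_partial_move_front:
  assumes "open U" "C_diff k U g" "length (as @ i # bs) \<le> k" "x \<in> U"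
  shows "iter_partial (as @ i # bs) g x = iter_partial (i # as @ bs) g x"
  using assms(3,4)
proof (induction as arbitrary: x)
  case (Cons a as)
  let ?G = "iter_partial (as @ bs) g"
  have "iter_partial ((a # as) @ i # bs) g x = partial_deriv a (iter_partial (i # as @ bs) g) x"
    using Cons by (auto intro: partial_deriv_cong[OF assms(1)])
  also have "\<dots> = partial_deriv i (partial_deriv a ?G) x"
  proof -
    have "C_diff 2 U ?G"
      by (rule C_diff_mono[OF C_diff_iter_partial[OF assms(2)]]) (use Cons in auto)
    then show ?thesis using partial_deriv_commute[OF assms(1)] Cons by simp
  qed
  finally show ?case by simp
qed auto

text \<open>Makes the arbitrary choice of a list in \<open>mi_deriv\<close> harmless: only the
  number of occurrences of each coordinate matters.\<close>

lemma iter_partial_mset_cong: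
  assumes "open U" "C_diff k U g"
  shows "mset is = mset js \<Longrightarrow> length is \<le> k \<Longrightarrow> x \<in> U \<Longrightarrow> iter_partial is g x = iter_partial js g x"
proof (induction "is" arbitrary: js x)
  case (Cons i "is")
  then obtain as bs where js: "js = as @ i # bs"
    by (metis list.set_intros(1) mset_eq_setD split_list)
  have len: "length js = Suc (length is)" using mset_eq_length[OF Cons.prems(1)] by simp
  have "iter_partial (i # is) g x = partial_deriv i (iter_partial (as @ bs) g) x"
    unfolding iter_partial.simps
    by (rule partial_deriv_cong[OF assms(1) Cons.prems(3)]) (use Cons js in auto)
  also have "\<dots> = iter_partial js g x"
    unfolding js using iter_partial_move_front[OF assms, of as i bs x] Cons.prems len js by simp
  finally show ?case .
qed auto

text \<open>The \<open>k\<close>-linear form with coefficients \<open>P\<close>; applied to the partial derivatives of order \<open>k\<close>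
  it is the iterated directional derivative, the head of the list being the outermost direction.\<close>

fun multilin :: "(real ^ 'd::finite) list \<Rightarrow> ('d list \<Rightarrow> real) \<Rightarrow> real"
  where
    "multilin [] P = P []"
  | "multilin (w # ws) P = (\<Sum>i\<in>UNIV. w $ i * multilin ws (\<lambda>is. P (i # is)))"

abbreviation dir_deriv :: "(real ^ 'd::finite) list \<Rightarrow> (real ^ 'd \<Rightarrow> real) \<Rightarrow> real ^ 'd \<Rightarrow> real"
  where "dir_deriv ws g x \<equiv> multilin ws (\<lambda>is. iter_partial is g x)"

text \<open>The norm under which a multilinear form is bounded by its largest coefficient times the
  product of the norms of its arguments.\<close>

definition l1_norm :: "real ^ 'd::finite \<Rightarrow> real" where "l1_norm w = (\<Sum>i\<in>UNIV. \<bar>w $ i\<bar>)"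

lemma l1_norm_nonneg [simp]: "0 \<le> l1_norm w"
  by (simp add: l1_norm_def sum_nonneg)

lemma l1_norm_le: "l1_norm (w :: real ^ 'd::finite) \<le> CARD('d) * norm w"
  unfolding l1_norm_def using sum_bounded_above[of UNIV "\<lambda>i. \<bar>w $ i\<bar>" "norm w"] component_le_norm_cart by auto

lemma multilin_bound:
  assumes "\<And>is. length is = length ws \<Longrightarrow> \<bar>P is\<bar> \<le> e"
  shows "\<bar>multilin ws P\<bar> \<le> prod_list (map l1_norm ws) * e"
  using assms
proof (induction ws arbitrary: P)
  case (Cons w ws)
  have "\<bar>multilin (w # ws) P\<bar> \<le> (\<Sum>i\<in>UNIV. \<bar>w $ i\<bar> * (prod_list (map l1_norm ws) * e))"
    unfolding multilin.simps
    by (rule order_trans[OF sum_abs sum_mono]) (auto simp: abs_mult intro!: mult_left_mono Cons)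
  also have "\<dots> = prod_list (map l1_norm (w # ws)) * e"
    by (simp add: l1_norm_def sum_distrib_right sum_distrib_left mult_ac)
  finally show ?case .
qed auto

lemma multilin_diff: "multilin ws P - multilin ws Q = multilin ws (\<lambda>is. P is - Q is)"
proof (induction ws arbitrary: P Q)
  case (Cons w ws)
  show ?case unfolding multilin.simps sum_subtractf[symmetric] right_diff_distrib[symmetric] Cons ..
qed simp

lemma multilin_sum: "multilin ws (\<lambda>is. \<Sum>i\<in>A. c i * P i is) = (\<Sum>i\<in>A. c i * multilin ws (P i))"
proof (induction ws arbitrary: P)
  case (Cons w ws)
  have "(\<Sum>j\<in>UNIV. w $ j * (\<Sum>i\<in>A. c i * multilin ws (\<lambda>is. P i (j # is))))
    = (\<Sum>i\<in>A. \<Sum>j\<in>UNIV. c i * (w $ j * multilin ws (\<lambda>is. P i (j # is))))"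
    unfolding sum_distrib_left by (subst sum.swap) (simp only: mult.left_commute)
  then show ?case by (simp add: Cons sum_distrib_left)
qed auto

lemma multilin_DERIV:
  assumes "\<And>is. length is = length ws \<Longrightarrow> ((F is) has_real_derivative G is) (at s)"
  shows "((\<lambda>s. multilin ws (\<lambda>is. F is s)) has_real_derivative multilin ws G) (at s)"
  using assms
proof (induction ws arbitrary: F G)
  case (Cons w ws)
  show ?case unfolding multilin.simps
    by (intro DERIV_sum DERIV_cmult Cons.IH Cons.prems) auto
qed auto

text \<open>Differentiation along \<open>v\<close> acts on each coefficient of the form; by
  linearity the sum over the new coordinate is pulled out as a new first argument.\<close>

lemma dir_deriv_DERIV:
  fixes g :: "real ^ 'd::finite \<Rightarrow> real"
  assumes "open U" "x + s *\<^sub>R v \<in> U" "C_diff k U g" "length ws < k"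
  shows "((\<lambda>s. dir_deriv ws g (x + s *\<^sub>R v)) has_real_derivative dir_deriv (v # ws) g (x + s *\<^sub>R v)) (at s)"
proof -
  have "((\<lambda>s. dir_deriv ws g (x + s *\<^sub>R v)) has_real_derivative
      multilin ws (\<lambda>is. \<Sum>i\<in>UNIV. v $ i * iter_partial (i # is) g (x + s *\<^sub>R v))) (at s)"
  proof (rule multilin_DERIV)
    fix "is" :: "'d list"
    assume "length is = length ws"
    then have "C_diff (Suc 0) U (iter_partial is g)"
      using assms(4) by (intro C_diff_mono[OF C_diff_iter_partial[OF assms(3)]]) auto
    then show "((\<lambda>s. iter_partial is g (x + s *\<^sub>R v)) has_real_derivative
        (\<Sum>i\<in>UNIV. v $ i * iter_partial (i # is) g (x + s *\<^sub>R v))) (at s)"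
      unfolding iter_partial.simps by (rule C_diff_DERIV_line[OF assms(1,2)])
  qed
  then show ?thesis by (simp add: multilin_sum)
qed

lemma multilin_replicate_scaleR: "multilin (replicate n (s *\<^sub>R w)) P = s ^ n * multilin (replicate n w) P"
  by (induction n arbitrary: P) (simp_all add: sum_distrib_left mult_ac)

lemma multilin_replicate_uminus: "multilin (replicate n (- w)) P = (- 1) ^ n * multilin (replicate n w) P"
  using multilin_replicate_scaleR[of n "-1" w P] by simp

lemma multilin_continuous: "continuous_on A (\<lambda>w. multilin (replicate n w) P)"
  by (induction n arbitrary: P) (auto intro!: continuous_intros)

lemma multilin_replicate:
  "multilin (replicate n w) P = (\<Sum>is | length is = n. prod_list (map (($) w) is) * P is)"
proof (induction n arbitrary: P)
  case (Suc n)
  have eq: "{is. length is = Suc n} = (\<lambda>(i, is). i # is) ` (UNIV \<times> {is :: 'a list. length is = n})"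
    by (auto simp: length_Suc_conv image_iff)
  have "(\<Sum>is | length is = Suc n. prod_list (map (($) w) is) * P is)
    = (\<Sum>(i, is)\<in>UNIV \<times> {is. length is = n}. prod_list (map (($) w) (i # is)) * P (i # is))"
    unfolding eq by (subst sum.reindex) (auto simp: inj_on_def intro!: sum.cong)
  also have "\<dots> = (\<Sum>i\<in>UNIV. \<Sum>is | length is = n. w $ i * (prod_list (map (($) w) is) * P (i # is)))"
    by (simp add: sum.cartesian_product mult.assoc)
  finally show ?case
    by (simp add: Suc sum_distrib_left)
qed auto

section \<open>Taylor expansion of the reciprocal square root of a density\<close>

lemma bigo_1_mult: "f \<in> O[F](\<lambda>_. 1 :: real) \<Longrightarrow> g \<in> O[F](\<lambda>_. 1) \<Longrightarrow> (\<lambda>x. f x * g x) \<in> O[F](\<lambda>_. 1)"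
  using landau_o.big.mult[of f F "\<lambda>_. 1" g "\<lambda>_. 1"] by simp

lemma bigo_1_power: "f \<in> O[F](\<lambda>_. 1 :: real) \<Longrightarrow> (\<lambda>x. f x ^ n) \<in> O[F](\<lambda>_. 1)"
  by (induction n) (auto intro: bigo_1_mult)

lemmas bigo_1_intros = bigo_1_mult bigo_1_power sum_in_bigo

text \<open>Here \<open>B\<close> is the Taylor polynomial of \<open>b = f\<^sup>-\<^sup>1\<^sup>/\<^sup>2\<close> along a ray, \<open>r\<close> the distance and
  \<open>D = B - r B'\<close>. By Lagrange inversion of \<open>y = r / b(r)\<close>, the coefficient of \<open>y\<^sup>n\<close> in
  \<open>f dr/dy \<cdot> b\<^sup>-\<^sup>1\<close> is the coefficient of \<open>r\<^sup>n\<close> in \<open>b\<^sup>n\<^sup>-\<^sup>2\<close>; the one of order 2 vanishes.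
  The statement clears all denominators. The factor \<open>Q\<close> is the quotient of the left-hand side by \<open>r\<^sup>5\<close>.\<close>

lemma lagrange_remainder:
  fixes b0 b1 b2 b3 b4 r :: "'a \<Rightarrow> real"
  assumes O: "b0 \<in> O[F](\<lambda>_. 1)" "b1 \<in> O[F](\<lambda>_. 1)" "b2 \<in> O[F](\<lambda>_. 1)" "b3 \<in> O[F](\<lambda>_. 1)"
      "b4 \<in> O[F](\<lambda>_. 1)" "r \<in> O[F](\<lambda>_. 1)"
    and B: "\<And>x. B x = b0 x + r x * b1 x + r x ^ 2 * b2 x + r x ^ 3 * b3 x + r x ^ 4 * b4 x"
    and D: "\<And>x. D x = b0 x - r x ^ 2 * b2 x - 2 * r x ^ 3 * b3 x - 3 * r x ^ 4 * b4 x"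
  shows "(\<lambda>x. b0 x ^ 2 * B x ^ 3 - (B x ^ 4 - r x * b1 x * B x ^ 3 + b0 x ^ 2 * (r x ^ 3 * b3 x) * B x
      + b0 x ^ 2 * (r x ^ 4 * (2 * b0 x * b4 x + 2 * b1 x * b3 x + b2 x ^ 2))) * D x) \<in> O[F](\<lambda>x. r x ^ 5)"
proof -
  define Q where "Q b0 b1 b2 b3 b4 r = (3 * b0^2 * b1 * b2^2 + 3 * b0^2 * b1^2 * b3 + 6 * b0^3 * b2 * b3 + 6 * b0^3 * b1 * b4 + r * (3 * b0 * b1^2 *
b2^2 + b0 * b1^3 * b3 + 4 * b0^2 * b2^3 + 18 * b0^2 * b1 * b2 * b3 + 6 * b0^2 * b1^2 * b4 + 6 * b0^3 * b3^2 +
12 * b0^3 * b2 * b4 + r * (b1^3 * b2^2 + 6 * b0 * b1 * b2^3 + 12 * b0 * b1^2 * b2 * b3 + 2 * b0 * b1^3 * b4 +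
18 * b0^2 * b2^2 * b3 + 18 * b0^2 * b1 * b3^2 + 24 * b0^2 * b1 * b2 * b4 + 20 * b0^3 * b3 * b4 + r * (3 * b1^2
* b2^3 + 3 * b1^3 * b2 * b3 + 3 * b0 * b2^4 + 27 * b0 * b1 * b2^2 * b3 + 9 * b0 * b1^2 * b3^2 + 18 * b0 * b1^2
* b2 * b4 + 24 * b0^2 * b2 * b3^2 + 24 * b0^2 * b2^2 * b4 + 42 * b0^2 * b1 * b3 * b4 + 15 * b0^3 * b4^2 + r *
(3 * b1 * b2^4 + 12 * b1^2 * b2^2 * b3 + 2 * b1^3 * b3^2 + 4 * b1^3 * b2 * b4 + 16 * b0 * b2^3 * b3 + 36 * b0
* b1 * b2 * b3^2 + 36 * b0 * b1 * b2^2 * b4 + 24 * b0 * b1^2 * b3 * b4 + 11 * b0^2 * b3^3 + 58 * b0^2 * b2 *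
b3 * b4 + 21 * b0^2 * b1 * b4^2 + r * (b2^5 + 15 * b1 * b2^3 * b3 + 15 * b1^2 * b2 * b3^2 + 15 * b1^2 * b2^2 *
b4 + 5 * b1^3 * b3 * b4 + 30 * b0 * b2^2 * b3^2 + 20 * b0 * b2^3 * b4 + 15 * b0 * b1 * b3^3 + 90 * b0 * b1 *
b2 * b3 * b4 + 15 * b0 * b1^2 * b4^2 + 38 * b0^2 * b3^2 * b4 + 33 * b0^2 * b2 * b4^2 + r * (6 * b2^4 * b3 + 27
* b1 * b2^2 * b3^2 + 18 * b1 * b2^3 * b4 + 6 * b1^2 * b3^3 + 36 * b1^2 * b2 * b3 * b4 + 3 * b1^3 * b4^2 + 24 *
b0 * b2 * b3^3 + 72 * b0 * b2^2 * b3 * b4 + 54 * b0 * b1 * b3^2 * b4 + 54 * b0 * b1 * b2 * b4^2 + 42 * b0^2 *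
b3 * b4^2 + r * (14 * b2^3 * b3^2 + 7 * b2^4 * b4 + 21 * b1 * b2 * b3^3 + 63 * b1 * b2^2 * b3 * b4 + 21 * b1^2
* b3^2 * b4 + 21 * b1^2 * b2 * b4^2 + 7 * b0 * b3^4 + 84 * b0 * b2 * b3^2 * b4 + 42 * b0 * b2^2 * b4^2 + 63 *
b0 * b1 * b3 * b4^2 + 15 * b0^2 * b4^3 + r * (16 * b2^2 * b3^3 + 32 * b2^3 * b3 * b4 + 6 * b1 * b3^4 + 72 * b1
* b2 * b3^2 * b4 + 36 * b1 * b2^2 * b4^2 + 24 * b1^2 * b3 * b4^2 + 32 * b0 * b3^3 * b4 + 96 * b0 * b2 * b3 *
b4^2 + 24 * b0 * b1 * b4^3 + r * (9 * b2 * b3^4 + 54 * b2^2 * b3^2 * b4 + 18 * b2^3 * b4^2 + 27 * b1 * b3^3 *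
b4 + 81 * b1 * b2 * b3 * b4^2 + 9 * b1^2 * b4^3 + 54 * b0 * b3^2 * b4^2 + 36 * b0 * b2 * b4^3 + r * (2 * b3^5
+ 40 * b2 * b3^3 * b4 + 60 * b2^2 * b3 * b4^2 + 45 * b1 * b3^2 * b4^2 + 30 * b1 * b2 * b4^3 + 40 * b0 * b3 *
b4^3 + r * (11 * b3^4 * b4 + 66 * b2 * b3^2 * b4^2 + 22 * b2^2 * b4^3 + 33 * b1 * b3 * b4^3 + 11 * b0 * b4^4 +
r * (24 * b3^3 * b4^2 + 48 * b2 * b3 * b4^3 + 9 * b1 * b4^4 + r * (26 * b3^2 * b4^3 + 13 * b2 * b4^4 + r * (14
* b3 * b4^4 + r * (3 * b4^5))))))))))))))))" for b0 b1 b2 b3 b4 r :: real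
  have id: "b0^2 * (b0 + r * b1 + r^2 * b2 + r^3 * b3 + r^4 * b4)^3
    - ((b0 + r * b1 + r^2 * b2 + r^3 * b3 + r^4 * b4)^4
       - r * b1 * (b0 + r * b1 + r^2 * b2 + r^3 * b3 + r^4 * b4)^3
       + b0^2 * (r^3 * b3) * (b0 + r * b1 + r^2 * b2 + r^3 * b3 + r^4 * b4)
       + b0^2 * (r^4 * (2 * b0 * b4 + 2 * b1 * b3 + b2^2)))
      * (b0 - r^2 * b2 - 2 * r^3 * b3 - 3 * r^4 * b4)
   = r^5 * Q b0 b1 b2 b3 b4 r" for b0 b1 b2 b3 b4 r :: real
    unfolding Q_def by algebra
  have "(\<lambda>x. Q (b0 x) (b1 x) (b2 x) (b3 x) (b4 x) (r x)) \<in> O[F](\<lambda>_. 1)"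
    unfolding Q_def by (intro bigo_1_intros O) simp_all
  from landau_o.big.mult[OF landau_o.big_refl[of "\<lambda>x. r x ^ 5"] this] show ?thesis
    unfolding B D id by simp
qed

text \<open>Factors are replaced one at a time:
  \<open>f g - f' g' = (f - f') g + f' (g - g')\<close>. With the rules for sums and powers this
  carries the errors of Taylor polynomials through any polynomial expression.\<close>

lemma smallo_diff_mult:
  fixes f f' g g' :: "'a \<Rightarrow> real"
  assumes "(\<lambda>x. f x - f' x) \<in> o[F](h)" "(\<lambda>x. g x - g' x) \<in> o[F](h)"
    and "g \<in> O[F](\<lambda>_. 1)" "f' \<in> O[F](\<lambda>_. 1)"
  shows "(\<lambda>x. f x * g x - f' x * g' x) \<in> o[F](h)"
proof -
  have "(\<lambda>x. (f x - f' x) * g x + f' x * (g x - g' x)) \<in> o[F](h)"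
    using landau_o.small_big_mult[OF assms(1,3)] landau_o.big_small_mult[OF assms(4,2)]
    by (intro sum_in_smallo) simp_all
  then show ?thesis by (simp add: algebra_simps)
qed

lemma smallo_diff_add:
  assumes "(\<lambda>x. f x - f' x) \<in> o[F](h)" "(\<lambda>x. g x - g' x) \<in> o[F](h)"
  shows "(\<lambda>x. f x + g x - (f' x + g' x :: real)) \<in> o[F](h)"
  using sum_in_smallo(1)[OF assms] by (simp add: algebra_simps)

lemma smallo_diff_diff:
  assumes "(\<lambda>x. f x - f' x) \<in> o[F](h)" "(\<lambda>x. g x - g' x) \<in> o[F](h)"
  shows "(\<lambda>x. f x - g x - (f' x - g' x :: real)) \<in> o[F](h)"
  using sum_in_smallo(2)[OF assms] by (simp add: algebra_simps)

lemma smallo_diff_power: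
  fixes f f' :: "'a \<Rightarrow> real"
  assumes "(\<lambda>x. f x - f' x) \<in> o[F](h)" "f \<in> O[F](\<lambda>_. 1)" "f' \<in> O[F](\<lambda>_. 1)"
  shows "(\<lambda>x. f x ^ n - f' x ^ n) \<in> o[F](h)"
proof (induction n)
  case (Suc n)
  from smallo_diff_mult[OF assms(1) this bigo_1_power[OF assms(2)] assms(3)] show ?case by simp
qed simp

lemma bigo_1_of_smallo_diff:
  fixes f f' :: "'a \<Rightarrow> real"
  assumes "(\<lambda>x. f x - f' x) \<in> o[F](h)" "f' \<in> O[F](\<lambda>_. 1)" "h \<in> O[F](\<lambda>_. 1)"
  shows "f \<in> O[F](\<lambda>_. 1)"
proof -
  have "(\<lambda>x. f x - f' x) \<in> O[F](\<lambda>_. 1)"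
    by (rule landau_o.big_trans[OF landau_o.small_imp_big[OF assms(1)] assms(3)])
  from sum_in_bigo(1)[OF this assms(2)] show ?thesis by simp
qed

lemma smallo_refl_diff: "(\<lambda>x. f x - f x :: real) \<in> o[F](h)"
  by simp

text \<open>The homogeneous part of degree \<open>n\<close> of the Taylor polynomial of
  \<open>g\<close> at \<open>t\<close>, as a polynomial in the displacement
  \<open>w\<close>.\<close>

definition dir_taylor :: "nat \<Rightarrow> (real ^ 'd::finite \<Rightarrow> real) \<Rightarrow> real ^ 'd \<Rightarrow> real ^ 'd \<Rightarrow> real"
  where "dir_taylor n g t w = dir_deriv (replicate n w) g t / fact n"

lemma dir_taylor_0 [simp]: "dir_taylor 0 g t w = g t"
  by (simp add: dir_taylor_def)

lemma dir_taylor_scaleR: "dir_taylor n g t (s *\<^sub>R w) = s ^ n * dir_taylor n g t w"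
  by (simp add: dir_taylor_def multilin_replicate_scaleR)

lemma dir_taylor_uminus: "dir_taylor n g t (- w) = (- 1) ^ n * dir_taylor n g t w"
  by (simp add: dir_taylor_def multilin_replicate_uminus)

lemma continuous_on_dir_taylor: "continuous_on A (dir_taylor n g t)"
  unfolding dir_taylor_def by (intro continuous_intros multilin_continuous) simp

lemma dir_taylor_bound:
  fixes g :: "real ^ 'd::finite \<Rightarrow> real"
  shows "\<exists>C\<ge>0. \<forall>w. \<bar>dir_taylor n g t w\<bar> \<le> C * norm w ^ n"
proof -
  define M where "M = (\<Sum>is\<in>{is :: 'd list. length is = n}. \<bar>iter_partial is g t\<bar>)"
  have fin: "finite {is :: 'd list. length is = n}"
    using finite_lists_length_eq[of "UNIV :: 'd set" n] by simp
  have M: "\<bar>iter_partial is g t\<bar> \<le> M" if "length is = n" for "is"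
    unfolding M_def by (rule member_le_sum) (use that fin in auto)
  have M0: "M \<ge> 0" unfolding M_def by (simp add: sum_nonneg)
  show ?thesis
  proof (intro exI[of _ "CARD('d) ^ n * M"] conjI allI)
    fix w :: "real ^ 'd"
    have "\<bar>dir_taylor n g t w\<bar> \<le> \<bar>dir_deriv (replicate n w) g t\<bar>"
      by (simp add: dir_taylor_def divide_le_eq mult_left_le abs_mult mult_le_cancel_left1)
    also have "\<dots> \<le> l1_norm w ^ n * M"
      using multilin_bound[of "replicate n w" "\<lambda>is. iter_partial is g t" M] M by (simp add: prod_list_replicate)
    also have "\<dots> \<le> (CARD('d) * norm w) ^ n * M"
      by (intro mult_right_mono power_mono l1_norm_le M0 l1_norm_nonneg)
    finally show "\<bar>dir_taylor n g t w\<bar> \<le> CARD('d) ^ n * M * norm w ^ n"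
      by (simp add: power_mult_distrib mult_ac)
  qed (use M0 in auto)
qed

lemma dir_deriv_taylor:
  fixes g :: "real ^ 'd::finite \<Rightarrow> real"
  assumes "open U" "\<And>s. 0 \<le> s \<Longrightarrow> s \<le> 1 \<Longrightarrow> x + s *\<^sub>R w \<in> U" "C_diff k U g" "n + length ws \<le> k" "0 < n"
  shows "\<exists>\<xi>. 0 \<le> \<xi> \<and> \<xi> \<le> 1 \<and> dir_deriv ws g (x + w) =
    (\<Sum>m<n. dir_deriv (replicate m w @ ws) g x / fact m) + dir_deriv (replicate n w @ ws) g (x + \<xi> *\<^sub>R w) / fact n"
proof -
  have "\<exists>\<xi>>0. \<xi> < 1 \<and> dir_deriv ws g (x + 1 *\<^sub>R w) =
    (\<Sum>m<n. dir_deriv (replicate m w @ ws) g (x + 0 *\<^sub>R w) / fact m * 1 ^ m)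
    + dir_deriv (replicate n w @ ws) g (x + \<xi> *\<^sub>R w) / fact n * 1 ^ n"
  proof (rule Maclaurin)
    show "\<forall>m s. m < n \<and> 0 \<le> s \<and> s \<le> 1 \<longrightarrow>
      ((\<lambda>s. dir_deriv (replicate m w @ ws) g (x + s *\<^sub>R w)) has_real_derivative
        dir_deriv (replicate (Suc m) w @ ws) g (x + s *\<^sub>R w)) (at s)"
    proof (intro allI impI)
      fix m and s :: real
      assume "m < n \<and> 0 \<le> s \<and> s \<le> 1"
      then show "((\<lambda>s. dir_deriv (replicate m w @ ws) g (x + s *\<^sub>R w)) has_real_derivative
        dir_deriv (replicate (Suc m) w @ ws) g (x + s *\<^sub>R w)) (at s)"
        using dir_deriv_DERIV[OF assms(1) assms(2) assms(3), of s "replicate m w @ ws"] assms(4) by simp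
    qed
  qed (use assms in auto)
  then show ?thesis by (auto intro: less_imp_le)
qed

text \<open>The remainder compares derivatives of the top order \<open>k\<close> at an intermediate
  point and at \<open>t\<close>; continuity makes the difference small, so no derivative beyond
  order \<open>k\<close> enters. The case \<open>j = 1\<close> expands the radial derivative that
  occurs in the Jacobian.\<close>

lemma dir_deriv_taylor_smallo:
  fixes g :: "real ^ 'd::finite \<Rightarrow> real"
  assumes U: "open U" "t \<in> U" and g: "C_diff k U g" and k: "n + j = k" "0 < n"
  shows "(\<lambda>w. dir_deriv (replicate j w) g (t + w) - (\<Sum>m\<le>n. dir_deriv (replicate (m + j) w) g t / fact m))
    \<in> o[at 0](\<lambda>w. norm w ^ k)"
proof (rule landau_o.smallI)
  fix c :: real
  assume c: "c > 0"
  \<comment> \<open>Top-order forms are bounded by \<open>l1_norm w ^ k * e\<close>, and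
    \<open>l1_norm w\<close> by the dimension times \<open>norm w\<close>.\<close>
  define e where "e = c / CARD('d) ^ k"
  have e: "e > 0" using c by (simp add: e_def)
  have fin: "finite {is :: 'd list. length is = k}"
    using finite_lists_length_eq[of "UNIV :: 'd set" k] by simp
  have "\<forall>is\<in>{is :: 'd list. length is = k}. eventually (\<lambda>y. dist (iter_partial is g y) (iter_partial is g t) < e) (nhds t)"
  proof
    fix "is" :: "'d list"
    assume "is \<in> {is. length is = k}"
    then have "continuous_on U (iter_partial is g)"
      using C_diff_iter_partial[OF g, of "is"] by simp
    then have "isCont (iter_partial is g) t"
      using U continuous_on_eq_continuous_at by blast
    then have "((iter_partial is g) \<longlongrightarrow> iter_partial is g t) (nhds t)"
      unfolding isCont_def tendsto_at_iff_tendsto_nhds .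
    then show "eventually (\<lambda>y. dist (iter_partial is g y) (iter_partial is g t) < e) (nhds t)"
      using e tendstoD by blast
  qed
  then have "eventually (\<lambda>y. y \<in> U \<and> (\<forall>is\<in>{is :: 'd list. length is = k}. dist (iter_partial is g y) (iter_partial is g t) < e)) (nhds t)"
    using U by (intro eventually_conj eventually_ball_finite[OF fin] eventually_nhds_in_open) auto
  then obtain \<delta> where \<delta>: "\<delta> > 0" "\<And>y is. dist y t < \<delta> \<Longrightarrow> y \<in> U"
    "\<And>y is. dist y t < \<delta> \<Longrightarrow> length is = k \<Longrightarrow> dist (iter_partial is g y) (iter_partial is g t) < e"
    unfolding eventually_nhds_metric by auto
  show "eventually (\<lambda>w. norm (dir_deriv (replicate j w) g (t + w) - (\<Sum>m\<le>n. dir_deriv (replicate (m + j) w) g t / fact m))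
      \<le> c * norm (norm w ^ k)) (at 0)"
    unfolding eventually_at
  proof (intro exI[of _ \<delta>] conjI ballI impI \<delta>(1))
    fix w :: "real ^ 'd"
    assume "w \<noteq> 0 \<and> dist w 0 < \<delta>"
    then have w: "norm w < \<delta>" by simp
    have near: "dist (t + s *\<^sub>R w) t < \<delta>" if "0 \<le> s" "s \<le> 1" for s
    proof -
      have "\<bar>s\<bar> * norm w \<le> 1 * norm w" by (rule mult_right_mono) (use that in auto)
      then show ?thesis using w by (simp add: dist_norm)
    qed
    have "\<exists>\<xi>. 0 \<le> \<xi> \<and> \<xi> \<le> 1 \<and> dir_deriv (replicate j w) g (t + w) =
      (\<Sum>m<n. dir_deriv (replicate m w @ replicate j w) g t / fact m)
      + dir_deriv (replicate n w @ replicate j w) g (t + \<xi> *\<^sub>R w) / fact n"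
      by (rule dir_deriv_taylor[OF U(1) \<delta>(2)[OF near] g]) (use k in auto)
    then obtain \<xi> where \<xi>: "0 \<le> \<xi>" "\<xi> \<le> 1" "dir_deriv (replicate j w) g (t + w) =
      (\<Sum>m<n. dir_deriv (replicate (m + j) w) g t / fact m)
      + dir_deriv (replicate k w) g (t + \<xi> *\<^sub>R w) / fact n"
      using k by (auto simp: replicate_add[symmetric])
    have "(\<Sum>m\<le>n. dir_deriv (replicate (m + j) w) g t / fact m)
      = (\<Sum>m<n. dir_deriv (replicate (m + j) w) g t / fact m) + dir_deriv (replicate k w) g t / fact n"
      using k by (simp add: lessThan_Suc_atMost[symmetric])
    then have "norm (dir_deriv (replicate j w) g (t + w) - (\<Sum>m\<le>n. dir_deriv (replicate (m + j) w) g t / fact m))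
      = \<bar>dir_deriv (replicate k w) g (t + \<xi> *\<^sub>R w) - dir_deriv (replicate k w) g t\<bar> / fact n"
      using \<xi>(3) by (simp add: diff_divide_distrib[symmetric])
    also have "\<dots> \<le> \<bar>dir_deriv (replicate k w) g (t + \<xi> *\<^sub>R w) - dir_deriv (replicate k w) g t\<bar>"
      by (simp add: divide_le_eq mult_left_le mult_le_cancel_left1)
    also have "\<dots> \<le> l1_norm w ^ k * e"
      unfolding multilin_diff
      using multilin_bound[of "replicate k w" "\<lambda>is. iter_partial is g (t + \<xi> *\<^sub>R w) - iter_partial is g t" e]
        \<delta>(3)[OF near[OF \<xi>(1,2)]] by (simp add: prod_list_replicate dist_real_def less_imp_le)
    also have "\<dots> \<le> (CARD('d) * norm w) ^ k * e"
      by (intro mult_right_mono power_mono l1_norm_le l1_norm_nonneg) (use e in auto)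
    also have "\<dots> = c * norm (norm w ^ k)"
      by (simp add: power_mult_distrib e_def)
    finally show "norm (dir_deriv (replicate j w) g (t + w) - (\<Sum>m\<le>n. dir_deriv (replicate (m + j) w) g t / fact m))
      \<le> c * norm (norm w ^ k)" .
  qed
qed

section \<open>Lagrange inversion along the rays through \<open>t\<close>\<close>

lemma dir_taylor_ratio_bigo:
  "(\<lambda>w. dir_taylor n g t w / norm w ^ n) \<in> O[F](\<lambda>_. 1)"
proof -
  obtain C where C: "C \<ge> 0" "\<And>w. \<bar>dir_taylor n g t w\<bar> \<le> C * norm w ^ n"
    using dir_taylor_bound by blast
  have "\<bar>dir_taylor n g t w\<bar> / norm w ^ n \<le> C" for w
  proof (cases "norm w ^ n = 0")
    case False
    then have "norm w ^ n > 0" using zero_le_power[OF norm_ge_zero, of w n] by linarith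
    then show ?thesis using C(2)[of w] by (simp add: pos_divide_le_eq)
  qed (simp add: C(1) del: power_eq_0_iff)
  then show ?thesis by (intro bigoI[of _ C]) (simp add: abs_divide)
qed

lemma dir_taylor_eq_norm_power:
  "dir_taylor n g t w = norm w ^ n * (dir_taylor n g t w / norm w ^ n)"
proof (cases "norm w ^ n = 0")
  case True
  then have "w = 0" "n \<noteq> 0" by auto
  with dir_taylor_scaleR[of n g t 0 w] show ?thesis by (simp add: power_0_left)
qed simp

text \<open>Multiplication by \<open>b (t + w) ^ 5 * b t ^ 2\<close> turns the claim into a
  statement about polynomials. There \<open>b\<close> and its radial derivative may be replaced by
  their Taylor polynomials, and \<open>lagrange_remainder\<close> with \<open>norm w\<close> as
  radius finishes; the coefficients \<open>\<beta> n\<close> vary with the direction but stay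
  bounded.\<close>

lemma rsqrt_expansion_remainder:
  fixes b :: "real ^ 'd::finite \<Rightarrow> real"
  assumes U: "open U" "t \<in> U" and b: "C_diff 4 U b" and pos: "b t > 0"
  shows "(\<lambda>w. 1 / b (t + w) ^ 2 - (1 / b t ^ 2 - dir_taylor 1 b t w / b t ^ 2 / b (t + w) + dir_taylor 3 b t w / b (t + w) ^ 3
      + (2 * b t * dir_taylor 4 b t w + 2 * dir_taylor 1 b t w * dir_taylor 3 b t w + dir_taylor 2 b t w ^ 2) / b (t + w) ^ 4)
      * (1 - dir_deriv [w] b (t + w) / b (t + w))) \<in> o[at 0](\<lambda>w. norm w ^ 4)"
proof -
  define T where "T n = dir_taylor n b t" for n
  define \<beta> where "\<beta> n w = T n w / norm w ^ n" for n w
  have T: "T n w = norm w ^ n * \<beta> n w" for n w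
    unfolding \<beta>_def T_def by (rule dir_taylor_eq_norm_power)
  have \<beta>_O: "\<beta> n \<in> O[at 0](\<lambda>_. 1)" for n
    unfolding \<beta>_def T_def by (rule dir_taylor_ratio_bigo)
  define B where "B w = T 0 w + T 1 w + T 2 w + T 3 w + T 4 w" for w
  define D where "D w = T 0 w - T 2 w - 2 * T 3 w - 3 * T 4 w" for w
  define f where "f w = b (t + w)" for w
  define c where "c w = dir_deriv [w] b (t + w)" for w
  \<comment> \<open>The first factor of the product in the claim times
    \<open>b t ^ 2 * x ^ 4\<close>, where \<open>x\<close> stands for
    \<open>b (t + w)\<close>.\<close>
  define S where "S x w = x ^ 4 - T 1 w * x ^ 3 + b t ^ 2 * T 3 w * x
    + b t ^ 2 * (2 * b t * T 4 w + 2 * T 1 w * T 3 w + T 2 w ^ 2)" for x w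
  have norm_O: "(\<lambda>w :: real ^ 'd. norm w) \<in> O[at 0](\<lambda>_. 1)"
    by (rule bigoI_tendsto[of _ _ 0]) (auto intro!: tendsto_eq_intros)
  have T_O: "T n \<in> O[at 0](\<lambda>_. 1)" for n
    unfolding T[abs_def] by (intro bigo_1_intros norm_O \<beta>_O)
  have B_O: "B \<in> O[at 0](\<lambda>_. 1)" and D_O: "D \<in> O[at 0](\<lambda>_. 1)"
    unfolding B_def[abs_def] D_def[abs_def] by (intro bigo_1_intros T_O; simp)+
  have f_lim: "(f \<longlongrightarrow> b t) (at 0)"
  proof -
    have "isCont b t"
      using C_diff_imp_continuous_on[OF b] U continuous_on_eq_continuous_at by blast
    then show ?thesis unfolding f_def isCont_def by (rule LIM_offset_zero)
  qed
  have f_O: "f \<in> O[at 0](\<lambda>_. 1)"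
    by (rule bigoI_tendsto[of _ _ "b t"]) (use f_lim in auto)
  have fB: "(\<lambda>w. f w - B w) \<in> o[at 0](\<lambda>w. norm w ^ 4)"
    using dir_deriv_taylor_smallo[OF U b, of 4 0]
    by (simp add: f_def B_def T_def dir_taylor_def eval_nat_numeral sum.atMost_Suc add_ac del: fact_Suc)
  \<comment> \<open>The radial derivative multiplies the part of degree \<open>n\<close> by
    \<open>n\<close>; hence the linear part cancels in \<open>D\<close>.\<close>
  have "(\<lambda>w. c w - (T 1 w + 2 * T 2 w + 3 * T 3 w + 4 * T 4 w)) \<in> o[at 0](\<lambda>w. norm w ^ 4)"
    using dir_deriv_taylor_smallo[OF U b, of 3 1]
    by (simp add: c_def T_def dir_taylor_def eval_nat_numeral add_ac)
  from sum_in_smallo(2)[OF fB this]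
  have gD: "(\<lambda>w. (f w - c w) - D w) \<in> o[at 0](\<lambda>w. norm w ^ 4)"
    by (simp add: B_def D_def algebra_simps)
  have g_O: "(\<lambda>w. f w - c w) \<in> O[at 0](\<lambda>_. 1)"
    by (rule bigo_1_of_smallo_diff[OF gD D_O]) (intro bigo_1_power norm_O)
  have "(\<lambda>w. b t ^ 2 * f w ^ 3 - S (f w) w * (f w - c w) - (b t ^ 2 * B w ^ 3 - S (B w) w * D w)) \<in> o[at 0](\<lambda>w. norm w ^ 4)"
    unfolding S_def
    by (intro smallo_diff_diff smallo_diff_mult smallo_diff_add smallo_diff_power fB gD smallo_refl_diff
        bigo_1_intros f_O B_O g_O T_O D_O) simp_all
  moreover have "(\<lambda>w. b t ^ 2 * B w ^ 3 - S (B w) w * D w) \<in> o[at 0](\<lambda>w. norm w ^ 4)"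
  proof -
    have B': "B w = \<beta> 0 w + norm w * \<beta> 1 w + norm w ^ 2 * \<beta> 2 w + norm w ^ 3 * \<beta> 3 w + norm w ^ 4 * \<beta> 4 w" for w
      unfolding B_def T by simp
    have D': "D w = \<beta> 0 w - norm w ^ 2 * \<beta> 2 w - 2 * norm w ^ 3 * \<beta> 3 w - 3 * norm w ^ 4 * \<beta> 4 w" for w
      unfolding D_def T by simp
    have \<beta>0: "\<beta> 0 w = b t" for w by (simp add: \<beta>_def T_def)
    have "(\<lambda>w. b t ^ 2 * B w ^ 3 - S (B w) w * D w) = (\<lambda>w. \<beta> 0 w ^ 2 * B w ^ 3 - (B w ^ 4 - norm w * \<beta> 1 w * B w ^ 3
        + \<beta> 0 w ^ 2 * (norm w ^ 3 * \<beta> 3 w) * B w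
        + \<beta> 0 w ^ 2 * (norm w ^ 4 * (2 * \<beta> 0 w * \<beta> 4 w + 2 * \<beta> 1 w * \<beta> 3 w + \<beta> 2 w ^ 2))) * D w)"
      unfolding S_def T \<beta>0 by (rule ext) algebra
    also have "\<dots> \<in> O[at 0](\<lambda>w. norm w ^ 5)"
      by (rule lagrange_remainder[OF \<beta>_O \<beta>_O \<beta>_O \<beta>_O \<beta>_O norm_O B' D'])
    also have "(\<lambda>w :: real ^ 'd. norm w ^ 5) \<in> o[at 0](\<lambda>w. norm w ^ 4)"
    proof -
      have "(\<lambda>w :: real ^ 'd. norm w) \<in> o[at 0](\<lambda>_. 1)"
        by (rule smalloI_tendsto) (auto intro!: tendsto_eq_intros)
      from landau_o.big_small_mult[OF landau_o.big_refl[of "\<lambda>w :: real ^ 'd. norm w ^ 4"] this]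
      show ?thesis by (simp add: eval_nat_numeral mult_ac)
    qed
    finally show ?thesis .
  qed
  ultimately have "(\<lambda>w. (b t ^ 2 * f w ^ 3 - S (f w) w * (f w - c w) - (b t ^ 2 * B w ^ 3 - S (B w) w * D w))
      + (b t ^ 2 * B w ^ 3 - S (B w) w * D w)) \<in> o[at 0](\<lambda>w. norm w ^ 4)"
    by (rule sum_in_smallo(1))
  then have N: "(\<lambda>w. b t ^ 2 * f w ^ 3 - S (f w) w * (f w - c w)) \<in> o[at 0](\<lambda>w. norm w ^ 4)"
    by simp
  have "((\<lambda>w. 1 / (f w ^ 5 * b t ^ 2)) \<longlongrightarrow> 1 / (b t ^ 5 * b t ^ 2)) (at 0)"
    by (intro tendsto_intros f_lim) (use pos in simp)
  then have "(\<lambda>w. 1 / (f w ^ 5 * b t ^ 2)) \<in> O[at 0](\<lambda>_. 1)"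
    by (intro bigoI_tendsto) simp_all
  from landau_o.small_big_mult[OF N this]
  have E: "(\<lambda>w. (b t ^ 2 * f w ^ 3 - S (f w) w * (f w - c w)) * (1 / (f w ^ 5 * b t ^ 2))) \<in> o[at 0](\<lambda>w. norm w ^ 4)"
    by simp
  have "eventually (\<lambda>w. f w > 0) (at 0)"
    using f_lim pos by (rule order_tendstoD)
  then have "eventually (\<lambda>w. (b t ^ 2 * f w ^ 3 - S (f w) w * (f w - c w)) * (1 / (f w ^ 5 * b t ^ 2)) =
      1 / f w ^ 2 - (1 / b t ^ 2 - T 1 w / b t ^ 2 / f w + T 3 w / f w ^ 3
      + (2 * b t * T 4 w + 2 * T 1 w * T 3 w + T 2 w ^ 2) / f w ^ 4) * (1 - c w / f w)) (at 0)"
  proof eventually_elim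
    case (elim w)
    show ?case using elim pos unfolding S_def
      by (simp add: field_simps) algebra
  qed
  from landau_o.small.in_cong[OF this] E show ?thesis unfolding T_def f_def c_def by blast
qed

text \<open>Four differentiations of \<open>b^2\<close> along the line through \<open>t\<close>.
  With \<open>1 / f = b^2\<close> this identifies the coefficient of degree four produced by
  Lagrange inversion with the Taylor part of \<open>1 / f\<close>.\<close>

lemma dir_deriv_square:
  fixes b h :: "real ^ 'd::finite \<Rightarrow> real"
  assumes U: "open U" "t \<in> U" and b: "C_diff 4 U b" and h: "C_diff 4 U h"
    and eq: "\<And>x. x \<in> U \<Longrightarrow> h x = b x ^ 2"
  shows "dir_taylor 4 h t w = 2 * b t * dir_taylor 4 b t w + 2 * dir_taylor 1 b t w * dir_taylor 3 b t w + dir_taylor 2 b t w ^ 2"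
proof -
  define V where "V = (\<lambda>s. t + s *\<^sub>R w) -` U"
  have V: "open V" "0 \<in> V"
    unfolding V_def using U by (auto intro!: open_vimage continuous_intros)
  define G where "G k s = dir_deriv (replicate k w) b (t + s *\<^sub>R w)" for k s
  define H where "H k s = dir_deriv (replicate k w) h (t + s *\<^sub>R w)" for k s
  have G: "(G k has_real_derivative G (Suc k) s) (at s)" if "s \<in> V" "k < 4" for k s
    using dir_deriv_DERIV[OF U(1) _ b, of t s w "replicate k w"] that unfolding G_def V_def by simp
  have H: "(H k has_real_derivative H (Suc k) s) (at s)" if "s \<in> V" "k < 4" for k s
    using dir_deriv_DERIV[OF U(1) _ h, of t s w "replicate k w"] that unfolding H_def V_def by simp
  \<comment> \<open>An equation valid on the open set \<open>V\<close> may be differentiated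
    there.\<close>
  have step: "H (Suc k) s = e' s" if "s \<in> V" "k < 4" "\<And>s. s \<in> V \<Longrightarrow> H k s = e s"
    "(e has_real_derivative e' s) (at s)" for k s e e'
  proof -
    have "(H k has_real_derivative e' s) (at s)"
      using has_field_derivative_transform_within_open[OF that(4) V(1) that(1), of "H k"] that(3) by simp
    then show ?thesis using H[OF that(1,2)] DERIV_unique by blast
  qed
  have H0: "H 0 s = G 0 s ^ 2" if "s \<in> V" for s
    using that eq unfolding H_def G_def V_def by simp
  have H1: "H (Suc 0) s = 2 * G 0 s * G (Suc 0) s" if "s \<in> V" for s
    by (rule step[OF that _ H0]) (use that in \<open>auto intro!: derivative_eq_intros G\<close>)
  have H2: "H (Suc (Suc 0)) s = 2 * G (Suc 0) s ^ 2 + 2 * G 0 s * G (Suc (Suc 0)) s" if "s \<in> V" for s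
    by (rule step[OF that _ H1]) (use that in \<open>auto intro!: derivative_eq_intros G simp: power2_eq_square\<close>)
  have H3: "H (Suc (Suc (Suc 0))) s = 6 * G (Suc 0) s * G (Suc (Suc 0)) s + 2 * G 0 s * G (Suc (Suc (Suc 0))) s" if "s \<in> V" for s
    by (rule step[OF that _ H2]) (use that in \<open>auto intro!: derivative_eq_intros G\<close>)
  have H4: "H (Suc (Suc (Suc (Suc 0)))) s = 6 * G (Suc (Suc 0)) s ^ 2 + 8 * G (Suc 0) s * G (Suc (Suc (Suc 0))) s
      + 2 * G 0 s * G (Suc (Suc (Suc (Suc 0)))) s" if "s \<in> V" for s
    by (rule step[OF that _ H3]) (use that in \<open>auto intro!: derivative_eq_intros G simp: power2_eq_square\<close>)
  have GT: "G k 0 = fact k * dir_taylor k b t w" "H k 0 = fact k * dir_taylor k h t w" for k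
    by (simp_all add: G_def H_def dir_taylor_def)
  from H4[OF V(2)] show ?thesis
    unfolding GT by (simp add: eval_nat_numeral algebra_simps)
qed

text \<open>Restates the expansion for \<open>f = 1 / b^2\<close> with an explicit radius, as
  pointwise bounds on a whole ball require.\<close>

lemma square_root_law_remainder:
  fixes f b :: "real ^ 'd::finite \<Rightarrow> real"
  assumes U: "open U" "t \<in> U" and f: "C_diff 4 U f" "\<And>x. x \<in> U \<Longrightarrow> f x > 0"
    and b_def: "b = (\<lambda>x. inverse (sqrt (f x)))" and e: "e > 0"
  shows "\<exists>\<delta>>0. \<forall>w. norm w < \<delta> \<longrightarrow> \<bar>f (t + w) - (f t - dir_taylor 1 b t w / b t ^ 2 / b (t + w)
      + dir_taylor 3 b t w / b (t + w) ^ 3 + dir_taylor 4 (\<lambda>x. 1 / f x) t w / b (t + w) ^ 4)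
      * (1 - dir_deriv [w] b (t + w) / b (t + w))\<bar> \<le> e * norm w ^ 4"
proof -
  have b: "C_diff 4 U b"
    unfolding b_def by (intro C_diff_inverse C_diff_sqrt U f) (auto dest: f(2))
  have h: "C_diff 4 U (\<lambda>x. 1 / f x)"
    unfolding divide_inverse by (intro C_diff_mult C_diff_const C_diff_inverse U f) (auto dest: f(2))
  have eq: "1 / f x = b x ^ 2" if "x \<in> U" for x
    using f(2)[OF that] by (simp add: b_def power_inverse field_simps)
  have eq': "f x = 1 / b x ^ 2" if "x \<in> U" for x
    by (simp add: eq[OF that, symmetric])
  have "b t > 0" using f(2)[OF U(2)] by (simp add: b_def)
  have "eventually (\<lambda>w. \<bar>1 / b (t + w) ^ 2 - (1 / b t ^ 2 - dir_taylor 1 b t w / b t ^ 2 / b (t + w)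
      + dir_taylor 3 b t w / b (t + w) ^ 3 + dir_taylor 4 (\<lambda>x. 1 / f x) t w / b (t + w) ^ 4)
      * (1 - dir_deriv [w] b (t + w) / b (t + w))\<bar> \<le> e * norm w ^ 4) (at 0)"
    using landau_o.smallD[OF rsqrt_expansion_remainder[OF U b \<open>b t > 0\<close>] e]
    by (simp add: dir_deriv_square[OF U b h eq])
  then obtain d1 where d1: "d1 > 0" "\<And>w. w \<noteq> 0 \<Longrightarrow> norm w < d1 \<Longrightarrow>
      \<bar>1 / b (t + w) ^ 2 - (1 / b t ^ 2 - dir_taylor 1 b t w / b t ^ 2 / b (t + w)
      + dir_taylor 3 b t w / b (t + w) ^ 3 + dir_taylor 4 (\<lambda>x. 1 / f x) t w / b (t + w) ^ 4)
      * (1 - dir_deriv [w] b (t + w) / b (t + w))\<bar> \<le> e * norm w ^ 4"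
    unfolding eventually_at by auto
  obtain d2 where d2: "d2 > 0" "ball t d2 \<subseteq> U"
    using U open_contains_ball by blast
  show ?thesis
  proof (intro exI[of _ "min d1 d2"] conjI allI impI)
    fix w :: "real ^ 'd"
    assume w: "norm w < min d1 d2"
    show "\<bar>f (t + w) - (f t - dir_taylor 1 b t w / b t ^ 2 / b (t + w)
      + dir_taylor 3 b t w / b (t + w) ^ 3 + dir_taylor 4 (\<lambda>x. 1 / f x) t w / b (t + w) ^ 4)
      * (1 - dir_deriv [w] b (t + w) / b (t + w))\<bar> \<le> e * norm w ^ 4"
    proof (cases "w = 0")
      case True
      \<comment> \<open>The o-relation says nothing at \<open>w = 0\<close>, where all parts of
        positive degree vanish.\<close>
      have "dir_taylor n g t 0 = 0" if "n > 0" for n and g :: "real ^ 'd \<Rightarrow> real"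
        using dir_taylor_scaleR[of n g t 0 0] that by (simp add: power_0_left)
      then show ?thesis using True by simp
    next
      case False
      have "t + w \<in> U" using d2 w by (auto simp: dist_norm)
      then show ?thesis using d1(2)[OF False] w eq' U(2) by simp
    qed
  qed (use d1 d2 in auto)
qed

section \<open>Polar coordinates and radial substitution\<close>

text \<open>There is no surface measure on the sphere: the direction \<open>\<theta>\<close> ranges over the shell
  \<open>1 \<le> \<bar>\<theta>\<bar> \<le> e\<close> instead, and \<open>\<integral> d\<lambda>/\<lambda>\<close> over \<open>\<bar>x\<bar>/e \<le> \<lambda> \<le> \<bar>x\<bar>\<close>
  equals 1, so every point is counted with total weight 1.\<close>

definition polar_weight :: "real ^ 'd::finite \<Rightarrow> real \<Rightarrow> real"
  where "polar_weight \<theta> l = indicator {1..exp 1} (norm \<theta>) * (indicator {0..} l * l ^ (CARD('d) - 1))"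

lemma polar_weight_nonneg: "0 \<le> polar_weight \<theta> l"
  by (simp add: polar_weight_def indicator_def)

lemma polar_weight_measurable [measurable]:
  "(\<lambda>(\<theta> :: real ^ 'd::finite, l). polar_weight \<theta> l) \<in> borel_measurable (borel \<Otimes>\<^sub>M borel)"
  unfolding polar_weight_def by measurable

lemma nn_integral_lborel_scaleR:
  fixes g :: "real ^ 'd::finite \<Rightarrow> ennreal"
  assumes [measurable]: "g \<in> borel_measurable borel" and "l > 0"
  shows "(\<integral>\<^sup>+x. g x \<partial>lborel) = (\<integral>\<^sup>+x. ennreal (l ^ CARD('d)) * g (l *\<^sub>R x) \<partial>lborel)"
proof -
  have "(lborel :: (real ^ 'd) measure) = density (distr lborel borel (\<lambda>x. 0 + l *\<^sub>R x)) (\<lambda>_. \<bar>l\<bar> ^ DIM(real ^ 'd))"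
    by (rule lborel_affine) (use assms in simp)
  then have "(\<integral>\<^sup>+x. g x \<partial>lborel) = (\<integral>\<^sup>+x. g x \<partial>density (distr lborel borel (\<lambda>x. 0 + l *\<^sub>R x)) (\<lambda>_. \<bar>l\<bar> ^ DIM(real ^ 'd)))"
    by simp
  also have "\<dots> = (\<integral>\<^sup>+x. ennreal (l ^ CARD('d)) * g (l *\<^sub>R x) \<partial>lborel)"
    using assms by (simp add: nn_integral_density nn_integral_distr)
  finally show ?thesis .
qed

text \<open>For fixed \<open>l\<close> the substitution \<open>y = l \<theta>\<close> has Jacobian
  \<open>l ^ d\<close>, of which the weight supplies all but one power. The missing power is the
  factor \<open>1 / l\<close>, integrated for fixed \<open>y\<close> after Fubini.\<close>

lemma nn_integral_polar:
  fixes F :: "real ^ 'd::finite \<Rightarrow> ennreal"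
  assumes [measurable]: "F \<in> borel_measurable borel"
  shows "(\<integral>\<^sup>+\<theta>. \<integral>\<^sup>+l. ennreal (polar_weight \<theta> l) * F (l *\<^sub>R \<theta>) \<partial>lborel \<partial>lborel) = (\<integral>\<^sup>+x. F x \<partial>lborel)"
proof -
  have "(\<integral>\<^sup>+\<theta>. \<integral>\<^sup>+l. ennreal (polar_weight \<theta> l) * F (l *\<^sub>R \<theta>) \<partial>lborel \<partial>lborel)
    = (\<integral>\<^sup>+l. \<integral>\<^sup>+\<theta>. ennreal (polar_weight \<theta> l) * F (l *\<^sub>R \<theta>) \<partial>lborel \<partial>lborel)"
    by (rule lborel_pair.Fubini'[symmetric]) measurable
  also have "\<dots> = (\<integral>\<^sup>+l. \<integral>\<^sup>+y. ennreal (indicator {0<..} l * inverse l) * (indicator {1..exp 1} (norm y / l) * F y) \<partial>(lborel :: (real ^ 'd) measure) \<partial>lborel)"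
  proof (rule nn_integral_cong_AE, rule AE_mp[OF AE_lborel_singleton[of 0]], rule AE_I2, rule impI)
    fix l :: real
    assume "l \<noteq> 0"
    show "(\<integral>\<^sup>+\<theta>. ennreal (polar_weight \<theta> l) * F (l *\<^sub>R \<theta>) \<partial>lborel)
      = (\<integral>\<^sup>+y. ennreal (indicator {0<..} l * inverse l) * (indicator {1..exp 1} (norm y / l) * F y) \<partial>lborel)"
    proof (cases "l > 0")
      case True
      have "l ^ CARD('d) * inverse l = l ^ (CARD('d) - 1)"
        using True by (cases "CARD('d)") auto
      then have l: "ennreal (l ^ CARD('d)) * (ennreal (inverse l) * x) = ennreal (l ^ (CARD('d) - 1)) * x" for x
        using True by (simp add: mult.assoc[symmetric] ennreal_mult''[symmetric])
      have "(\<integral>\<^sup>+y. ennreal (indicator {0<..} l * inverse l) * (indicator {1..exp 1} (norm y / l) * F y) \<partial>(lborel :: (real ^ 'd) measure))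
        = (\<integral>\<^sup>+y. ennreal (l ^ CARD('d)) * (ennreal (indicator {0<..} l * inverse l) * (indicator {1..exp 1} (norm (l *\<^sub>R y) / l) * F (l *\<^sub>R y))) \<partial>lborel)"
        by (rule nn_integral_lborel_scaleR[OF _ True]) measurable
      also have "\<dots> = (\<integral>\<^sup>+\<theta>. ennreal (polar_weight \<theta> l) * F (l *\<^sub>R \<theta>) \<partial>lborel)"
        by (rule nn_integral_cong)
          (use True l in \<open>auto simp: polar_weight_def split: split_indicator\<close>)
      finally show ?thesis by simp
    next
      case False
      then show ?thesis using \<open>l \<noteq> 0\<close> by (simp add: polar_weight_def)
    qed
  qed
  also have "\<dots> = (\<integral>\<^sup>+y. \<integral>\<^sup>+l. ennreal (indicator {0<..} l * inverse l) * (indicator {1..exp 1} (norm y / l) * F y) \<partial>lborel \<partial>(lborel :: (real ^ 'd) measure))"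
    by (rule lborel_pair.Fubini'[symmetric]) measurable
  also have "\<dots> = (\<integral>\<^sup>+y. F y \<partial>lborel)"
  proof (rule nn_integral_cong_AE)
    have "AE y in lborel. y \<noteq> (0 :: real ^ 'd)" by (rule AE_lborel_singleton)
    then show "AE y in lborel. (\<integral>\<^sup>+l. ennreal (indicator {0<..} l * inverse l) * (indicator {1..exp 1} (norm y / l) * F y) \<partial>lborel) = F y"
    proof eventually_elim
      case (elim y)
      have "(\<integral>\<^sup>+l. ennreal (inverse l) * indicator {norm y / exp 1 .. norm y} l \<partial>lborel) = ln (norm y) - ln (norm y / exp 1)"
      proof (rule nn_integral_FTC_Icc[where F = ln])
        fix l assume "l \<in> {norm y / exp 1..norm y}"
        then have "norm y / exp 1 \<le> l" by simp
        moreover have "0 < norm y / exp 1" using elim by simp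
        ultimately have l: "0 < l" by linarith
        then show "(ln has_real_derivative inverse l) (at l)"
          by (auto intro!: derivative_eq_intros simp: divide_inverse)
        show "0 \<le> inverse l" using l by simp
      qed (use elim in \<open>auto simp: field_simps\<close>)
      also have "ln (norm y) - ln (norm y / exp 1) = 1" using elim by (simp add: ln_div)
      finally have 1: "(\<integral>\<^sup>+l. ennreal (inverse l) * indicator {norm y / exp 1 .. norm y} l \<partial>lborel) = 1" by simp
      have "(\<integral>\<^sup>+l. ennreal (indicator {0<..} l * inverse l) * (indicator {1..exp 1} (norm y / l) * F y) \<partial>lborel)
        = (\<integral>\<^sup>+l. (ennreal (inverse l) * indicator {norm y / exp 1 .. norm y} l) * F y \<partial>lborel)"
      proof (rule nn_integral_cong)
        fix l :: real
        have pos: "0 < norm y / exp 1" using elim by simp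
        show "ennreal (indicator {0<..} l * inverse l) * (indicator {1..exp 1} (norm y / l) * F y)
          = (ennreal (inverse l) * indicator {norm y / exp 1 .. norm y} l) * F y"
        proof (cases "l > 0")
          case True
          then have "norm y / l \<in> {1..exp 1} \<longleftrightarrow> l \<in> {norm y / exp 1 .. norm y}"
            by (auto simp: field_simps)
          then show ?thesis using True by (auto split: split_indicator)
        next
          case False
          then have "l \<notin> {norm y / exp 1 .. norm y}" using pos by (auto dest: less_le_trans)
          then show ?thesis using False by simp
        qed
      qed
      also have "\<dots> = F y" by (subst nn_integral_multc) (simp_all add: 1)
      finally show ?case .
    qed
  qed
  finally show ?thesis .
qed

text \<open>As an identity of measures the formula passes to signed integrands through the rules for
  \<open>distr\<close> and \<open>density\<close>.\<close>

lemma lborel_polar: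
  "(lborel :: (real ^ 'd::finite) measure)
    = distr (density (lborel \<Otimes>\<^sub>M lborel) (\<lambda>(\<theta>, l). ennreal (polar_weight \<theta> l))) borel (\<lambda>(\<theta>, l). l *\<^sub>R \<theta>)"
proof (rule measure_eqI)
  fix A :: "(real ^ 'd) set"
  assume "A \<in> sets lborel"
  then have A [measurable]: "A \<in> sets borel" by simp
  have m: "(\<lambda>(\<theta> :: real ^ 'd, l). l *\<^sub>R \<theta>) \<in> measurable (density (lborel \<Otimes>\<^sub>M lborel) (\<lambda>(\<theta>, l). ennreal (polar_weight \<theta> l))) borel"
    by measurable
  have "emeasure (distr (density (lborel \<Otimes>\<^sub>M lborel) (\<lambda>(\<theta>, l). ennreal (polar_weight \<theta> l))) borel (\<lambda>(\<theta>, l). l *\<^sub>R \<theta>)) A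
    = (\<integral>\<^sup>+x. indicator A x \<partial>distr (density (lborel \<Otimes>\<^sub>M lborel) (\<lambda>(\<theta> :: real ^ 'd, l). ennreal (polar_weight \<theta> l))) borel (\<lambda>(\<theta>, l). l *\<^sub>R \<theta>))"
    by simp
  also have "\<dots> = (\<integral>\<^sup>+z. ennreal (polar_weight (fst z) (snd z)) * indicator A (snd z *\<^sub>R fst z) \<partial>(lborel \<Otimes>\<^sub>M lborel))"
    by (subst nn_integral_distr[OF m]) (simp_all add: nn_integral_density case_prod_beta)
  also have "\<dots> = (\<integral>\<^sup>+\<theta>. \<integral>\<^sup>+l. ennreal (polar_weight \<theta> l) * indicator A (l *\<^sub>R \<theta>) \<partial>lborel \<partial>lborel)"
    by (subst lborel.nn_integral_fst[symmetric]) simp_all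
  also have "\<dots> = emeasure lborel A"
    by (subst nn_integral_polar) simp_all
  finally show "emeasure lborel A = emeasure (distr (density (lborel \<Otimes>\<^sub>M lborel) (\<lambda>(\<theta>, l). ennreal (polar_weight \<theta> l))) borel (\<lambda>(\<theta>, l). l *\<^sub>R \<theta>)) A"
    by simp
qed simp

lemma integral_polar:
  fixes F :: "real ^ 'd::finite \<Rightarrow> real"
  assumes F: "integrable lborel F"
  shows "(\<integral>x. F x \<partial>lborel) = (\<integral>\<theta>. \<integral>l. polar_weight \<theta> l * F (l *\<^sub>R \<theta>) \<partial>lborel \<partial>lborel)"
proof -
  have F': "F \<in> borel_measurable borel" using F by (auto dest: borel_measurable_integrable)
  note [measurable] = F'
  let ?P = "density (lborel \<Otimes>\<^sub>M lborel) (\<lambda>(\<theta> :: real ^ 'd, l). ennreal (polar_weight \<theta> l))"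
  have m: "(\<lambda>(\<theta> :: real ^ 'd, l). l *\<^sub>R \<theta>) \<in> measurable ?P borel" by measurable
  have pw: "(\<lambda>z :: (real ^ 'd) \<times> real. polar_weight (fst z) (snd z)) \<in> borel_measurable (lborel \<Otimes>\<^sub>M lborel)"
    using polar_weight_measurable by (simp add: case_prod_beta)
  have P: "?P = density (lborel \<Otimes>\<^sub>M lborel) (\<lambda>z. ennreal (polar_weight (fst z) (snd z)))"
    by (simp add: case_prod_unfold)
  have nn: "AE z in lborel \<Otimes>\<^sub>M lborel. 0 \<le> polar_weight (fst z :: real ^ 'd) (snd z)"
    by (simp add: polar_weight_nonneg)
  have Fm: "(\<lambda>z :: (real ^ 'd) \<times> real. F (snd z *\<^sub>R fst z)) \<in> borel_measurable (lborel \<Otimes>\<^sub>M lborel)"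
    by measurable
  have "integrable (distr ?P borel (\<lambda>(\<theta>, l). l *\<^sub>R \<theta>)) F" using F lborel_polar by metis
  then have "integrable ?P (\<lambda>z. F (snd z *\<^sub>R fst z))"
    using integrable_distr[OF m] by (simp add: case_prod_beta)
  then have int: "integrable (lborel \<Otimes>\<^sub>M lborel) (\<lambda>z. polar_weight (fst z) (snd z) * F (snd z *\<^sub>R fst z))"
    unfolding P using integrable_density[OF Fm pw nn] by simp
  have "(\<integral>x. F x \<partial>lborel) = (\<integral>x. F x \<partial>distr ?P borel (\<lambda>(\<theta>, l). l *\<^sub>R \<theta>))"
    using lborel_polar by metis
  also have "\<dots> = (\<integral>z. F (snd z *\<^sub>R fst z) \<partial>?P)"
    by (subst integral_distr[OF m F']) (simp add: case_prod_beta)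
  also have "\<dots> = (\<integral>z. polar_weight (fst z) (snd z) * F (snd z *\<^sub>R fst z) \<partial>(lborel \<Otimes>\<^sub>M lborel))"
    unfolding P using integral_density[OF Fm pw nn] by simp
  also have "\<dots> = (\<integral>\<theta>. \<integral>l. polar_weight \<theta> l * F (l *\<^sub>R \<theta>) \<partial>lborel \<partial>lborel)"
    using lborel_pair.integral_fst'[OF int] by simp
  finally show ?thesis .
qed

lemma integrable_continuous_compact_support:
  fixes B :: "'a::euclidean_space \<Rightarrow> real"
  assumes "continuous_on UNIV B" "\<And>z. norm z > R \<Longrightarrow> B z = 0"
  shows "integrable lborel B"
proof -
  have "integrable lborel (\<lambda>x. indicator (cball 0 R) x *\<^sub>R B x)"
    by (rule borel_integrable_compact) (use assms(1) continuous_on_subset in auto)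
  also have "(\<lambda>x. indicator (cball 0 R) x *\<^sub>R B x) = B"
    using assms(2) by (auto simp: fun_eq_iff indicator_def)
  finally show ?thesis .
qed

text \<open>The substitution rule compares integrals between end values, so \<open>y\<close> may
  fail to be monotone. Since \<open>p\<close> vanishes beyond \<open>y L\<close>, the upper end can
  be moved to infinity.\<close>

lemma radial_substitution_line:
  fixes p y :: "real \<Rightarrow> real"
  assumes L: "0 \<le> L" and p: "continuous_on {0..} p" and vanish: "\<And>s. s > y L \<Longrightarrow> p s = 0"
    and y: "\<And>l. 0 \<le> l \<Longrightarrow> l \<le> L \<Longrightarrow> (y has_real_derivative y' l) (at l)"
    and y0: "y 0 = 0" and yL: "\<And>l. 0 \<le> l \<Longrightarrow> l \<le> L \<Longrightarrow> y l \<ge> 0"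
    and cont: "continuous_on {0..L} y'"
  shows "(\<integral>l. indicator {0..L} l * (y' l * p (y l)) \<partial>lborel) = (\<integral>s. indicator {0..} s * p s \<partial>lborel)"
proof -
  have y_cont: "continuous_on {0..L} y"
    by (rule DERIV_continuous_on) (use y in \<open>auto intro: DERIV_subset\<close>)
  \<comment> \<open>\<open>p\<close> is continuous on the half-line only; the interval from 0 to the
    maximum of \<open>y\<close> contains the range of \<open>y\<close>.\<close>
  obtain m where m: "m \<in> {0..L}" "\<And>l. l \<in> {0..L} \<Longrightarrow> y l \<le> y m"
    using continuous_attains_sup[OF compact_Icc _ y_cont] L by auto
  have "((\<lambda>l. y' l *\<^sub>R p (y l)) has_integral (integral {y 0..y L} p)) {0..L}"
  proof (rule has_integral_substitution[where c = 0 and d = "y m"])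
    show "y ` {0..L} \<subseteq> {0..y m}" using m yL by auto
    show "continuous_on {0..y m} p" using p by (rule continuous_on_subset) auto
  qed (use L y0 yL m y in \<open>auto intro: DERIV_subset\<close>)
  then have 1: "integral {0..L} (\<lambda>l. y' l * p (y l)) = integral {0..y L} p"
    using y0 by (simp add: integral_unique)
  have "(\<integral>l. indicator {0..L} l *\<^sub>R (y' l * p (y l)) \<partial>lborel) = integral {0..L} (\<lambda>l. y' l * p (y l))"
  proof (rule set_borel_integral_eq_integral(2)[unfolded set_lebesgue_integral_def])
    show "set_integrable lborel {0..L} (\<lambda>l. y' l * p (y l))"
      unfolding set_integrable_def
      by (intro borel_integrable_compact compact_Icc continuous_intros cont continuous_on_compose2[OF p y_cont]) (use yL in auto)
  qed
  moreover have "(\<integral>l. indicator {0..y L} l *\<^sub>R p l \<partial>lborel) = integral {0..y L} p"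
  proof (rule set_borel_integral_eq_integral(2)[unfolded set_lebesgue_integral_def])
    show "set_integrable lborel {0..y L} p"
      unfolding set_integrable_def
      by (intro borel_integrable_compact compact_Icc continuous_on_subset[OF p]) auto
  qed
  moreover have "(\<lambda>l. indicator {0..y L} l *\<^sub>R p l) = (\<lambda>l. indicator {0..} l * p l)"
  proof
    show "indicator {0..y L} l *\<^sub>R p l = indicator {0..} l * p l" for l
      using vanish[of l] by (cases "l \<le> y L") (auto simp: indicator_def)
  qed
  ultimately show ?thesis using 1 by simp
qed

text \<open>The change of variables \<open>z = a(x) x\<close> has Jacobian \<open>a\<^sup>d\<^sup>-\<^sup>1 (a + x \<cdot> \<nabla>a)\<close>, where \<open>da\<close> stands for
  \<open>x \<cdot> \<nabla>a\<close>; in polar coordinates it is a one-dimensional substitution on every ray.\<close>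

lemma radial_substitution:
  fixes B a da :: "real ^ 'd::finite \<Rightarrow> real"
  assumes B: "continuous_on UNIV B" "\<And>z. norm z \<ge> R \<Longrightarrow> B z = 0" and r: "0 < r"
    and cont: "continuous_on (cball 0 r) a" "continuous_on (cball 0 r) da"
    and pos: "\<And>x. norm x \<le> r \<Longrightarrow> a x > 0"
    and bdry: "\<And>x. norm x = r \<Longrightarrow> R \<le> a x * r"
    and deriv: "\<And>x s. 0 \<le> s \<Longrightarrow> s * norm x \<le> r \<Longrightarrow>
      ((\<lambda>s. s * a (s *\<^sub>R x)) has_real_derivative a (s *\<^sub>R x) + da (s *\<^sub>R x)) (at s)"
  shows "(\<integral>x. indicator (cball 0 r) x * (B (a x *\<^sub>R x) * (a x ^ (CARD('d) - 1) * (a x + da x))) \<partial>lborel) = (\<integral>z. B z \<partial>lborel)"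
proof -
  have "integrable lborel (\<lambda>x. indicator (cball 0 r) x *\<^sub>R (B (a x *\<^sub>R x) * (a x ^ (CARD('d) - 1) * (a x + da x))))"
    by (intro borel_integrable_compact compact_cball continuous_intros cont continuous_on_compose2[OF B(1)]) auto
  then have int: "integrable lborel (\<lambda>x. indicator (cball 0 r) x * (B (a x *\<^sub>R x) * (a x ^ (CARD('d) - 1) * (a x + da x))))"
    by simp
  have intB: "integrable lborel B"
    by (rule integrable_continuous_compact_support[of _ R]) (use B in auto)
  have "(\<integral>l. polar_weight \<theta> l * (indicator (cball 0 r) (l *\<^sub>R \<theta>) * (B (a (l *\<^sub>R \<theta>) *\<^sub>R l *\<^sub>R \<theta>) *
      (a (l *\<^sub>R \<theta>) ^ (CARD('d) - 1) * (a (l *\<^sub>R \<theta>) + da (l *\<^sub>R \<theta>))))) \<partial>lborel)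
    = (\<integral>l. polar_weight \<theta> l * B (l *\<^sub>R \<theta>) \<partial>lborel)" for \<theta> :: "real ^ 'd"
  proof (cases "norm \<theta> \<in> {1..exp 1}")
    case False
    then show ?thesis by (simp add: polar_weight_def)
  next
    case True
    define L where "L = r / norm \<theta>"
    have n: "norm \<theta> > 0" "0 \<le> L" using True r by (auto simp: L_def)
    have lL: "l * norm \<theta> \<le> r \<longleftrightarrow> l \<le> L" for l using n by (simp add: L_def pos_le_divide_eq)
    define y where "y l = l * a (l *\<^sub>R \<theta>)" for l
    define y' where "y' l = a (l *\<^sub>R \<theta>) + da (l *\<^sub>R \<theta>)" for l
    define p where "p s = s ^ (CARD('d) - 1) * B (s *\<^sub>R \<theta>)" for s
    have in_ball: "norm (l *\<^sub>R \<theta>) \<le> r" if "0 \<le> l" "l \<le> L" for l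
      using that lL[of l] by simp
    \<comment> \<open>The end of the ray segment is mapped outside the interior of the support of
      \<open>B\<close>, so the image of the segment reaches all of it.\<close>
    have yL: "R \<le> y L * norm \<theta>"
      using bdry[of "L *\<^sub>R \<theta>"] n r by (simp add: y_def L_def mult_ac)
    have sub: "(\<integral>l. indicator {0..L} l * (y' l * p (y l)) \<partial>lborel) = (\<integral>s. indicator {0..} s * p s \<partial>lborel)"
    proof (rule radial_substitution_line)
      show "continuous_on {0..} p"
        unfolding p_def by (intro continuous_intros continuous_on_compose2[OF B(1)]) auto
      show "p s = 0" if "s > y L" for s
      proof -
        have "y L \<ge> 0" unfolding y_def using n pos[OF in_ball, of L] by simp
        then have "R \<le> norm (s *\<^sub>R \<theta>)" using yL that mult_right_mono[of "y L" s "norm \<theta>"] by simp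
        then show ?thesis unfolding p_def using B(2) by simp
      qed
      show "(y has_real_derivative y' l) (at l)" if "0 \<le> l" "l \<le> L" for l
        unfolding y_def y'_def using deriv[of l \<theta>] that lL by simp
      show "0 \<le> y l" if "0 \<le> l" "l \<le> L" for l
        unfolding y_def using that pos[OF in_ball[OF that]] by simp
      show "continuous_on {0..L} y'"
        unfolding y'_def
        by (intro continuous_intros continuous_on_compose2[OF cont(1)] continuous_on_compose2[OF cont(2)])
          (use in_ball in auto)
    qed (use n in \<open>auto simp: y_def\<close>)
    have "polar_weight \<theta> l * (indicator (cball 0 r) (l *\<^sub>R \<theta>) * (B (a (l *\<^sub>R \<theta>) *\<^sub>R l *\<^sub>R \<theta>) *
      (a (l *\<^sub>R \<theta>) ^ (CARD('d) - 1) * (a (l *\<^sub>R \<theta>) + da (l *\<^sub>R \<theta>))))) = indicator {0..L} l * (y' l * p (y l))" for l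
      unfolding polar_weight_def y_def y'_def p_def using True lL[of l]
      by (auto simp: indicator_def power_mult_distrib mult_ac)
    moreover have "polar_weight \<theta> l * B (l *\<^sub>R \<theta>) = indicator {0..} l * p l" for l
      unfolding polar_weight_def p_def using True by simp
    ultimately show ?thesis using sub by simp
  qed
  then show ?thesis
    unfolding integral_polar[OF int] integral_polar[OF intB] by simp
qed

section \<open>Radial kernels and the square root law\<close>

lemma integral_lborel_affine:
  fixes g :: "real ^ 'd::finite \<Rightarrow> real"
  assumes [measurable]: "g \<in> borel_measurable borel" and "l \<noteq> 0"
  shows "(\<integral>x. g x \<partial>lborel) = \<bar>l\<bar> ^ CARD('d) * (\<integral>x. g (x0 + l *\<^sub>R x) \<partial>lborel)"
proof -
  have "(lborel :: (real ^ 'd) measure) = density (distr lborel borel (\<lambda>x. x0 + l *\<^sub>R x)) (\<lambda>_. \<bar>l\<bar> ^ DIM(real ^ 'd))"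
    by (rule lborel_affine) (use assms in simp)
  then have "(\<integral>x. g x \<partial>lborel) = (\<integral>x. g x \<partial>density (distr lborel borel (\<lambda>x. x0 + l *\<^sub>R x)) (\<lambda>_. \<bar>l\<bar> ^ DIM(real ^ 'd)))"
    by simp
  also have "\<dots> = (\<integral>x. \<bar>l\<bar> ^ CARD('d) * g (x0 + l *\<^sub>R x) \<partial>lborel)"
    by (subst integral_density) (simp_all add: integral_distr)
  finally show ?thesis by simp
qed

lemma integral_odd_eq_0:
  fixes g :: "real ^ 'd::finite \<Rightarrow> real"
  assumes "g \<in> borel_measurable borel" "\<And>x. g (- x) = - g x"
  shows "(\<integral>x. g x \<partial>lborel) = 0"
  using integral_lborel_affine[OF assms(1), of "-1" 0] by (simp add: assms(2))

text \<open>\<open>T\<close> is any positive bound from which on the profile and its derivative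
  vanish, not necessarily the end of the support.\<close>

locale radial_kernel =
  fixes \<Phi> \<Phi>' \<Phi>'' :: "real \<Rightarrow> real" and B2 T :: real and K :: "real ^ 'd::finite \<Rightarrow> real"
  assumes K: "\<And>z. K z = \<Phi> ((norm z)\<^sup>2)"
    and D1: "\<And>s. 0 \<le> s \<Longrightarrow> (\<Phi> has_real_derivative \<Phi>' s) (at s within {0..})"
    and D2: "\<And>s. 0 \<le> s \<Longrightarrow> (\<Phi>' has_real_derivative \<Phi>'' s) (at s within {0..})"
    and B2: "\<And>s. 0 \<le> s \<Longrightarrow> \<bar>\<Phi>'' s\<bar> \<le> B2"
    and T: "0 < T" "\<And>s. T \<le> s \<Longrightarrow> \<Phi> s = 0" "\<And>s. T \<le> s \<Longrightarrow> \<Phi>' s = 0"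
begin

text \<open>\<open>2 Klin\<close> is the derivative of \<open>\<lambda>\<^sup>d K(\<lambda>z)\<close> in \<open>\<lambda>\<close> at \<open>\<lambda> = 1\<close>, hence has integral 0.\<close>

definition lin :: "real \<Rightarrow> real" where "lin s = CARD('d) / 2 * \<Phi> s + s * \<Phi>' s"

definition Klin :: "real ^ 'd \<Rightarrow> real" where "Klin z = lin ((norm z)\<^sup>2)"

lemma cont_\<Phi>: "continuous_on {0..} \<Phi>"
  using D1 by (auto intro!: DERIV_continuous_on)

lemma cont_\<Phi>': "continuous_on {0..} \<Phi>'"
  using D2 by (auto intro!: DERIV_continuous_on)

lemma cont_lin: "continuous_on {0..} lin"
  unfolding lin_def by (intro continuous_intros cont_\<Phi> cont_\<Phi>')

lemma lin_0: "T \<le> s \<Longrightarrow> lin s = 0"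
  by (simp add: lin_def T)

lemma cont_K: "continuous_on A K"
  unfolding K[abs_def] by (intro continuous_on_compose2[OF cont_\<Phi>] continuous_intros) auto

lemma cont_Klin: "continuous_on A Klin"
  unfolding Klin_def[abs_def] by (intro continuous_on_compose2[OF cont_lin] continuous_intros) auto

lemma norm_ge_sqrt_T: "norm z \<ge> sqrt T \<Longrightarrow> T \<le> (norm (z :: real ^ 'd))\<^sup>2"
  using T(1) by (metis less_eq_real_def real_sqrt_le_iff real_sqrt_abs abs_norm_cancel)

lemma K_0: "norm z \<ge> sqrt T \<Longrightarrow> K z = 0"
  unfolding K by (intro T norm_ge_sqrt_T)

lemma Klin_0: "norm z \<ge> sqrt T \<Longrightarrow> Klin z = 0"
  unfolding Klin_def by (intro lin_0 norm_ge_sqrt_T)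

lemma bounded_by_compact_support:
  fixes g :: "real \<Rightarrow> real"
  assumes "continuous_on {0..} g" "\<And>s. T \<le> s \<Longrightarrow> g s = 0"
  shows "\<exists>M>0. \<forall>s\<ge>0. \<bar>g s\<bar> \<le> M"
proof -
  have "compact (g ` {0..T})"
    by (intro compact_continuous_image compact_Icc continuous_on_subset[OF assms(1)]) auto
  then obtain M where M: "M > 0" "\<And>s. s \<in> {0..T} \<Longrightarrow> \<bar>g s\<bar> \<le> M"
    using compact_imp_bounded bounded_pos by (metis imageI real_norm_def)
  have "\<bar>g s\<bar> \<le> M" if "s \<ge> 0" for s
    using M assms(2)[of s] that by (cases "s \<le> T") auto
  then show ?thesis using M(1) by blast
qed

lemma K_bounded: obtains M where "M > 0" "\<And>z. K z \<le> M"
proof -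
  obtain M where M: "M > 0" "\<And>s. s \<ge> 0 \<Longrightarrow> \<bar>\<Phi> s\<bar> \<le> M"
    using bounded_by_compact_support[OF cont_\<Phi> T(2)] by auto
  have "K z \<le> M" for z unfolding K using M(2)[of "(norm z)\<^sup>2"] by simp
  then show ?thesis by (rule that[OF M(1)])
qed

lemma K_uminus: "K (- z) = K z"
  by (simp add: K)

lemma Klin_uminus: "Klin (- z) = Klin z"
  by (simp add: Klin_def)

text \<open>On each ray \<open>l ^ (d - 1) * Klin (l \<theta>)\<close> is the derivative of
  \<open>l ^ d * K (l \<theta>) / 2\<close>, which vanishes at 0 and past the support.\<close>

lemma integral_Klin: "(\<integral>z. Klin z \<partial>lborel) = 0"
proof -
  have int: "integrable lborel Klin"
    by (rule integrable_continuous_compact_support[OF cont_Klin, of "sqrt T"]) (simp add: Klin_0)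
  have "(\<integral>l. polar_weight \<theta> l * Klin (l *\<^sub>R \<theta>) \<partial>lborel) = 0" for \<theta> :: "real ^ 'd"
  proof (cases "norm \<theta> \<in> {1..exp 1}")
    case True
    \<comment> \<open>Past the support for every direction of the shell, as
      \<open>norm \<theta> \<ge> 1\<close> and \<open>(T + 1)^2 \<ge> T\<close>.\<close>
    define L where "L = T + 1"
    have big: "T \<le> (l * norm \<theta>)\<^sup>2" if "l \<ge> L" for l
    proof -
      have "l * 1 \<le> l * norm \<theta>" by (rule mult_left_mono) (use True that T(1) in \<open>auto simp: L_def\<close>)
      then have "L \<le> l * norm \<theta>" using that by simp
      then have "L\<^sup>2 \<le> (l * norm \<theta>)\<^sup>2" using T(1) by (intro power_mono) (auto simp: L_def)
      moreover have "T \<le> L\<^sup>2" using T(1) by (simp add: L_def power2_eq_square algebra_simps)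
      ultimately show ?thesis by simp
    qed
    define P where "P l = l ^ CARD('d) * \<Phi> ((l * norm \<theta>)\<^sup>2) / 2" for l
    define p where "p l = l ^ (CARD('d) - 1) * lin ((l * norm \<theta>)\<^sup>2)" for l
    have "has_bochner_integral lborel (\<lambda>l. indicator {0..L} l *\<^sub>R p l) (P L - P 0)"
    proof (rule has_bochner_integral_FTC_Icc)
      show "continuous_on {0..L} p" unfolding p_def
        by (intro continuous_intros continuous_on_compose2[OF cont_lin]) auto
      fix l assume l: "0 \<le> l" "l \<le> L"
      have sq: "((\<lambda>l. (l * norm \<theta>)\<^sup>2) has_real_derivative 2 * l * (norm \<theta>)\<^sup>2) (at l within {0..L})"
        by (auto intro!: derivative_eq_intros simp: power2_eq_square)
      have "(\<Phi> has_real_derivative \<Phi>' ((l * norm \<theta>)\<^sup>2)) (at ((l * norm \<theta>)\<^sup>2) within (\<lambda>l. (l * norm \<theta>)\<^sup>2) ` {0..L})"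
        by (rule DERIV_subset[OF D1]) auto
      from DERIV_image_chain[OF this sq]
      have "((\<lambda>l. \<Phi> ((l * norm \<theta>)\<^sup>2)) has_real_derivative \<Phi>' ((l * norm \<theta>)\<^sup>2) * (2 * l * (norm \<theta>)\<^sup>2)) (at l within {0..L})"
        by (simp add: o_def)
      then have "(P has_real_derivative (real CARD('d) * l ^ (CARD('d) - 1) * \<Phi> ((l * norm \<theta>)\<^sup>2)
          + l ^ CARD('d) * (\<Phi>' ((l * norm \<theta>)\<^sup>2) * (2 * l * (norm \<theta>)\<^sup>2))) / 2) (at l within {0..L})"
        unfolding P_def by (auto intro!: derivative_eq_intros)
      moreover have "(real CARD('d) * l ^ (CARD('d) - 1) * \<Phi> ((l * norm \<theta>)\<^sup>2)
          + l ^ CARD('d) * (\<Phi>' ((l * norm \<theta>)\<^sup>2) * (2 * l * (norm \<theta>)\<^sup>2))) / 2 = p l"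
      proof -
        have "l ^ CARD('d) = l ^ (CARD('d) - 1) * l" by (cases "CARD('d)") auto
        then show ?thesis by (simp add: p_def lin_def power2_eq_square algebra_simps)
      qed
      ultimately show "(P has_vector_derivative p l) (at l within {0..L})"
        by (simp add: has_real_derivative_iff_has_vector_derivative)
    qed (use T in \<open>simp add: L_def\<close>)
    moreover have "P L - P 0 = 0" using big[of L] T by (simp add: P_def)
    moreover have "(\<lambda>l. indicator {0..L} l *\<^sub>R p l) = (\<lambda>l. polar_weight \<theta> l * Klin (l *\<^sub>R \<theta>))"
    proof
      fix l
      show "indicator {0..L} l *\<^sub>R p l = polar_weight \<theta> l * Klin (l *\<^sub>R \<theta>)"
        using True lin_0[OF big[of l]] by (cases "l \<le> L") (auto simp: polar_weight_def p_def Klin_def indicator_def power_mult_distrib)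
    qed
    ultimately show ?thesis by (simp add: has_bochner_integral_integral_eq)
  qed (simp add: polar_weight_def)
  then show ?thesis unfolding integral_polar[OF int] by simp
qed

end

text \<open>\<open>r\<close> bounds the scaled displacement \<open>u\<close>: where
  \<open>f \<ge> \<sigma>\<close>, the inequality \<open>T \<le> \<sigma> r^2\<close> makes the
  kernel vanish at \<open>f(x)^(1/2) u\<close> as soon as \<open>norm u \<ge> r\<close>.\<close>

locale density_at = radial_kernel \<Phi> \<Phi>' \<Phi>'' B2 T K
  for \<Phi> \<Phi>' \<Phi>'' :: "real \<Rightarrow> real" and B2 T :: real and K :: "real ^ 'd::finite \<Rightarrow> real" +
  fixes f :: "real ^ 'd \<Rightarrow> real" and t :: "real ^ 'd" and Cf \<sigma> \<rho> r :: real
  assumes f: "C_diff 4 UNIV f"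
    and f_bound: "\<And>is x. length is \<le> 4 \<Longrightarrow> \<bar>iter_partial is f x\<bar> \<le> Cf"
    and \<sigma>: "0 < \<sigma>" and \<rho>: "0 < \<rho>" and f_pos: "\<And>w. norm w < \<rho> \<Longrightarrow> \<sigma> \<le> f (t + w)"
    and r: "0 < r" "T \<le> \<sigma> * r\<^sup>2"
begin

text \<open>On the scale \<open>x = t + h u\<close> the ideal bandwidth factor is \<open>a h u = f(x)\<^sup>1\<^sup>/\<^sup>2 = 1 / b x\<close>, and \<open>jac\<close> is
  the Jacobian determinant of \<open>u \<mapsto> a h u \<cdot> u\<close>.\<close>

definition b :: "real ^ 'd \<Rightarrow> real" where "b x = inverse (sqrt (f x))"

definition a :: "real \<Rightarrow> real ^ 'd \<Rightarrow> real" where "a h u = sqrt (f (t + h *\<^sub>R u))"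

definition jac :: "real \<Rightarrow> real ^ 'd \<Rightarrow> real"
  where "jac h u = a h u ^ CARD('d) * (1 - a h u * dir_deriv [h *\<^sub>R u] b (t + h *\<^sub>R u))"

definition U :: "(real ^ 'd) set" where "U = ball t \<rho>"

lemma U: "open U" "t \<in> U" "t + w \<in> U \<longleftrightarrow> norm w < \<rho>"
  using \<rho> by (simp_all add: U_def dist_norm)

lemma f_U: "x \<in> U \<Longrightarrow> \<sigma> \<le> f x"
  using f_pos[of "x - t"] by (simp add: U_def dist_norm norm_minus_commute)

lemma f_U_pos: "x \<in> U \<Longrightarrow> 0 < f x"
  using f_U \<sigma> by force

lemma f_C4: "C_diff 4 U f"
  by (rule C_diff_subset[OF f]) simp

lemma b_C4: "C_diff 4 U b"
  unfolding b_def[abs_def] by (intro C_diff_inverse C_diff_sqrt U f_C4) (auto dest: f_U_pos)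

lemma f_cont: "continuous_on A f"
  using C_diff_imp_continuous_on[OF f] continuous_on_subset by blast

lemma f_le: "f x \<le> Cf"
  using f_bound[of "[]" x] by simp

lemma a_cont: "continuous_on A (a h)"
  unfolding a_def by (intro continuous_intros continuous_on_compose2[OF f_cont]) auto

lemma scaled_in_U: "0 < h \<Longrightarrow> h * r < \<rho> \<Longrightarrow> norm u \<le> r \<Longrightarrow> t + h *\<^sub>R u \<in> U"
  unfolding U by (simp add: order.strict_trans1[OF mult_left_mono[of "norm u" r h]])

lemma a_ge: "0 < h \<Longrightarrow> h * r < \<rho> \<Longrightarrow> norm u \<le> r \<Longrightarrow> sqrt \<sigma> \<le> a h u"
  unfolding a_def using f_U[OF scaled_in_U] by auto

lemma a_pos: "0 < h \<Longrightarrow> h * r < \<rho> \<Longrightarrow> norm u \<le> r \<Longrightarrow> 0 < a h u"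
  using a_ge \<sigma> by (meson less_le_trans real_sqrt_gt_zero)

lemma a_le: "a h u \<le> sqrt Cf" and a_nonneg: "t + h *\<^sub>R u \<in> U \<Longrightarrow> 0 \<le> a h u"
  unfolding a_def using f_le f_U_pos by (auto simp: less_imp_le)

lemma dir_deriv_b_cont: 
  assumes "0 < h" "h * r < \<rho>"
  shows "continuous_on (cball 0 r) (\<lambda>u. dir_deriv [h *\<^sub>R u] b (t + h *\<^sub>R u))"
proof -
  have "continuous_on U (partial_deriv i b)" for i
    using C_diff_imp_continuous_on[OF C_diff_iter_partial[OF b_C4, of "[i]"]] by simp
  then have "continuous_on (cball 0 r) (\<lambda>u. partial_deriv i b (t + h *\<^sub>R u))" for i
    by (rule continuous_on_compose2) (use scaled_in_U[OF assms] in \<open>auto intro!: continuous_intros\<close>)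
  then show ?thesis by (auto intro!: continuous_intros)
qed

lemma jac_cont: "0 < h \<Longrightarrow> h * r < \<rho> \<Longrightarrow> continuous_on (cball 0 r) (jac h)"
  unfolding jac_def[abs_def] by (intro continuous_intros a_cont dir_deriv_b_cont) simp_all

text \<open>The radial substitution with \<open>a = 1 / b\<close>; by
  \<open>T \<le> \<sigma> r^2\<close> the boundary sphere is mapped to points where \<open>B\<close>
  vanishes.\<close>

lemma scaled_substitution:
  assumes h: "0 < h" "h * r < \<rho>" and B: "continuous_on UNIV B" "\<And>z. norm z \<ge> sqrt T \<Longrightarrow> B z = 0"
  shows "(\<integral>u. indicator (cball 0 r) u * (B (a h u *\<^sub>R u) * jac h u) \<partial>lborel) = (\<integral>z. B z \<partial>lborel)"
proof -
  \<comment> \<open>The radial derivative of \<open>a = 1 / b\<close> is \<open>- a^2\<close> times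
    that of \<open>b\<close>.\<close>
  define da where "da u = - (a h u ^ 2 * dir_deriv [h *\<^sub>R u] b (t + h *\<^sub>R u))" for u
  have jac: "jac h u = a h u ^ (CARD('d) - 1) * (a h u + da u)" for u
  proof -
    have "a h u ^ CARD('d) = a h u ^ (CARD('d) - 1) * a h u" by (cases "CARD('d)") auto
    then show ?thesis by (simp add: jac_def da_def power2_eq_square algebra_simps)
  qed
  have b_inv: "a h u = inverse (b (t + h *\<^sub>R u))" for u by (simp add: a_def b_def)
  show ?thesis unfolding jac
  proof (rule radial_substitution[OF B r(1) a_cont])
    show "continuous_on (cball 0 r) da"
      unfolding da_def by (intro continuous_intros a_cont dir_deriv_b_cont h)
    show "0 < a h x" if "norm x \<le> r" for x using a_pos[OF h that] .
    show "sqrt T \<le> a h x * r" if "norm x = r" for x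
    proof -
      have "sqrt T \<le> sqrt \<sigma> * r" using r real_sqrt_le_mono[OF r(2)] by (simp add: real_sqrt_mult)
      also have "\<dots> \<le> a h x * r" using a_ge[OF h, of x] that r(1) by (intro mult_right_mono) auto
      finally show ?thesis .
    qed
    fix x :: "real ^ 'd" and s :: real assume s: "0 \<le> s" "s * norm x \<le> r"
    then have nx: "norm (s *\<^sub>R x) \<le> r" by simp
    have inU: "t + s *\<^sub>R h *\<^sub>R x \<in> U" using scaled_in_U[OF h nx] by (simp add: mult.commute)
    have "((\<lambda>s. dir_deriv [] b (t + s *\<^sub>R h *\<^sub>R x)) has_real_derivative dir_deriv [h *\<^sub>R x] b (t + s *\<^sub>R h *\<^sub>R x)) (at s)"
      by (rule dir_deriv_DERIV[OF U(1) inU b_C4]) simp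
    then have db: "((\<lambda>s. b (t + h *\<^sub>R s *\<^sub>R x)) has_real_derivative dir_deriv [h *\<^sub>R x] b (t + h *\<^sub>R s *\<^sub>R x)) (at s)"
      by (simp add: mult.commute)
    have bnz: "b (t + h *\<^sub>R s *\<^sub>R x) \<noteq> 0"
      using f_U_pos[OF scaled_in_U[OF h nx]] by (simp add: b_def)
    have lin: "dir_deriv [h *\<^sub>R s *\<^sub>R x] b y = s * dir_deriv [h *\<^sub>R x] b y" for y
      by (simp add: sum_distrib_left mult_ac)
    have "((\<lambda>s. s * inverse (b (t + h *\<^sub>R s *\<^sub>R x))) has_real_derivative
        inverse (b (t + h *\<^sub>R s *\<^sub>R x)) + s * (- (inverse (b (t + h *\<^sub>R s *\<^sub>R x)) * dir_deriv [h *\<^sub>R x] b (t + h *\<^sub>R s *\<^sub>R x) * inverse (b (t + h *\<^sub>R s *\<^sub>R x))))) (at s)"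
      by (rule derivative_eq_intros db refl bnz | simp)+
    then show "((\<lambda>s. s * a h (s *\<^sub>R x)) has_real_derivative a h (s *\<^sub>R x) + da (s *\<^sub>R x)) (at s)"
      unfolding da_def b_inv lin by (simp add: power2_eq_square mult_ac)
  qed (use B in auto)
qed

end

section \<open>Expansions of the smoothing integrals\<close>

lemma integral_bound_cball:
  fixes g :: "real ^ 'd::finite \<Rightarrow> real"
  assumes "integrable lborel g" "\<And>x. norm x \<le> r \<Longrightarrow> \<bar>g x\<bar> \<le> c" "\<And>x. norm x > r \<Longrightarrow> g x = 0"
  shows "\<bar>\<integral>x. g x \<partial>lborel\<bar> \<le> c * measure lborel (cball (0 :: real ^ 'd) r)"
proof -
  have fin: "emeasure lborel (cball (0 :: real ^ 'd) r) < \<infinity>"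
    by (rule emeasure_lborel_cball_finite)
  have "\<bar>\<integral>x. g x \<partial>lborel\<bar> \<le> (\<integral>x. \<bar>g x\<bar> \<partial>lborel)"
    using integral_norm_bound[of lborel g] by simp
  also have "\<dots> \<le> (\<integral>x. c * indicator (cball 0 r) x \<partial>(lborel :: (real ^ 'd) measure))"
  proof (rule Bochner_Integration.integral_mono)
    show "integrable lborel (\<lambda>x. \<bar>g x\<bar>)" using assms(1) by simp
    show "integrable lborel (\<lambda>x :: real ^ 'd. c * indicator (cball 0 r) x)"
      using fin by (intro integrable_mult_right) simp
    show "\<bar>g x\<bar> \<le> c * indicator (cball 0 r) x" for x
      using assms(2,3)[of x] by (cases "norm x \<le> r") auto
  qed
  finally show ?thesis by simp
qed

lemma smallo_bigo_diff:
  assumes "(\<lambda>x. f x - g x :: real) \<in> o[F](h)" "g \<in> O[F](h)"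
  shows "f \<in> O[F](h)"
  using sum_in_bigo(1)[OF landau_o.small_imp_big[OF assms(1)] assms(2)] by simp

lemma dir_taylor_bigo: "dir_taylor n g t \<in> O[F](\<lambda>w. norm w ^ n)"
proof -
  obtain C where "C \<ge> 0" "\<And>w. \<bar>dir_taylor n g t w\<bar> \<le> C * norm w ^ n"
    using dir_taylor_bound by blast
  then show ?thesis by (intro bigoI[of _ C]) simp
qed

lemma bigo_at_0_E:
  fixes X :: "real ^ 'd::finite \<Rightarrow> real"
  assumes "X \<in> O[at 0](\<lambda>w. norm w ^ n)" "X 0 = 0"
  shows "\<exists>c>0. \<exists>\<delta>>0. \<forall>w. norm w < \<delta> \<longrightarrow> \<bar>X w\<bar> \<le> c * norm w ^ n"
proof -
  from landau_o.bigE[OF assms(1)] obtain c where c: "c > 0"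
    "eventually (\<lambda>w. norm (X w) \<le> c * norm (norm w ^ n)) (at 0)" by blast
  from c(2) obtain \<delta> where "\<delta> > 0" "\<And>w. w \<noteq> 0 \<Longrightarrow> norm w < \<delta> \<Longrightarrow> \<bar>X w\<bar> \<le> c * norm w ^ n"
    unfolding eventually_at by auto
  then show ?thesis using c(1) assms(2)
    by (intro exI[of _ c] conjI exI[of _ \<delta>] allI impI) (metis abs_zero mult_nonneg_nonneg less_imp_le norm_ge_zero zero_le_power)+
qed

text \<open>In the Taylor formulas at \<open>v\<close> and \<open>- v\<close> the first-order terms
  cancel and the second-order forms are even. The directions \<open>ws\<close> record derivatives
  already taken, so two further orders suffice.\<close>

lemma second_difference_bound:
  fixes f :: "real ^ 'd::finite \<Rightarrow> real"
  assumes f: "C_diff k UNIV f" and ws: "length ws + 2 \<le> k"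
    and bound: "\<And>is x. length is \<le> k \<Longrightarrow> \<bar>iter_partial is f x\<bar> \<le> Cf"
  shows "\<bar>dir_deriv ws f (x + v) + dir_deriv ws f (x - v) - 2 * dir_deriv ws f x\<bar>
    \<le> l1_norm v ^ 2 * (prod_list (map l1_norm ws) * Cf)"
proof -
  define D where "D w y = dir_deriv (w # w # ws) f y" for w y
  have D: "\<bar>D v y\<bar> \<le> l1_norm v ^ 2 * (prod_list (map l1_norm ws) * Cf)" "D (- v) y = D v y" for y
  proof -
    show "\<bar>D v y\<bar> \<le> l1_norm v ^ 2 * (prod_list (map l1_norm ws) * Cf)"
      using multilin_bound[of "v # v # ws" "\<lambda>is. iter_partial is f y" Cf] bound ws
      by (simp add: D_def power2_eq_square mult_ac)
    show "D (- v) y = D v y" by (simp add: D_def sum_negf)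
  qed
  have taylor: "\<exists>y. dir_deriv ws f (x + w) = dir_deriv ws f x + dir_deriv (w # ws) f x + D w y / 2" for w
  proof -
    have "\<exists>\<xi>. 0 \<le> \<xi> \<and> \<xi> \<le> 1 \<and> dir_deriv ws f (x + w) =
      (\<Sum>m<2. dir_deriv (replicate m w @ ws) f x / fact m) + dir_deriv (replicate 2 w @ ws) f (x + \<xi> *\<^sub>R w) / fact 2"
      by (rule dir_deriv_taylor[OF open_UNIV _ f]) (use ws in auto)
    then show ?thesis unfolding D_def by (auto simp: numeral_2_eq_2)
  qed
  obtain y where y: "dir_deriv ws f (x + v) = dir_deriv ws f x + dir_deriv (v # ws) f x + D v y / 2"
    using taylor by blast
  obtain y' where y': "dir_deriv ws f (x + - v) = dir_deriv ws f x + dir_deriv (- v # ws) f x + D (- v) y' / 2"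
    using taylor by blast
  have "dir_deriv (- v # ws) f x = - dir_deriv (v # ws) f x" by (simp add: sum_negf)
  then have eq: "dir_deriv ws f (x + v) + dir_deriv ws f (x - v) - 2 * dir_deriv ws f x = (D v y + D v y') / 2"
    using y y' D(2) by (simp add: field_simps)
  have "\<bar>(D v y + D v y') / 2\<bar> \<le> l1_norm v ^ 2 * (prod_list (map l1_norm ws) * Cf)"
    using abs_triangle_ineq[of "D v y" "D v y'"] D(1)[of y] D(1)[of y'] by simp
  then show ?thesis unfolding eq .
qed

context density_at
begin

lemma Cf_nonneg: "0 \<le> Cf"
  using f_bound[of "[]" 0] by simp

lemma scaled_mem: "0 < h \<Longrightarrow> h * r < x \<Longrightarrow> norm u \<le> r \<Longrightarrow> norm (h *\<^sub>R u) < x"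
  using order.strict_trans1[OF mult_left_mono[of "norm u" r h]] by simp

text \<open>For \<open>\<kappa> = K\<close> and \<open>g = f\<close> this is the mean of the
  estimator with the true density in place of the pilot value, in the scaled variable
  \<open>u\<close>. The restriction to \<open>norm u \<le> r\<close> keeps \<open>t + h u\<close> in
  the region where \<open>f\<close> is bounded below when \<open>h\<close> is small.\<close>

definition smooth_int :: "(real ^ 'd \<Rightarrow> real) \<Rightarrow> real \<Rightarrow> (real ^ 'd \<Rightarrow> real) \<Rightarrow> real"
  where "smooth_int \<kappa> h g = (\<integral>u. indicator (cball 0 r) u *
    (\<kappa> (a h u *\<^sub>R u) * (a h u ^ CARD('d) * g (t + h *\<^sub>R u))) \<partial>lborel)"

lemma smooth_integrable:
  assumes "continuous_on UNIV \<kappa>" "continuous_on UNIV g"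
  shows "integrable lborel (\<lambda>u. indicator (cball 0 r) u * (\<kappa> (a h u *\<^sub>R u) * (a h u ^ CARD('d) * g (t + h *\<^sub>R u))))"
proof -
  have "integrable lborel (\<lambda>u. indicator (cball 0 r) u *\<^sub>R (\<kappa> (a h u *\<^sub>R u) * (a h u ^ CARD('d) * g (t + h *\<^sub>R u))))"
    by (intro borel_integrable_compact compact_cball continuous_intros continuous_on_compose2[OF assms(1)]
        continuous_on_compose2[OF assms(2)] a_cont) auto
  then show ?thesis by simp
qed

text \<open>After the substitution \<open>z = a(u) u\<close> the integral of
  \<open>\<kappa> z * q z\<close> has the shape of \<open>smooth_int\<close>, and a pointwise error
  remains. The kernel enters through a bound on its values; no derivative of it is taken.\<close>

lemma smooth_int_compare:
  assumes h: "0 < h" "h * r < \<rho>"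
    and \<kappa>: "continuous_on UNIV \<kappa>" "\<And>z. norm z \<ge> sqrt T \<Longrightarrow> \<kappa> z = 0" "\<And>z. \<bar>\<kappa> z\<bar> \<le> M" "0 \<le> M"
    and cont: "continuous_on UNIV q" "continuous_on UNIV g"
    and err: "\<And>u. norm u \<le> r \<Longrightarrow>
      \<bar>g (t + h *\<^sub>R u) - q (a h u *\<^sub>R u) * (1 - a h u * dir_deriv [h *\<^sub>R u] b (t + h *\<^sub>R u))\<bar> \<le> e"
  shows "\<bar>smooth_int \<kappa> h g - (\<integral>z. \<kappa> z * q z \<partial>lborel)\<bar>
    \<le> M * (sqrt Cf ^ CARD('d) * e) * measure lborel (cball (0 :: real ^ 'd) r)"
proof -
  let ?I = "\<lambda>u. indicator (cball 0 r) u * (\<kappa> (a h u *\<^sub>R u) * (a h u ^ CARD('d) * g (t + h *\<^sub>R u)))"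
  define B where "B z = \<kappa> z * q z" for z
  have B_cont: "continuous_on UNIV B" unfolding B_def[abs_def] by (intro continuous_intros \<kappa> cont)
  have B0: "B z = 0" if "norm z \<ge> sqrt T" for z using \<kappa>(2)[OF that] by (simp add: B_def)
  let ?J = "\<lambda>u. indicator (cball 0 r) u * (B (a h u *\<^sub>R u) * jac h u)"
  have intI: "integrable lborel ?I" by (rule smooth_integrable[OF \<kappa>(1) cont(2)])
  have "integrable lborel (\<lambda>u. indicator (cball 0 r) u *\<^sub>R (B (a h u *\<^sub>R u) * jac h u))"
    by (intro borel_integrable_compact compact_cball continuous_intros continuous_on_compose2[OF B_cont] a_cont jac_cont h) auto
  then have intJ: "integrable lborel ?J" by simp
  have "smooth_int \<kappa> h g - (\<integral>z. \<kappa> z * q z \<partial>lborel) = (\<integral>u. ?I u - ?J u \<partial>lborel)"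
    using intI intJ scaled_substitution[OF h B_cont B0] by (simp add: smooth_int_def B_def)
  also have "\<bar>\<dots>\<bar> \<le> M * (sqrt Cf ^ CARD('d) * e) * measure lborel (cball (0 :: real ^ 'd) r)"
  proof (rule integral_bound_cball)
    show "integrable lborel (\<lambda>u. ?I u - ?J u)" using intI intJ by (rule Bochner_Integration.integrable_diff)
    fix u :: "real ^ 'd"
    show "?I u - ?J u = 0" if "norm u > r" using that by simp
    assume u: "norm u \<le> r"
    define x where "x = g (t + h *\<^sub>R u)"
    define y where "y = dir_deriv [h *\<^sub>R u] b (t + h *\<^sub>R u)"
    have "?I u - ?J u = \<kappa> (a h u *\<^sub>R u) * (a h u ^ CARD('d) * (x - q (a h u *\<^sub>R u) * (1 - a h u * y)))"
      using u unfolding B_def jac_def x_def[symmetric] y_def[symmetric] by (simp add: algebra_simps)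
    also have "\<bar>\<dots>\<bar> \<le> M * (sqrt Cf ^ CARD('d) * e)"
      unfolding abs_mult[of "\<kappa> _"] abs_mult[of "_ ^ _"]
    proof (intro mult_mono \<kappa>(3))
      show "\<bar>a h u ^ CARD('d)\<bar> \<le> sqrt Cf ^ CARD('d)"
        using a_le[of h u] a_nonneg[OF scaled_in_U[OF h u]] by (simp add: power_mono)
      show "\<bar>x - q (a h u *\<^sub>R u) * (1 - a h u * y)\<bar> \<le> e" unfolding x_def y_def by (rule err[OF u])
    qed (use \<kappa>(4) Cf_nonneg order_trans[OF abs_ge_zero err[OF u]] in auto)
    finally show "\<bar>?I u - ?J u\<bar> \<le> M * (sqrt Cf ^ CARD('d) * e)" .
  qed
  finally show ?thesis .
qed

lemma main_expansion:
  assumes intK: "(\<integral>z. K z \<partial>lborel) = 1" and e: "0 < e"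
  shows "\<exists>h0>0. \<forall>h. 0 < h \<and> h < h0 \<longrightarrow>
    \<bar>smooth_int K h f - f t - h ^ 4 * (\<integral>z. K z * dir_taylor 4 (\<lambda>x. 1 / f x) t z \<partial>lborel)\<bar> \<le> e * h ^ 4"
proof -
  obtain M where M: "M > 0" "\<And>s. s \<ge> 0 \<Longrightarrow> \<bar>\<Phi> s\<bar> \<le> M"
    using bounded_by_compact_support[OF cont_\<Phi> T(2)] by auto
  define V where "V = measure lborel (cball (0 :: real ^ 'd) r)"
  define W where "W = M * sqrt Cf ^ CARD('d) * r ^ 4 * V"
  have W: "W \<ge> 0" unfolding W_def V_def using M Cf_nonneg r by simp
  \<comment> \<open>The summand 1 guards against \<open>W = 0\<close>.\<close>
  define e' where "e' = e / (W + 1)"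
  have e': "0 < e'" "e' * W \<le> e"
    using e W by (auto simp: e'_def field_simps)
  let ?q1 = "dir_taylor 1 b t" and ?q3 = "dir_taylor 3 b t" and ?q4 = "dir_taylor 4 (\<lambda>x. 1 / f x) t"
  define c where "c w = dir_deriv [w] b (t + w)" for w
  define E where "E w = f (t + w) - (f t - ?q1 w / b t ^ 2 / b (t + w)
      + ?q3 w / b (t + w) ^ 3 + ?q4 w / b (t + w) ^ 4) * (1 - c w / b (t + w))" for w
  obtain \<delta> where \<delta>: "\<delta> > 0" "\<And>w. norm w < \<delta> \<Longrightarrow> \<bar>E w\<bar> \<le> e' * norm w ^ 4"
    using square_root_law_remainder[OF U(1,2) f_C4 f_U_pos meta_eq_to_obj_eq[OF b_def[abs_def]] e'(1)] unfolding E_def c_def by blast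
  show ?thesis
  proof (intro exI[of _ "min \<rho> \<delta> / r"] conjI allI impI)
    show "0 < min \<rho> \<delta> / r" using \<rho> \<delta> r by simp
    fix h :: real
    assume "0 < h \<and> h < min \<rho> \<delta> / r"
    then have h: "0 < h" "h * r < \<rho>" "h * r < \<delta>" using r by (auto simp: field_simps)
    \<comment> \<open>The Lagrange polynomial in \<open>h z\<close>. A part of degree
      \<open>n\<close> at \<open>h u\<close>, divided by \<open>b (t + h u) ^ n\<close>, is
      \<open>h ^ n\<close> times the same part at \<open>z = a(u) u\<close>, which matches the
      remainder estimate.\<close>
    define q where "q z = f t - h / b t ^ 2 * ?q1 z + h ^ 3 * ?q3 z + h ^ 4 * ?q4 z" for z
    have intg: "integrable lborel (\<lambda>z. K z * g z)" if "continuous_on UNIV g" for g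
      by (rule integrable_continuous_compact_support[of _ "sqrt T"])
        (use that K_0 in \<open>auto intro!: continuous_intros cont_K\<close>)
    \<comment> \<open>An even kernel annihilates the parts of odd degree.\<close>
    have odd: "(\<integral>z. K z * dir_taylor n g t z \<partial>lborel) = 0" if "odd n" for n g
      by (rule integral_odd_eq_0)
        (use that in \<open>auto intro!: borel_measurable_continuous_onI continuous_intros cont_K continuous_on_dir_taylor simp: K_uminus dir_taylor_uminus\<close>)
    have "(\<integral>z. K z * q z \<partial>lborel) = (\<integral>z. f t * K z - h / b t ^ 2 * (K z * ?q1 z) + h ^ 3 * (K z * ?q3 z) + h ^ 4 * (K z * ?q4 z) \<partial>lborel)"
      unfolding q_def by (rule Bochner_Integration.integral_cong) (simp_all add: algebra_simps)
    also have "\<dots> = f t * (\<integral>z. K z \<partial>lborel) - h / b t ^ 2 * (\<integral>z. K z * ?q1 z \<partial>lborel)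
        + h ^ 3 * (\<integral>z. K z * ?q3 z \<partial>lborel) + h ^ 4 * (\<integral>z. K z * ?q4 z \<partial>lborel)"
      using intg[of "\<lambda>_. 1"] intg[OF continuous_on_dir_taylor] by simp
    also have "\<dots> = f t + h ^ 4 * (\<integral>z. K z * ?q4 z \<partial>lborel)"
      using intK odd[of 1 b] odd[of 3 b] by simp
    finally have intq: "(\<integral>z. K z * q z \<partial>lborel) = f t + h ^ 4 * (\<integral>z. K z * ?q4 z \<partial>lborel)" .
    have "\<bar>smooth_int K h f - (\<integral>z. K z * q z \<partial>lborel)\<bar> \<le> M * (sqrt Cf ^ CARD('d) * (e' * (h * r) ^ 4)) * V"
      unfolding V_def
    proof (rule smooth_int_compare[OF h(1,2) cont_K K_0 _ _ _ f_cont])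
      show "\<bar>K z\<bar> \<le> M" for z unfolding K by (rule M) simp
      show "continuous_on UNIV q"
        unfolding q_def[abs_def] by (intro continuous_intros continuous_on_dir_taylor)
      fix u :: "real ^ 'd" assume u: "norm u \<le> r"
      have ab: "x / b (t + h *\<^sub>R u) ^ n = x * a h u ^ n" for x n
        by (simp add: a_def b_def power_inverse field_simps)
      have ab1: "x / b (t + h *\<^sub>R u) = x * a h u" for x using ab[of x 1] by simp
      have "q (a h u *\<^sub>R u) = f t - ?q1 (h *\<^sub>R u) / b t ^ 2 / b (t + h *\<^sub>R u) + ?q3 (h *\<^sub>R u) / b (t + h *\<^sub>R u) ^ 3
          + ?q4 (h *\<^sub>R u) / b (t + h *\<^sub>R u) ^ 4"
        unfolding q_def ab ab1 dir_taylor_scaleR by simp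
      then have "f (t + h *\<^sub>R u) - q (a h u *\<^sub>R u) * (1 - a h u * c (h *\<^sub>R u)) = E (h *\<^sub>R u)"
        unfolding E_def ab1 by (simp add: mult.commute)
      also have "\<bar>\<dots>\<bar> \<le> e' * norm (h *\<^sub>R u) ^ 4"
        by (rule \<delta>(2)[OF scaled_mem[OF h(1,3) u]])
      also have "\<dots> \<le> e' * (h * r) ^ 4"
        using h u e' by (intro mult_left_mono power_mono) auto
      finally show "\<bar>f (t + h *\<^sub>R u) - q (a h u *\<^sub>R u) * (1 - a h u * dir_deriv [h *\<^sub>R u] b (t + h *\<^sub>R u))\<bar> \<le> e' * (h * r) ^ 4"
        unfolding c_def .
    qed (use M in auto)
    also have "\<dots> = (e' * W) * h ^ 4"
      by (simp add: W_def power_mult_distrib mult_ac)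
    also have "\<dots> \<le> e * h ^ 4"
      using e' h by (intro mult_right_mono) auto
    finally show "\<bar>smooth_int K h f - f t - h ^ 4 * (\<integral>z. K z * ?q4 z \<partial>lborel)\<bar> \<le> e * h ^ 4"
      unfolding intq by (simp add: diff_diff_eq)
  qed
qed

text \<open>Lagrange inversion to first order, with \<open>y = w / b (t + w)\<close>: up to second
  order \<open>1\<close> is \<open>1 + dir_taylor 1 b t y\<close> times the Jacobian factor, and
  with relative error of first order a linear form in \<open>w\<close> is the same form in
  \<open>b t y\<close> times that factor. These two facts transport the constant and the linear part
  of a function through the substitution.\<close>

lemma b_first_order:
  shows "\<exists>c>0. \<exists>\<delta>>0. \<forall>w. norm w < \<delta> \<longrightarrow>
      \<bar>1 - (1 + dir_taylor 1 b t w / b (t + w)) * (1 - dir_deriv [w] b (t + w) / b (t + w))\<bar> \<le> c * norm w ^ 2 \<and>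
      \<bar>1 - b t / b (t + w) * (1 - dir_deriv [w] b (t + w) / b (t + w))\<bar> \<le> c * norm w ^ 1"
proof -
  define q where "q = dir_taylor 1 b t"
  define c where "c w = dir_deriv [w] b (t + w)" for w
  define g where "g w = b (t + w)" for w
  have le: "(\<lambda>w :: real ^ 'd. norm w ^ 2) \<in> O[at 0](\<lambda>w. norm w ^ 1)"
  proof (rule bigoI[of _ 1])
    show "eventually (\<lambda>w :: real ^ 'd. norm (norm w ^ 2) \<le> 1 * norm (norm w ^ 1)) (at 0)"
      unfolding eventually_at
      by (rule exI[of _ 1]) (auto simp: power2_eq_square mult_le_cancel_right1)
  qed
  have gt_pos: "b t > 0" using f_U_pos[OF U(2)] by (simp add: b_def)
  have g_lim: "(g \<longlongrightarrow> b t) (at 0)"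
  proof -
    have "isCont b t"
      using C_diff_imp_continuous_on[OF b_C4] U continuous_on_eq_continuous_at by blast
    then show ?thesis unfolding g_def isCont_def by (rule LIM_offset_zero)
  qed
  have g_O: "g \<in> O[at 0](\<lambda>_. 1)"
    by (rule bigoI_tendsto[of _ _ "b t"]) (use g_lim in auto)
  have "((\<lambda>w. 1 / g w ^ 2) \<longlongrightarrow> 1 / b t ^ 2) (at 0)"
    by (intro tendsto_intros g_lim) (use gt_pos in simp)
  then have inv_O: "(\<lambda>w. 1 / g w ^ 2) \<in> O[at 0](\<lambda>_. 1)"
    by (intro bigoI_tendsto) simp_all
  have q_O: "q \<in> O[at 0](\<lambda>w. norm w ^ 1)" unfolding q_def by (rule dir_taylor_bigo)
  have "(\<lambda>w. (c w - q w) - 2 * dir_taylor 2 b t w) \<in> o[at 0](\<lambda>w. norm w ^ 2)"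
    using dir_deriv_taylor_smallo[OF U(1,2) C_diff_mono[OF b_C4, of 2], of 1 1]
    by (simp add: c_def q_def dir_taylor_def numeral_2_eq_2 diff_diff_eq)
  from smallo_bigo_diff[OF this] dir_taylor_bigo[of 2 b t]
  have cq: "(\<lambda>w. c w - q w) \<in> O[at 0](\<lambda>w. norm w ^ 2)" by simp
  have c_O: "c \<in> O[at 0](\<lambda>w. norm w ^ 1)"
    using sum_in_bigo(1)[OF landau_o.big_trans[OF cq le] q_O] by simp
  have "(\<lambda>w. (g w - b t) - q w) \<in> o[at 0](\<lambda>w. norm w ^ 1)"
    using dir_deriv_taylor_smallo[OF U(1,2) C_diff_mono[OF b_C4, of 1], of 1 0]
    by (simp add: g_def q_def dir_taylor_def diff_diff_eq)
  from smallo_bigo_diff[OF this q_O] have gb: "(\<lambda>w. g w - b t) \<in> O[at 0](\<lambda>w. norm w ^ 1)" .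
  have ev: "eventually (\<lambda>w. g w > 0) (at 0)"
    using g_lim gt_pos by (rule order_tendstoD)
  \<comment> \<open>Over a common denominator the small differences \<open>c - q\<close>, and below
    \<open>g - b t\<close>, become visible.\<close>
  have "(\<lambda>w. (g w * (c w - q w) + q w * c w) * (1 / g w ^ 2)) \<in> O[at 0](\<lambda>w. norm w ^ 2)"
  proof -
    have "(\<lambda>w. g w * (c w - q w)) \<in> O[at 0](\<lambda>w. norm w ^ 2)"
      using landau_o.big.mult[OF g_O cq] by simp
    moreover have "(\<lambda>w. q w * c w) \<in> O[at 0](\<lambda>w. norm w ^ 2)"
      using landau_o.big.mult[OF q_O c_O] by (simp add: power2_eq_square)
    ultimately show ?thesis
      using landau_o.big.mult[OF sum_in_bigo(1) inv_O] by fastforce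
  qed
  also have "?this \<longleftrightarrow> (\<lambda>w. 1 - (1 + q w / g w) * (1 - c w / g w)) \<in> O[at 0](\<lambda>w. norm w ^ 2)"
    by (rule landau_o.big.in_cong, rule eventually_mono[OF ev]) (simp add: field_simps power2_eq_square)
  finally have X: "(\<lambda>w. 1 - (1 + q w / g w) * (1 - c w / g w)) \<in> O[at 0](\<lambda>w. norm w ^ 2)" .
  have "(\<lambda>w. (g w * (g w - b t) + b t * c w) * (1 / g w ^ 2)) \<in> O[at 0](\<lambda>w. norm w ^ 1)"
  proof -
    have "(\<lambda>w. g w * (g w - b t)) \<in> O[at 0](\<lambda>w. norm w ^ 1)"
      using landau_o.big.mult[OF g_O gb] by simp
    moreover have "(\<lambda>w. b t * c w) \<in> O[at 0](\<lambda>w. norm w ^ 1)" using c_O by simp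
    ultimately show ?thesis
      using landau_o.big.mult[OF sum_in_bigo(1) inv_O] by fastforce
  qed
  also have "?this \<longleftrightarrow> (\<lambda>w. 1 - b t / g w * (1 - c w / g w)) \<in> O[at 0](\<lambda>w. norm w ^ 1)"
    by (rule landau_o.big.in_cong, rule eventually_mono[OF ev]) (simp add: field_simps power2_eq_square)
  finally have Y: "(\<lambda>w. 1 - b t / g w * (1 - c w / g w)) \<in> O[at 0](\<lambda>w. norm w ^ 1)" .
  have zero: "q 0 = 0" "c 0 = 0" "g 0 = b t"
    by (simp_all add: q_def c_def g_def dir_taylor_def)
  obtain c1 d1 where 1: "c1 > 0" "d1 > 0" "\<And>w. norm w < d1 \<Longrightarrow> \<bar>1 - (1 + q w / g w) * (1 - c w / g w)\<bar> \<le> c1 * norm w ^ 2"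
    using bigo_at_0_E[OF X] zero by auto
  obtain c2 d2 where 2: "c2 > 0" "d2 > 0" "\<And>w. norm w < d2 \<Longrightarrow> \<bar>1 - b t / g w * (1 - c w / g w)\<bar> \<le> c2 * norm w ^ 1"
    using bigo_at_0_E[OF Y] zero gt_pos by auto
  have mx: "c1 * norm w ^ n \<le> max c1 c2 * norm w ^ n" "c2 * norm w ^ n \<le> max c1 c2 * norm w ^ n" for w :: "real ^ 'd" and n
    by (intro mult_right_mono; simp)+
  show ?thesis unfolding q_def[symmetric] c_def[symmetric] g_def[symmetric]
  proof (rule exI[of _ "max c1 c2"], rule conjI, use 1 in simp, rule exI[of _ "min d1 d2"], intro conjI allI impI)
    fix w :: "real ^ 'd" assume w: "norm w < min d1 d2"
    show "\<bar>1 - (1 + q w / g w) * (1 - c w / g w)\<bar> \<le> max c1 c2 * norm w ^ 2"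
      using 1(3)[of w] w mx(1)[of w 2] by linarith
    show "\<bar>1 - b t / g w * (1 - c w / g w)\<bar> \<le> max c1 c2 * norm w ^ 1"
      using 2(3)[of w] w mx(2)[of w 1] by linarith
  qed (use 1 2 in simp)
qed

text \<open>The terms of order 0 and 1 in \<open>h\<close> vanish because \<open>Klin\<close> has integral 0 and is even.\<close>

lemma linear_term_bound:
  "\<exists>C1\<ge>0. \<exists>h0>0. \<forall>h g g1 G. 0 < h \<longrightarrow> h < h0 \<longrightarrow> continuous_on UNIV g \<longrightarrow> continuous_on UNIV g1 \<longrightarrow>
    (\<forall>s w. g1 (s *\<^sub>R w) = s * g1 w) \<longrightarrow> \<bar>g t\<bar> \<le> G \<longrightarrow> (\<forall>w. \<bar>g1 w\<bar> \<le> G * norm w) \<longrightarrow>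
    (\<forall>w. \<bar>g (t + w) - g t - g1 w\<bar> \<le> G * norm w ^ 2) \<longrightarrow> \<bar>smooth_int Klin h g\<bar> \<le> C1 * G * h ^ 2"
proof -
  obtain M where M: "M > 0" "\<And>s. s \<ge> 0 \<Longrightarrow> \<bar>lin s\<bar> \<le> M"
    using bounded_by_compact_support[OF cont_lin lin_0] by auto
  define V where "V = measure lborel (cball (0 :: real ^ 'd) r)"
  let ?q1 = "dir_taylor 1 b t"
  define c where "c w = dir_deriv [w] b (t + w)" for w
  define X where "X w = 1 - (1 + ?q1 w / b (t + w)) * (1 - c w / b (t + w))" for w
  define Y where "Y w = 1 - b t / b (t + w) * (1 - c w / b (t + w))" for w
  obtain k \<delta> where k: "k > 0" "\<delta> > 0" "\<And>w. norm w < \<delta> \<Longrightarrow> \<bar>X w\<bar> \<le> k * norm w ^ 2"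
    "\<And>w. norm w < \<delta> \<Longrightarrow> \<bar>Y w\<bar> \<le> k * norm w ^ 1"
    using b_first_order unfolding X_def Y_def c_def by blast
  \<comment> \<open>Built from the kernel and the density but not from \<open>g\<close>, so that the
    bound applies to all second differences at once and can be averaged.\<close>
  define C1 where "C1 = M * sqrt Cf ^ CARD('d) * (2 * k + 1) * r ^ 2 * V"
  have C1: "C1 \<ge> 0" unfolding C1_def V_def using M Cf_nonneg r k by simp
  show ?thesis
  proof (rule exI[of _ C1], rule conjI[OF C1], rule exI[of _ "min \<rho> \<delta> / r"], intro conjI allI impI)
    show "0 < min \<rho> \<delta> / r" using \<rho> k r by simp
    fix h G :: real and g g1 :: "real ^ 'd \<Rightarrow> real"
    assume h0: "0 < h" "h < min \<rho> \<delta> / r" and g_cont: "continuous_on UNIV g" and g1_cont: "continuous_on UNIV g1"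
      and g1_lin: "\<forall>s w. g1 (s *\<^sub>R w) = s * g1 w" and G0: "\<bar>g t\<bar> \<le> G" and G1: "\<forall>w. \<bar>g1 w\<bar> \<le> G * norm w"
      and G2: "\<forall>w. \<bar>g (t + w) - g t - g1 w\<bar> \<le> G * norm w ^ 2"
    from h0 have h: "0 < h" "h * r < \<rho>" "h * r < \<delta>" using r by (auto simp: field_simps)
    have G: "G \<ge> 0" using G0 by linarith
    \<comment> \<open>The pointwise error: \<open>X\<close> for the constant part, \<open>Y\<close>
      for the linear part, and the Taylor remainder of \<open>g\<close>.\<close>
    define E where "E w = g t * X w + g1 w * Y w + (g (t + w) - g t - g1 w)" for w
    have E: "\<bar>E w\<bar> \<le> G * (2 * k + 1) * norm w ^ 2" if "norm w < \<delta>" for w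
    proof -
      have "\<bar>g t * X w\<bar> \<le> G * (k * norm w ^ 2)"
        unfolding abs_mult by (intro mult_mono G0 k that G) auto
      moreover have "\<bar>g1 w * Y w\<bar> \<le> (G * norm w) * (k * norm w ^ 1)"
        unfolding abs_mult by (intro mult_mono G1[rule_format] k that) (use G in auto)
      ultimately show ?thesis
        unfolding E_def using G2[rule_format, of w] by (simp add: power2_eq_square algebra_simps)
    qed
    \<comment> \<open>To first order the displacement \<open>h u\<close> is \<open>b t\<close> times
      \<open>h z\<close>, and the constant \<open>g t\<close> picks up the linear part of
      \<open>b\<close> from the Jacobian.\<close>
    define q1 where "q1 z = b t * g1 z + g t * ?q1 z" for z
    define q where "q z = g t + h * q1 z" for z
    have q1_cont: "continuous_on UNIV q1"
      unfolding q1_def[abs_def] by (intro continuous_intros g1_cont continuous_on_dir_taylor)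
    have intq: "(\<integral>z. Klin z * q z \<partial>lborel) = 0"
    proof -
      have intg: "integrable lborel (\<lambda>z. Klin z * g z)" if "continuous_on UNIV g" for g
        by (rule integrable_continuous_compact_support[of _ "sqrt T"])
          (use that Klin_0 in \<open>auto intro!: continuous_intros cont_Klin\<close>)
      have "(\<integral>z. Klin z * q1 z \<partial>lborel) = 0"
      proof (rule integral_odd_eq_0)
        show "(\<lambda>z. Klin z * q1 z) \<in> borel_measurable borel"
          by (intro borel_measurable_continuous_onI continuous_intros cont_Klin q1_cont)
        show "Klin (- z) * q1 (- z) = - (Klin z * q1 z)" for z
          using g1_lin[rule_format, of "-1" z] by (simp add: q1_def Klin_uminus dir_taylor_uminus algebra_simps)
      qed
      moreover have "(\<integral>z. Klin z * q z \<partial>lborel) = (\<integral>z. g t * Klin z + h * (Klin z * q1 z) \<partial>lborel)"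
        unfolding q_def by (rule Bochner_Integration.integral_cong) (simp_all add: algebra_simps)
      ultimately show ?thesis
        using intg[of "\<lambda>_. 1"] intg[OF q1_cont] integral_Klin by simp
    qed
    have "\<bar>smooth_int Klin h g - (\<integral>z. Klin z * q z \<partial>lborel)\<bar> \<le> M * (sqrt Cf ^ CARD('d) * (G * (2 * k + 1) * (h * r) ^ 2)) * V"
      unfolding V_def
    proof (rule smooth_int_compare[OF h(1,2) cont_Klin Klin_0 _ _ _ g_cont])
      show "\<bar>Klin z\<bar> \<le> M" for z unfolding Klin_def by (rule M) simp
      show "continuous_on UNIV q" unfolding q_def[abs_def] by (intro continuous_intros q1_cont)
      fix u :: "real ^ 'd" assume u: "norm u \<le> r"
      have ab1: "x / b (t + h *\<^sub>R u) = x * a h u" for x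
        by (simp add: a_def b_def field_simps)
      have "g (t + h *\<^sub>R u) - q (a h u *\<^sub>R u) * (1 - a h u * c (h *\<^sub>R u)) = E (h *\<^sub>R u)"
        unfolding E_def q_def q1_def X_def Y_def ab1 dir_taylor_scaleR g1_lin[rule_format] power_one_right
        by (simp add: algebra_simps)
      also have "\<bar>\<dots>\<bar> \<le> G * (2 * k + 1) * norm (h *\<^sub>R u) ^ 2"
        by (rule E[OF scaled_mem[OF h(1,3) u]])
      also have "\<dots> \<le> G * (2 * k + 1) * (h * r) ^ 2"
        using h u k G by (intro mult_left_mono power_mono) auto
      finally show "\<bar>g (t + h *\<^sub>R u) - q (a h u *\<^sub>R u) * (1 - a h u * dir_deriv [h *\<^sub>R u] b (t + h *\<^sub>R u))\<bar>
          \<le> G * (2 * k + 1) * (h * r) ^ 2"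
        unfolding c_def .
    qed (use M in auto)
    also have "\<dots> = C1 * G * h ^ 2"
      by (simp add: C1_def power_mult_distrib mult_ac)
    finally show "\<bar>smooth_int Klin h g\<bar> \<le> C1 * G * h ^ 2" unfolding intq by simp
  qed
qed

end

section \<open>Moments and the bias of the pilot estimator\<close>

lemma prod_list_eq_mi_power: "prod_list (map (($) z) is) = mi_power z (count_list is)"
proof (induction "is")
  case (Cons a "is")
  have "mi_power z (count_list (a # is)) = (\<Prod>i\<in>UNIV. (if i = a then z $ i else 1) * z $ i ^ count_list is i)"
    unfolding mi_power_def by (rule prod.cong) auto
  also have "\<dots> = z $ a * mi_power z (count_list is)"
    by (simp add: mi_power_def prod.distrib prod.delta)
  finally show ?case using Cons by (simp del: count_list.simps)
qed (simp add: mi_power_def)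

lemma mi_order_count_list: "mi_order (count_list is) = length (is :: 'd::finite list)"
  unfolding mi_order_def by (rule sum_count_set) simp_all

definition mi_mset :: "('d::finite \<Rightarrow> nat) \<Rightarrow> 'd multiset"
  where "mi_mset v = Abs_multiset v"

lemma count_mi_mset [simp]: "count (mi_mset v) = v"
  unfolding mi_mset_def by (rule Abs_multiset_inverse) simp

lemma mset_eq_mi_mset_iff: "mset is = mi_mset v \<longleftrightarrow> count_list is = v"
  by (auto simp: multiset_eq_iff count_mset fun_eq_iff)

text \<open>The lists with prescribed counts are the permutations of one multiset, counted by the
  multinomial coefficient.\<close>

lemma card_count_list_eq:
  "real (card {is. count_list is = v}) * mi_fact v = fact (mi_order v)"
proof -
  have "{is. count_list is = v} = permutations_of_multiset (mi_mset v)"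
    unfolding permutations_of_multiset_def mset_eq_mi_mset_iff ..
  moreover have "(\<Prod>x\<in>set_mset (mi_mset v). fact (count (mi_mset v) x)) = (\<Prod>i\<in>UNIV. fact (v i) :: nat)"
    unfolding count_mi_mset by (rule prod.mono_neutral_left) (auto simp: set_mset_def)
  moreover have "size (mi_mset v) = mi_order v"
    unfolding size_multiset_overloaded_eq mi_order_def count_mi_mset by (rule sum.mono_neutral_left) (auto simp: set_mset_def)
  ultimately have "card {is. count_list is = v} * (\<Prod>i\<in>UNIV. fact (v i)) = fact (mi_order v)"
    using card_permutations_of_multiset(1)[of "mi_mset v"] card_permutations_of_multiset_aux[of "mi_mset v"] by simp
  then have "real (card {is. count_list is = v} * (\<Prod>i\<in>UNIV. fact (v i))) = real (fact (mi_order v))"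
    by (simp only:)
  then show ?thesis by (simp add: mi_fact_def)
qed

lemma iter_partial_eq_mi_deriv:
  assumes "open U" "C_diff k U g" "t \<in> U" "length is \<le> k"
  shows "iter_partial is g t = mi_deriv (count_list is) g t"
proof -
  have "\<forall>i. count_list (SOME js. \<forall>i. count_list js i = count_list is i) i = count_list is i"
    by (rule someI[of "\<lambda>js. \<forall>i. count_list js i = count_list is i" "is"]) simp
  then have "mset is = mset (SOME js. \<forall>i. count_list js i = count_list is i)"
    by (simp add: multiset_eq_iff count_mset)
  from iter_partial_mset_cong[OF assms(1,2) this assms(4,3)] show ?thesis unfolding mi_deriv_def .
qed

text \<open>Lists of coordinates are sorted by their counts: a multi-index \<open>v\<close> arises
  from \<open>k! / v!\<close> lists with equal summands, and \<open>k!\<close> cancels against the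
  Taylor factorial.\<close>

lemma dir_taylor_eq_mi_sum:
  fixes g :: "real ^ 'd::finite \<Rightarrow> real"
  assumes "open U" "C_diff k U g" "t \<in> U"
  shows "dir_taylor k g t z = (\<Sum>v | mi_order v = k. mi_power z v * mi_deriv v g t / mi_fact v)"
proof -
  let ?L = "{is :: 'd list. length is = k}"
  have fin: "finite ?L" using finite_lists_length_eq[of "UNIV :: 'd set" k] by simp
  have img: "count_list ` ?L = {v. mi_order v = k}"
  proof (intro equalityI subsetI)
    fix v :: "'d \<Rightarrow> nat" assume v: "v \<in> {v. mi_order v = k}"
    obtain xs where "mset xs = mi_mset v" using ex_mset by blast
    then have "count_list xs = v" by (simp add: mset_eq_mi_mset_iff)
    then show "v \<in> count_list ` ?L" using v mi_order_count_list[of xs] by auto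
  qed (auto simp: mi_order_count_list)
  have "dir_deriv (replicate k z) g t = (\<Sum>is\<in>?L. mi_power z (count_list is) * mi_deriv (count_list is) g t)"
    unfolding multilin_replicate
    by (rule sum.cong) (use iter_partial_eq_mi_deriv[OF assms] in \<open>auto simp: prod_list_eq_mi_power\<close>)
  also have "\<dots> = (\<Sum>v\<in>count_list ` ?L. \<Sum>is\<in>{is \<in> ?L. count_list is = v}. mi_power z (count_list is) * mi_deriv (count_list is) g t)"
    by (rule sum.image_gen[OF fin])
  also have "\<dots> = (\<Sum>v | mi_order v = k. fact k * (mi_power z v * mi_deriv v g t / mi_fact v))"
    unfolding img
  proof (rule sum.cong[OF refl])
    fix v :: "'d \<Rightarrow> nat" assume "v \<in> {v. mi_order v = k}"
    then have v: "mi_order v = k" by simp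
    then have eq: "{is \<in> ?L. count_list is = v} = {is. count_list is = v}"
      by (auto simp: mi_order_count_list)
    have "mi_fact v > 0" unfolding mi_fact_def by (intro prod_pos) simp
    then have "real (card {is. count_list is = v}) = fact k / mi_fact v"
      using card_count_list_eq[of v] v by (simp add: field_simps)
    then show "(\<Sum>is\<in>{is \<in> ?L. count_list is = v}. mi_power z (count_list is) * mi_deriv (count_list is) g t)
      = fact k * (mi_power z v * mi_deriv v g t / mi_fact v)"
      unfolding eq by simp
  qed
  finally show ?thesis unfolding dir_taylor_def by (simp add: sum_divide_distrib)
qed

locale pilot_density = density_at \<Phi> \<Phi>' \<Phi>'' B2 T K f t Cf \<sigma> \<rho> r
  for \<Phi> \<Phi>' \<Phi>'' :: "real \<Rightarrow> real" and B2 T :: real and K :: "real ^ 'd::finite \<Rightarrow> real"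
    and f :: "real ^ 'd \<Rightarrow> real" and t :: "real ^ 'd" and Cf \<sigma> \<rho> r :: real +
  assumes K_nonneg: "\<And>z. 0 \<le> K z" and int_K: "(\<integral>z. K z \<partial>lborel) = 1" and f_nonneg: "\<And>x. 0 \<le> f x"
begin

lemma K_integrable: "integrable lborel K"
  by (rule integrable_continuous_compact_support[OF cont_K, of "sqrt T"]) (simp add: K_0)

lemma integral_K_dir_taylor:
  assumes "open V" "t \<in> V" "C_diff k V g"
  shows "(\<integral>z. K z * dir_taylor k g t z \<partial>lborel)
    = (\<Sum>v | mi_order v = k. kernel_moment K v * mi_deriv v g t / mi_fact v)"
proof -
  have cont: "continuous_on UNIV (\<lambda>z :: real ^ 'd. mi_power z v)" for v
    unfolding mi_power_def by (intro continuous_intros)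
  have int: "integrable lborel (\<lambda>z. mi_power z v * K z)" for v
    by (rule integrable_continuous_compact_support[of _ "sqrt T"])
      (use K_0 in \<open>auto intro!: continuous_intros cont cont_K\<close>)
  have "(\<integral>z. K z * dir_taylor k g t z \<partial>lborel)
    = (\<integral>z. (\<Sum>v | mi_order v = k. mi_deriv v g t / mi_fact v * (mi_power z v * K z)) \<partial>lborel)"
    unfolding dir_taylor_eq_mi_sum[OF assms(1,3,2)] by (simp add: sum_distrib_left mult_ac)
  also have "\<dots> = (\<Sum>v | mi_order v = k. mi_deriv v g t / mi_fact v * (\<integral>z. mi_power z v * K z \<partial>lborel))"
    using int by (subst Bochner_Integration.integral_sum) auto
  finally show ?thesis by (simp add: kernel_moment_def mult_ac)
qed

section \<open>Second differences of the density and the pilot bias\<close>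

definition sec_diff :: "real ^ 'd \<Rightarrow> real ^ 'd \<Rightarrow> real"
  where "sec_diff v x = f (x + v) + f (x - v) - 2 * f x"

definition bias :: "real \<Rightarrow> real ^ 'd \<Rightarrow> real"
  where "bias h x = (\<integral>w. K w * f (x - h *\<^sub>R w) \<partial>lborel) - f x"

lemma shift_integrable: "continuous_on UNIV g \<Longrightarrow> integrable lborel (\<lambda>w. K w * g w)"
  by (rule integrable_continuous_compact_support[of _ "sqrt T"])
    (use K_0 in \<open>auto intro!: continuous_intros cont_K\<close>)

lemma f_comp_cont: "continuous_on A g \<Longrightarrow> continuous_on A (\<lambda>w. f (g w))"
  by (rule continuous_on_compose2[OF f_cont[of UNIV]]) auto

text \<open>Averaging over \<open>w\<close> and \<open>- w\<close> cancels the first-order term: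
  since \<open>K\<close> is even with integral 1, the bias is a mean of second differences.\<close>

lemma bias_eq: "bias h x = (\<integral>w. K w * (sec_diff (h *\<^sub>R w) x / 2) \<partial>lborel)"
proof -
  have m: "(\<lambda>w. K w * f (x - h *\<^sub>R w)) \<in> borel_measurable borel"
    by (intro borel_measurable_continuous_onI continuous_intros cont_K f_comp_cont)
  have i1: "integrable lborel (\<lambda>w. K w * f (x - h *\<^sub>R w))" and i2: "integrable lborel (\<lambda>w. K w * f (x + h *\<^sub>R w))"
    by (intro shift_integrable f_comp_cont continuous_intros)+
  have "(\<integral>w. K w * f (x - h *\<^sub>R w) \<partial>lborel) = (\<integral>w. K w * f (x + h *\<^sub>R w) \<partial>lborel)"
    using integral_lborel_affine[OF m, of "-1" 0] by (simp add: K_uminus)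
  then have "2 * bias h x = (\<integral>w. K w * f (x - h *\<^sub>R w) \<partial>lborel) + (\<integral>w. K w * f (x + h *\<^sub>R w) \<partial>lborel) - 2 * f x * (\<integral>w. K w \<partial>lborel)"
    by (simp add: bias_def int_K)
  also have "\<dots> = (\<integral>w. K w * f (x - h *\<^sub>R w) + K w * f (x + h *\<^sub>R w) - 2 * f x * K w \<partial>lborel)"
    using i1 i2 K_integrable by simp
  also have "\<dots> = (\<integral>w. 2 * (K w * (sec_diff (h *\<^sub>R w) x / 2)) \<partial>lborel)"
    by (rule Bochner_Integration.integral_cong) (simp_all add: sec_diff_def algebra_simps)
  finally show ?thesis by simp
qed

text \<open>\<open>K\<close> is a probability density that vanishes outside the ball of radius
  \<open>sqrt T\<close>.\<close>

lemma K_weighted_bound: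
  assumes "integrable lborel (\<lambda>w. K w * g w)" "\<And>w. norm w \<le> sqrt T \<Longrightarrow> \<bar>g w\<bar> \<le> c"
  shows "\<bar>\<integral>w. K w * g w \<partial>lborel\<bar> \<le> c"
proof -
  have "\<bar>\<integral>w. K w * g w \<partial>lborel\<bar> \<le> (\<integral>w. \<bar>K w * g w\<bar> \<partial>lborel)"
    using integral_norm_bound[of lborel "\<lambda>w. K w * g w"] by simp
  also have "\<dots> \<le> (\<integral>w. K w * c \<partial>lborel)"
  proof (rule Bochner_Integration.integral_mono)
    show "integrable lborel (\<lambda>w. \<bar>K w * g w\<bar>)" using assms(1) by simp
    show "integrable lborel (\<lambda>w. K w * c)" using K_integrable by simp
    show "\<bar>K w * g w\<bar> \<le> K w * c" for w
      using assms(2)[of w] K_0[of w] K_nonneg[of w] by (cases "norm w \<le> sqrt T") (auto simp: abs_mult intro: mult_left_mono)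
  qed
  finally show ?thesis by (simp add: int_K)
qed

lemma l1_scaled: "norm w \<le> sqrt T \<Longrightarrow> l1_norm (h *\<^sub>R w :: real ^ 'd) ^ 2 \<le> CARD('d) ^ 2 * T * h ^ 2"
proof -
  assume w: "norm w \<le> sqrt T"
  have "l1_norm (h *\<^sub>R w) \<le> CARD('d) * (\<bar>h\<bar> * sqrt T)"
    by (rule order_trans[OF l1_norm_le]) (use w in \<open>auto intro!: mult_left_mono\<close>)
  then have "l1_norm (h *\<^sub>R w) ^ 2 \<le> (CARD('d) * (\<bar>h\<bar> * sqrt T)) ^ 2"
    by (rule power_mono) simp
  then show ?thesis using T(1) by (simp add: power_mult_distrib mult_ac)
qed

lemma sec_diff_cont: "continuous_on A (\<lambda>w. sec_diff (h *\<^sub>R w) x)" "continuous_on A (sec_diff v)"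
  unfolding sec_diff_def[abs_def] by (intro continuous_intros f_comp_cont)+

lemma bias_bound: "\<bar>bias h x\<bar> \<le> CARD('d) ^ 2 * T * Cf * h ^ 2"
  unfolding bias_eq
proof (rule K_weighted_bound)
  show "integrable lborel (\<lambda>w. K w * (sec_diff (h *\<^sub>R w) x / 2))"
    by (intro shift_integrable continuous_intros sec_diff_cont) simp
  fix w :: "real ^ 'd" assume w: "norm w \<le> sqrt T"
  have "\<bar>sec_diff (h *\<^sub>R w) x\<bar> \<le> l1_norm (h *\<^sub>R w) ^ 2 * Cf"
    using second_difference_bound[OF f, of "[]" Cf x "h *\<^sub>R w"] f_bound by (simp add: sec_diff_def)
  also have "\<dots> \<le> (CARD('d) ^ 2 * T * h ^ 2) * Cf"
    by (intro mult_right_mono l1_scaled w Cf_nonneg)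
  finally show "\<bar>sec_diff (h *\<^sub>R w) x / 2\<bar> \<le> CARD('d) ^ 2 * T * Cf * h ^ 2"
    by (simp add: mult_ac)
qed

text \<open>The second-order Taylor remainder in \<open>w\<close> of a second difference in
  \<open>v\<close> is itself a second difference of second derivatives, hence controlled by
  derivatives of order four. This yields the product of both squares.\<close>

lemma sec_diff_remainder:
  "\<bar>sec_diff v (t + w) - sec_diff v t - (dir_deriv [w] f (t + v) + dir_deriv [w] f (t - v) - 2 * dir_deriv [w] f t)\<bar>
    \<le> l1_norm v ^ 2 * (l1_norm w ^ 2 * Cf)"
proof -
  \<comment> \<open>Second differences in \<open>v\<close> of the derivatives along
    \<open>w\<close>, at the point moved by \<open>s w\<close>; each \<open>\<gamma> m\<close>
    differentiates to the next.\<close>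
  define \<gamma> where "\<gamma> m s = dir_deriv (replicate m w) f (t + v + s *\<^sub>R w) + dir_deriv (replicate m w) f (t - v + s *\<^sub>R w)
    - 2 * dir_deriv (replicate m w) f (t + s *\<^sub>R w)" for m s
  have "\<exists>\<xi>>0. \<xi> < 1 \<and> \<gamma> 0 1 = (\<Sum>m<2. \<gamma> m 0 / fact m * 1 ^ m) + \<gamma> 2 \<xi> / fact 2 * 1 ^ 2"
  proof (rule Maclaurin)
    show "\<forall>m s. m < 2 \<and> 0 \<le> s \<and> s \<le> 1 \<longrightarrow> (\<gamma> m has_real_derivative \<gamma> (Suc m) s) (at s)"
      unfolding \<gamma>_def replicate_Suc
      by (intro allI impI DERIV_diff DERIV_add DERIV_cmult dir_deriv_DERIV[OF open_UNIV UNIV_I f]) simp_all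
  qed auto
  then obtain \<xi> where \<xi>: "\<gamma> 0 1 = \<gamma> 0 0 + \<gamma> 1 0 + \<gamma> 2 \<xi> / 2"
    by (auto simp: numeral_2_eq_2)
  have "\<bar>\<gamma> 2 \<xi>\<bar> \<le> l1_norm v ^ 2 * (l1_norm w ^ 2 * Cf)"
    using second_difference_bound[OF f, of "replicate 2 w" Cf "t + \<xi> *\<^sub>R w" v] f_bound
    by (simp add: \<gamma>_def numeral_2_eq_2 algebra_simps)
  moreover have "sec_diff v (t + w) - sec_diff v t - (dir_deriv [w] f (t + v) + dir_deriv [w] f (t - v) - 2 * dir_deriv [w] f t)
    = \<gamma> 2 \<xi> / 2"
    using \<xi> by (simp add: \<gamma>_def sec_diff_def algebra_simps)
  ultimately show ?thesis by simp
qed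

text \<open>The value, the slope and the remainder of \<open>sec_diff v\<close> at \<open>t\<close>
  carry the powers 0, 1 and 2 of the dimension, from \<open>l1_norm_le\<close>. The square dominates
  them, so a single \<open>G\<close> proportional to \<open>l1_norm v ^ 2\<close> serves.\<close>

lemma sec_diff_linear_term:
  "\<exists>C2\<ge>0. \<exists>h0>0. \<forall>h v. 0 < h \<longrightarrow> h < h0 \<longrightarrow>
    \<bar>smooth_int Klin h (sec_diff v)\<bar> \<le> C2 * l1_norm v ^ 2 * h ^ 2"
proof -
  obtain C1 h0 where C1: "C1 \<ge> 0" "h0 > 0" and lin: "\<forall>h g g1 G. 0 < h \<longrightarrow> h < h0 \<longrightarrow> continuous_on UNIV g \<longrightarrow> continuous_on UNIV g1 \<longrightarrow>
    (\<forall>s w. g1 (s *\<^sub>R w) = s * g1 w) \<longrightarrow> \<bar>g t\<bar> \<le> G \<longrightarrow> (\<forall>w. \<bar>g1 w\<bar> \<le> G * norm w) \<longrightarrow>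
    (\<forall>w. \<bar>g (t + w) - g t - g1 w\<bar> \<le> G * norm w ^ 2) \<longrightarrow>
    \<bar>smooth_int Klin h g\<bar> \<le> C1 * G * h ^ 2"
    using linear_term_bound by (elim exE conjE) (rule that)
  have card1: "1 \<le> real CARD('d)" using zero_less_card_finite[where 'a = 'd] by linarith
  then have card2: "1 \<le> real CARD('d) ^ 2" "real CARD('d) \<le> real CARD('d) ^ 2"
    by (rule one_le_power, simp add: power2_eq_square)
  show ?thesis
  proof (rule exI[of _ "C1 * (CARD('d) ^ 2 * Cf)"], rule conjI, use C1 Cf_nonneg in simp, rule exI[of _ h0], intro conjI allI impI C1(2))
    fix h :: real and v :: "real ^ 'd" assume h: "0 < h" "h < h0"
    define G where "G = l1_norm v ^ 2 * (CARD('d) ^ 2 * Cf)"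
    define g1 where "g1 w = dir_deriv [w] f (t + v) + dir_deriv [w] f (t - v) - 2 * dir_deriv [w] f t" for w
    have "\<bar>smooth_int Klin h (sec_diff v)\<bar> \<le> C1 * G * h ^ 2"
    proof (rule lin[rule_format, OF h sec_diff_cont(2), of g1])
      show "continuous_on UNIV g1" unfolding g1_def by (auto intro!: continuous_intros)
      show "g1 (s *\<^sub>R w) = s * g1 w" for s w
        unfolding g1_def by (simp add: sum_distrib_left algebra_simps)
      have "\<bar>sec_diff v t\<bar> \<le> l1_norm v ^ 2 * (1 * Cf)"
        using second_difference_bound[OF f, of "[]" Cf t v] f_bound by (simp add: sec_diff_def)
      also have "\<dots> \<le> G" unfolding G_def by (intro mult_left_mono mult_right_mono card2 Cf_nonneg) simp_all
      finally show "\<bar>sec_diff v t\<bar> \<le> G" .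
      show "\<bar>g1 w\<bar> \<le> G * norm w" for w
      proof -
        have "\<bar>g1 w\<bar> \<le> l1_norm v ^ 2 * (l1_norm w * Cf)"
          unfolding g1_def using second_difference_bound[OF f, of "[w]" Cf t v] f_bound by simp
        also have "\<dots> \<le> l1_norm v ^ 2 * ((CARD('d) ^ 2 * norm w) * Cf)"
          by (intro mult_left_mono mult_right_mono order_trans[OF l1_norm_le] card2 Cf_nonneg) (simp_all add: self_le_power Suc_leI)
        finally show "\<bar>g1 w\<bar> \<le> G * norm w" by (simp add: G_def mult_ac)
      qed
      show "\<bar>sec_diff v (t + w) - sec_diff v t - g1 w\<bar> \<le> G * (norm w)\<^sup>2" for w
      proof -
        have "\<bar>sec_diff v (t + w) - sec_diff v t - g1 w\<bar> \<le> l1_norm v ^ 2 * (l1_norm w ^ 2 * Cf)"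
          unfolding g1_def by (rule sec_diff_remainder)
        also have "\<dots> \<le> l1_norm v ^ 2 * ((CARD('d) * norm w) ^ 2 * Cf)"
          by (intro mult_left_mono mult_right_mono power_mono l1_norm_le Cf_nonneg) simp_all
        finally show "\<bar>sec_diff v (t + w) - sec_diff v t - g1 w\<bar> \<le> G * (norm w)\<^sup>2"
          by (simp add: G_def power_mult_distrib mult_ac)
      qed
    qed
    then show "\<bar>smooth_int Klin h (sec_diff v)\<bar> \<le> C1 * (CARD('d) ^ 2 * Cf) * l1_norm v ^ 2 * h ^ 2"
      by (simp add: G_def mult_ac)
  qed
qed

text \<open>The bias is a mean of second differences and \<open>smooth_int\<close> is linear, so
  Fubini exchanges the two integrals and the estimate for each second difference is averaged; no
  Taylor expansion of \<open>bias\<close> itself occurs.\<close>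

lemma bias_linear_term:
  "\<exists>C2\<ge>0. \<exists>h0>0. \<forall>h h1. 0 < h \<longrightarrow> h < h0 \<longrightarrow>
    \<bar>smooth_int Klin h (bias h1)\<bar> \<le> C2 * h1 ^ 2 * h ^ 2"
proof -
  obtain C2 h0 where C2: "C2 \<ge> 0" "h0 > 0" and lin: "\<forall>h v. 0 < h \<longrightarrow> h < h0 \<longrightarrow>
    \<bar>smooth_int Klin h (sec_diff v)\<bar> \<le> C2 * l1_norm v ^ 2 * h ^ 2"
    using sec_diff_linear_term by (elim exE conjE) (rule that)
  show ?thesis
  proof (rule exI[of _ "C2 * (CARD('d) ^ 2 * T)"], rule conjI, use C2 T(1) in simp, rule exI[of _ h0], intro conjI allI impI C2(2))
    fix h h1 :: real assume h: "0 < h" "h < h0"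
    define P where "P u = Klin (a h u *\<^sub>R u) * a h u ^ CARD('d)" for u
    \<comment> \<open>The indicators confine both variables to compact balls, which gives joint
      integrability. The one in \<open>w\<close> changes nothing, because \<open>K\<close> vanishes
      outside its ball.\<close>
    define F where "F u w = indicator (cball 0 r) u * (indicator (cball 0 (sqrt T)) w *
        (P u * (K w * (sec_diff (h1 *\<^sub>R w) (t + h *\<^sub>R u) / 2))))" for u w
    have P_cont: "continuous_on A P" for A
      unfolding P_def by (intro continuous_intros continuous_on_compose2[OF cont_Klin[of UNIV]] a_cont) auto
    have "continuous_on S (\<lambda>z. P (fst z) * (K (snd z) * (sec_diff (h1 *\<^sub>R snd z) (t + h *\<^sub>R fst z) / 2)))" for S
      unfolding sec_diff_def
      by (intro continuous_intros f_comp_cont continuous_on_compose2[OF P_cont[of UNIV]] continuous_on_compose2[OF cont_K[of UNIV]]) auto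
    then have "integrable lborel (\<lambda>z. indicator (cball 0 r \<times> cball 0 (sqrt T)) z *\<^sub>R
        (P (fst z) * (K (snd z) * (sec_diff (h1 *\<^sub>R snd z) (t + h *\<^sub>R fst z) / 2))))"
      by (intro borel_integrable_compact compact_Times compact_cball)
    also have "(\<lambda>z. indicator (cball 0 r \<times> cball 0 (sqrt T)) z *\<^sub>R
        (P (fst z) * (K (snd z) * (sec_diff (h1 *\<^sub>R snd z) (t + h *\<^sub>R fst z) / 2)))) = case_prod F"
      by (auto simp: F_def indicator_def)
    finally have int: "integrable (lborel \<Otimes>\<^sub>M lborel) (case_prod F)" by (simp add: lborel_prod)
    have K_ind: "indicator (cball 0 (sqrt T)) w * (x * (K w * y)) = x * (K w * y)" for w x y
      using K_0[of w] by (cases "norm w \<le> sqrt T") auto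
    define g where "g w = smooth_int Klin h (sec_diff (h1 *\<^sub>R w)) / 2" for w
    have inner: "(\<integral>u. F u w \<partial>lborel) = K w * g w" for w
    proof -
      have "(\<integral>u. F u w \<partial>lborel) = (\<integral>u. K w / 2 * (indicator (cball 0 r) u * (Klin (a h u *\<^sub>R u) * (a h u ^ CARD('d) * sec_diff (h1 *\<^sub>R w) (t + h *\<^sub>R u)))) \<partial>lborel)"
        unfolding F_def K_ind P_def by (rule Bochner_Integration.integral_cong) (simp_all add: mult_ac)
      then show ?thesis by (simp add: g_def smooth_int_def)
    qed
    have "smooth_int Klin h (bias h1) = (\<integral>u. (\<integral>w. F u w \<partial>lborel) \<partial>lborel)"
      unfolding smooth_int_def F_def K_ind bias_eq P_def by (simp only: integral_mult_right_zero mult.assoc)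
    also have "\<dots> = (\<integral>w. K w * g w \<partial>lborel)"
      unfolding inner[symmetric] by (rule lborel_pair.Fubini_integral[OF int, symmetric])
    also have "\<bar>\<dots>\<bar> \<le> C2 * (CARD('d) ^ 2 * T) * h1 ^ 2 * h ^ 2"
    proof (rule K_weighted_bound)
      show "integrable lborel (\<lambda>w. K w * g w)"
        unfolding inner[symmetric] by (rule lborel_pair.integrable_snd[OF int])
      fix w :: "real ^ 'd" assume w: "norm w \<le> sqrt T"
      have "\<bar>g w\<bar> \<le> C2 * l1_norm (h1 *\<^sub>R w) ^ 2 * h ^ 2"
        using lin[rule_format, OF h, of "h1 *\<^sub>R w"] unfolding g_def by simp
      also have "\<dots> \<le> C2 * (CARD('d) ^ 2 * T * h1 ^ 2) * h ^ 2"
        by (intro mult_left_mono mult_right_mono l1_scaled w C2) simp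
      finally show "\<bar>g w\<bar> \<le> C2 * (CARD('d) ^ 2 * T) * h1 ^ 2 * h ^ 2" by (simp add: mult_ac)
    qed
    finally show "\<bar>smooth_int Klin h (bias h1)\<bar> \<le> C2 * (CARD('d) ^ 2 * T) * h1 ^ 2 * h ^ 2" .
  qed
qed

end

section \<open>Sums of independent variables and the clipped kernel\<close>

text \<open>Cross terms vanish by independence, and a diagonal term is at most
  \<open>E(Y^2) \<le> B m\<close>. Keeping the mean instead of a second factor \<open>B\<close>
  matters: for kernel summands \<open>m\<close> is of order \<open>h ^ d\<close>.\<close>

lemma (in prob_space) sum_variance_bound:
  fixes Y :: "'i \<Rightarrow> 'a \<Rightarrow> real" and B m :: real
  assumes J: "finite J" and ind: "indep_vars (\<lambda>_. borel) Y J"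
    and bound: "\<And>j \<omega>. j \<in> J \<Longrightarrow> 0 \<le> Y j \<omega> \<and> Y j \<omega> \<le> B"
    and mean: "\<And>j. j \<in> J \<Longrightarrow> expectation (Y j) = m"
  shows "expectation (\<lambda>\<omega>. ((\<Sum>j\<in>J. Y j \<omega>) - card J * m)\<^sup>2) \<le> card J * (B * m)"
proof -
  have rv: "random_variable borel (Y j)" if "j \<in> J" for j
    using ind that unfolding indep_vars_def by auto
  note [measurable] = rv
  have int: "integrable M (Y j)" if "j \<in> J" for j
    by (rule integrable_const_bound[of _ B]) (use bound[OF that] rv[OF that] in auto)
  have int2: "integrable M (\<lambda>\<omega>. Y j \<omega> * Y k \<omega>)" if "j \<in> J" "k \<in> J" for j k
  proof (rule integrable_const_bound[of _ "B * B"])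
    show "AE x in M. norm (Y j x * Y k x) \<le> B * B"
      using bound[OF that(1)] bound[OF that(2)]
      by (intro AE_I2) (simp add: abs_mult, meson mult_mono order_trans)
  qed (use rv that in auto)
  define Z where "Z j \<omega> = Y j \<omega> - m" for j \<omega>
  have Zint: "integrable M (\<lambda>\<omega>. Z j \<omega> * Z k \<omega>)" if "j \<in> J" "k \<in> J" for j k
    unfolding Z_def left_diff_distrib right_diff_distrib using int int2 that
    by (intro Bochner_Integration.integrable_diff) auto
  have Z: "expectation (\<lambda>\<omega>. Z j \<omega> * Z k \<omega>) \<le> (if j = k then B * m else 0)" if jk: "j \<in> J" "k \<in> J" for j k
  proof -
    have exp: "expectation (\<lambda>\<omega>. Z j \<omega> * Z k \<omega>) = expectation (\<lambda>\<omega>. Y j \<omega> * Y k \<omega>) - m * m"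
    proof -
      have "expectation (\<lambda>\<omega>. Z j \<omega> * Z k \<omega>) = expectation (\<lambda>\<omega>. Y j \<omega> * Y k \<omega> - m * Y k \<omega> - (m * Y j \<omega> - m * m))"
        unfolding Z_def by (rule Bochner_Integration.integral_cong) (simp_all add: algebra_simps)
      also have "\<dots> = expectation (\<lambda>\<omega>. Y j \<omega> * Y k \<omega>) - m * m - (m * m - m * m)"
        using int int2 jk mean prob_space by simp
      finally show ?thesis by simp
    qed
    show ?thesis
    proof (cases "j = k")
      case True
      have "expectation (\<lambda>\<omega>. Y j \<omega> * Y k \<omega>) \<le> expectation (\<lambda>\<omega>. B * Y j \<omega>)"
        by (rule Bochner_Integration.integral_mono) (use int int2 jk bound True in \<open>auto intro: mult_right_mono\<close>)
      moreover have "expectation (\<lambda>\<omega>. B * Y j \<omega>) = B * m" using int jk mean by simp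
      ultimately have "expectation (\<lambda>\<omega>. Z j \<omega> * Z k \<omega>) \<le> B * m"
        using exp zero_le_square[of m] by linarith
      then show ?thesis using True by simp
    next
      case False
      have "indep_vars (\<lambda>_. borel) Y {j, k}"
        by (rule indep_vars_subset[OF ind]) (use jk in auto)
      from indep_vars_lebesgue_integral[OF _ this] have "expectation (\<lambda>\<omega>. Y j \<omega> * Y k \<omega>) = m * m"
        using int jk mean False by auto
      then show ?thesis using exp False by simp
    qed
  qed
  have "expectation (\<lambda>\<omega>. ((\<Sum>j\<in>J. Y j \<omega>) - card J * m)\<^sup>2) = expectation (\<lambda>\<omega>. \<Sum>j\<in>J. \<Sum>k\<in>J. Z j \<omega> * Z k \<omega>)"
  proof (rule Bochner_Integration.integral_cong[OF refl])
    fix \<omega>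
    have "(\<Sum>j\<in>J. Y j \<omega>) - card J * m = (\<Sum>j\<in>J. Z j \<omega>)" by (simp add: Z_def sum_subtractf)
    then show "((\<Sum>j\<in>J. Y j \<omega>) - card J * m)\<^sup>2 = (\<Sum>j\<in>J. \<Sum>k\<in>J. Z j \<omega> * Z k \<omega>)"
      by (simp add: power2_eq_square sum_product)
  qed
  also have "\<dots> = (\<Sum>j\<in>J. \<Sum>k\<in>J. expectation (\<lambda>\<omega>. Z j \<omega> * Z k \<omega>))"
    using Zint by (simp add: Bochner_Integration.integral_sum)
  also have "\<dots> \<le> (\<Sum>j\<in>J. \<Sum>k\<in>J. if j = k then B * m else 0)"
    by (intro sum_mono Z)
  also have "\<dots> = card J * (B * m)" using J by simp
  finally show ?thesis .
qed

lemma exp_le_chord: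
  assumes "0 \<le> y" "y \<le> B"
  shows "exp y \<le> 1 + exp B * (y :: real)"
proof -
  have "exp y - exp 0 \<le> y * exp B"
  proof (cases "y = 0")
    case False
    then have "\<exists>z>0. z < y \<and> exp y - exp 0 = (y - 0) * exp z"
      using assms by (intro MVT2) (auto intro!: derivative_eq_intros)
    then show ?thesis using assms by (auto intro!: mult_left_mono)
  qed simp
  then show ?thesis by (simp add: mult.commute)
qed

text \<open>The pilot estimator is not bounded uniformly in \<open>n\<close>, and \<open>\<alpha>\<^sup>d\<close> grows like its power \<open>d/2\<close>; this exponential moment
  controls the event that it is large.\<close>

lemma (in prob_space) exp_sum_bound:
  fixes Y :: "'i \<Rightarrow> 'a \<Rightarrow> real" and B m :: real
  assumes J: "finite J" and ind: "indep_vars (\<lambda>_. borel) Y J"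
    and bound: "\<And>j \<omega>. j \<in> J \<Longrightarrow> 0 \<le> Y j \<omega> \<and> Y j \<omega> \<le> B"
    and mean: "\<And>j. j \<in> J \<Longrightarrow> expectation (Y j) = m"
  shows "expectation (\<lambda>\<omega>. exp (\<Sum>j\<in>J. Y j \<omega>)) \<le> exp (card J * (exp B * m))"
proof -
  have rv: "random_variable borel (Y j)" if "j \<in> J" for j
    using ind that unfolding indep_vars_def by auto
  have int: "integrable M (Y j)" if "j \<in> J" for j
    by (rule integrable_const_bound[of _ B]) (use bound[OF that] rv[OF that] in auto)
  have inte: "integrable M (\<lambda>\<omega>. exp (Y j \<omega>))" if "j \<in> J" for j
    by (rule integrable_const_bound[of _ "exp B"]) (use bound[OF that] rv[OF that] in auto)
  have ind': "indep_vars (\<lambda>_. borel) (\<lambda>j \<omega>. exp (Y j \<omega>)) J"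
    using indep_vars_compose2[OF ind, of "\<lambda>_. exp" "\<lambda>_. borel"] by simp
  have le: "expectation (\<lambda>\<omega>. exp (Y j \<omega>)) \<le> exp (exp B * m)" if j: "j \<in> J" for j
  proof -
    have "expectation (\<lambda>\<omega>. exp (Y j \<omega>)) \<le> expectation (\<lambda>\<omega>. 1 + exp B * Y j \<omega>)"
      by (rule Bochner_Integration.integral_mono) (use int[OF j] inte[OF j] bound[OF j] exp_le_chord in auto)
    also have "\<dots> = 1 + exp B * m" using int[OF j] mean[OF j] prob_space by simp
    also have "\<dots> \<le> exp (exp B * m)" by (rule exp_ge_add_one_self)
    finally show ?thesis .
  qed
  have "expectation (\<lambda>\<omega>. exp (\<Sum>j\<in>J. Y j \<omega>)) = expectation (\<lambda>\<omega>. \<Prod>j\<in>J. exp (Y j \<omega>))"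
    by (simp add: exp_sum J)
  also have "\<dots> = (\<Prod>j\<in>J. expectation (\<lambda>\<omega>. exp (Y j \<omega>)))"
    by (rule indep_vars_lebesgue_integral[OF J ind' inte])
  also have "\<dots> \<le> (\<Prod>j\<in>J. exp (exp B * m))"
    by (intro prod_mono conjI le integral_nonneg) auto
  finally show ?thesis by (simp add: exp_of_nat_mult)
qed

lemma power_div_fact_le_exp:
  assumes "0 \<le> (x :: real)"
  shows "x ^ n / fact n \<le> exp x"
proof -
  have "(\<Sum>k\<in>{n}. x ^ k /\<^sub>R fact k) \<le> (\<Sum>k. x ^ k /\<^sub>R fact k)"
    using assms by (intro sum_le_suminf summable_exp_generic) auto
  then show ?thesis by (simp add: exp_def divide_inverse mult.commute)
qed

text \<open>With one power of \<open>N * s\<close> more than \<open>s ^ m\<close> asks for, the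
  exponential series leaves a factor \<open>1 / N\<close> to spare; \<open>2 * A \<le> s\<close>
  ensures that \<open>s / 2\<close> is at most \<open>s - A\<close>.\<close>

lemma power_le_exp_excess:
  fixes s N A :: real
  assumes "1 \<le> N" "0 < A" "2 * A \<le> s" 
  shows "s ^ m \<le> (2 ^ Suc m * fact (Suc m) / (2 * A)) * (exp (N * (s - A)) / N)"
proof -
  have "(N * s / 2) ^ Suc m \<le> fact (Suc m) * exp (N * s / 2)"
  proof -
    have "(N * s / 2) ^ Suc m / fact (Suc m) \<le> exp (N * s / 2)"
      using assms by (intro power_div_fact_le_exp) auto
    then show ?thesis by (simp add: field_simps del: fact_Suc power_Suc)
  qed
  also have "\<dots> \<le> fact (Suc m) * exp (N * (s - A))"
  proof -
    have "N * (2 * A) \<le> N * s" using assms by (intro mult_left_mono) auto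
    then have "N * s / 2 \<le> N * (s - A)" by (simp add: algebra_simps)
    then show ?thesis by (intro mult_left_mono) auto
  qed
  finally have 1: "(N * s / 2) ^ Suc m \<le> fact (Suc m) * exp (N * (s - A))" .
  \<comment> \<open>Gives away the surplus factors through \<open>1 \<le> N ^ m\<close> and
    \<open>2 * A \<le> s\<close>.\<close>
  have "N * 1 * (2 * A * s ^ m) \<le> N * N ^ m * (s * s ^ m)"
    using assms by (intro mult_mono one_le_power) auto
  also have "\<dots> = 2 ^ Suc m * (N * s / 2) ^ Suc m" by (simp add: power_divide power_mult_distrib)
  also have "\<dots> \<le> 2 ^ Suc m * (fact (Suc m) * exp (N * (s - A)))"
    using 1 by (intro mult_left_mono) auto
  finally show ?thesis using assms by (simp add: field_simps del: fact_Suc power_Suc)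
qed

section \<open>Conditioning on one sample point\<close>

lemma (in prob_space) indep_var_expectation:
  fixes G :: "'b \<times> 'b \<Rightarrow> real"
  assumes ind: "indep_var S X T Y" and G [measurable]: "G \<in> borel_measurable (S \<Otimes>\<^sub>M T)" and bound: "\<And>z. \<bar>G z\<bar> \<le> B"
  shows "expectation (\<lambda>\<omega>. G (X \<omega>, Y \<omega>)) = (\<integral>x. expectation (\<lambda>\<omega>. G (x, Y \<omega>)) \<partial>distr M S X)"
proof -
  have [measurable]: "random_variable S X" "random_variable T Y"
    and eq: "distr M S X \<Otimes>\<^sub>M distr M T Y = distr M (S \<Otimes>\<^sub>M T) (\<lambda>x. (X x, Y x))"
    using ind unfolding indep_var_distribution_eq by auto
  interpret PX: prob_space "distr M S X" by (rule prob_space_distr) simp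
  interpret PY: prob_space "distr M T Y" by (rule prob_space_distr) simp
  interpret P: pair_sigma_finite "distr M S X" "distr M T Y" ..
  interpret PP: prob_space "distr M (S \<Otimes>\<^sub>M T) (\<lambda>x. (X x, Y x))" by (rule prob_space_distr) simp
  have inner: "expectation (\<lambda>\<omega>. G (x, Y \<omega>)) = (\<integral>y. G (x, y) \<partial>distr M T Y)" if "x \<in> space S" for x
    using that by (subst integral_distr) auto
  have int: "integrable (distr M S X \<Otimes>\<^sub>M distr M T Y) G"
    unfolding eq by (rule PP.integrable_const_bound[of _ B]) (use bound in auto)
  have "expectation (\<lambda>\<omega>. G (X \<omega>, Y \<omega>)) = (\<integral>z. G z \<partial>(distr M S X \<Otimes>\<^sub>M distr M T Y))"
    unfolding eq by (subst integral_distr) auto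
  also have "\<dots> = (\<integral>x. (\<integral>y. G (x, y) \<partial>distr M T Y) \<partial>distr M S X)"
    by (rule P.integral_fst'[OF int, symmetric])
  also have "\<dots> = (\<integral>x. expectation (\<lambda>\<omega>. G (x, Y \<omega>)) \<partial>distr M S X)"
    by (rule Bochner_Integration.integral_cong) (simp_all add: inner)
  finally show ?thesis .
qed

text \<open>Independence makes the joint law of \<open>X i\<close> and the other points a product,
  so the expectation is taken over the others with \<open>X i\<close> frozen at \<open>y\<close>,
  and then over \<open>y\<close> with density \<open>f\<close>.\<close>

lemma (in prob_space) sample_expectation:
  fixes X :: "nat \<Rightarrow> 'a \<Rightarrow> real ^ 'd::finite" and G :: "(real ^ 'd) \<times> (nat \<Rightarrow> real ^ 'd) \<Rightarrow> real"
  assumes ind: "indep_vars (\<lambda>_. borel) X I" and sub: "i \<in> I" "J \<subseteq> I" "i \<notin> J"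
    and dist: "distributed M lborel (X i) (\<lambda>x. ennreal (f x))" and f: "\<And>x. 0 \<le> f x" "f \<in> borel_measurable borel"
    and G: "G \<in> borel_measurable (borel \<Otimes>\<^sub>M Pi\<^sub>M J (\<lambda>_. borel))" "\<And>z. \<bar>G z\<bar> \<le> B"
  shows "expectation (\<lambda>\<omega>. G (X i \<omega>, \<lambda>j\<in>J. X j \<omega>))
    = (\<integral>y. f y * expectation (\<lambda>\<omega>. G (y, \<lambda>j\<in>J. X j \<omega>)) \<partial>lborel)"
    and "(\<lambda>y. expectation (\<lambda>\<omega>. G (y, \<lambda>j\<in>J. X j \<omega>))) \<in> borel_measurable borel"
proof -
  have "indep_var (Pi\<^sub>M {i} (\<lambda>_. borel)) (\<lambda>\<omega>. \<lambda>j\<in>{i}. X j \<omega>) (Pi\<^sub>M J (\<lambda>_. borel)) (\<lambda>\<omega>. \<lambda>j\<in>J. X j \<omega>)"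
    by (rule indep_var_restrict[OF ind]) (use sub in auto)
  note iv = this
  have [measurable]: "random_variable (Pi\<^sub>M J (\<lambda>_. borel)) (\<lambda>\<omega>. \<lambda>j\<in>J. X j \<omega>)"
    "random_variable (Pi\<^sub>M {i} (\<lambda>_. borel)) (\<lambda>\<omega>. \<lambda>j\<in>{i}. X j \<omega>)"
    using iv by (auto dest: indep_var_rv1 indep_var_rv2)
  have [measurable]: "random_variable borel (X i)" using ind sub(1) unfolding indep_vars_def by auto
  note [measurable] = G(1)
  interpret PY: prob_space "distr M (Pi\<^sub>M J (\<lambda>_. borel)) (\<lambda>\<omega>. \<lambda>j\<in>J. X j \<omega>)" by (rule prob_space_distr) simp
  have inner: "expectation (\<lambda>\<omega>. G (y, \<lambda>j\<in>J. X j \<omega>)) = (\<integral>x. G (y, x) \<partial>distr M (Pi\<^sub>M J (\<lambda>_. borel)) (\<lambda>\<omega>. \<lambda>j\<in>J. X j \<omega>))" for y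
    by (subst integral_distr) auto
  show m: "(\<lambda>y. expectation (\<lambda>\<omega>. G (y, \<lambda>j\<in>J. X j \<omega>))) \<in> borel_measurable borel"
    unfolding inner by (rule PY.borel_measurable_lebesgue_integral) simp
  \<comment> \<open>\<open>indep_var_restrict\<close> provides the single point as a function on
    \<open>{i}\<close>, which is evaluated at \<open>i\<close>.\<close>
  have G': "(\<lambda>z. G (fst z i, snd z)) \<in> borel_measurable (Pi\<^sub>M {i} (\<lambda>_. borel) \<Otimes>\<^sub>M Pi\<^sub>M J (\<lambda>_. borel))"
  proof -
    have "(\<lambda>z. (fst z i, snd z)) \<in> measurable (Pi\<^sub>M {i} (\<lambda>_. borel :: (real ^ 'd) measure) \<Otimes>\<^sub>M Pi\<^sub>M J (\<lambda>_. borel :: (real ^ 'd) measure)) (borel \<Otimes>\<^sub>M Pi\<^sub>M J (\<lambda>_. borel))"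
      by (intro measurable_Pair measurable_compose[OF measurable_fst measurable_component_singleton] measurable_snd) simp
    from measurable_compose[OF this G(1)] show ?thesis .
  qed
  have "expectation (\<lambda>\<omega>. G (X i \<omega>, \<lambda>j\<in>J. X j \<omega>))
    = (\<integral>x. expectation (\<lambda>\<omega>. G (x i, \<lambda>j\<in>J. X j \<omega>)) \<partial>distr M (Pi\<^sub>M {i} (\<lambda>_. borel)) (\<lambda>\<omega>. \<lambda>j\<in>{i}. X j \<omega>))"
    using indep_var_expectation[OF iv G' G(2)] by simp
  also have "\<dots> = expectation (\<lambda>\<omega>'. expectation (\<lambda>\<omega>. G (X i \<omega>', \<lambda>j\<in>J. X j \<omega>)))"
    by (subst integral_distr) (use measurable_compose[OF measurable_component_singleton[of i "{i}" "\<lambda>_. borel"] m] in auto)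
  also have "\<dots> = (\<integral>y. expectation (\<lambda>\<omega>. G (y, \<lambda>j\<in>J. X j \<omega>)) \<partial>distr M lborel (X i))"
    by (subst integral_distr) (use m in auto)
  also have "\<dots> = (\<integral>y. f y * expectation (\<lambda>\<omega>. G (y, \<lambda>j\<in>J. X j \<omega>)) \<partial>lborel)"
    unfolding distributed_distr_eq_density[OF dist]
    by (subst integral_density) (use f m in auto)
  finally show "expectation (\<lambda>\<omega>. G (X i \<omega>, \<lambda>j\<in>J. X j \<omega>))
    = (\<integral>y. f y * expectation (\<lambda>\<omega>. G (y, \<lambda>j\<in>J. X j \<omega>)) \<partial>lborel)" .
qed

text \<open>From \<open>\<sigma>0\<close> on, \<alpha> is the square root, while \<open>f\<close> is
  at least \<open>\<sigma>0 + \<eta>\<close> near \<open>t\<close>: pilot values within \<eta> of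
  \<open>f y\<close> are not clipped. The bound \<open>T \<le> c^2 r^2\<close> lets the same radius
  \<open>r\<close> serve for every pilot value.\<close>

locale variable_bandwidth = pilot_density \<Phi> \<Phi>' \<Phi>'' B2 T K f t Cf "\<sigma>0 + \<eta>" \<rho> r
  for \<Phi> \<Phi>' \<Phi>'' :: "real \<Rightarrow> real" and B2 T :: real and K :: "real ^ 'd::finite \<Rightarrow> real"
    and f :: "real ^ 'd \<Rightarrow> real" and t :: "real ^ 'd" and Cf \<sigma>0 \<eta> \<rho> r :: real +
  fixes \<alpha> :: "real \<Rightarrow> real" and c :: real
  assumes \<alpha>_cont: "continuous_on UNIV \<alpha>" and \<alpha>_ge: "\<And>s. c \<le> \<alpha> s" and c: "0 < c"
    and \<alpha>_sqrt: "\<And>s. \<sigma>0 \<le> s \<Longrightarrow> \<alpha> s = sqrt s" and \<sigma>0: "0 < \<sigma>0" and \<eta>: "0 < \<eta>" and T_le: "T \<le> c\<^sup>2 * r\<^sup>2"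
begin

text \<open>The summand of the estimator as a function of the pilot value \<open>s\<close> and the squared distance \<open>\<tau>\<close>
  in units of the bandwidth, and its \<open>s\<close>-derivative where the clipping is inactive.\<close>

definition Z :: "real \<Rightarrow> real \<Rightarrow> real"
  where "Z s \<tau> = \<alpha> s ^ CARD('d) * \<Phi> ((\<alpha> s)\<^sup>2 * \<tau>)"

definition Z1 :: "real \<Rightarrow> real \<Rightarrow> real"
  where "Z1 s \<tau> = sqrt s ^ CARD('d) / s * lin (s * \<tau>)"

text \<open>For \<open>\<tau> = 0\<close> the argument of \<Phi> stays at the end point 0, where the
  derivatives are one-sided; hence the chain rule relative to the image of the interval.\<close>

lemma Z_DERIV:
  assumes s: "\<sigma>0 \<le> s" "s \<le> S" and \<tau>: "0 \<le> \<tau>"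
  shows "((\<lambda>s. sqrt s ^ CARD('d) * \<Phi> (s * \<tau>)) has_real_derivative Z1 s \<tau>) (at s within {\<sigma>0..S})"
    and "((\<lambda>s. Z1 s \<tau>) has_real_derivative
      (CARD('d) / 2 - 1) * (sqrt s ^ CARD('d) / s\<^sup>2) * lin (s * \<tau>)
      + sqrt s ^ CARD('d) / s * ((CARD('d) / 2 * \<Phi>' (s * \<tau>) + (\<Phi>' (s * \<tau>) + s * \<tau> * \<Phi>'' (s * \<tau>))) * \<tau>)) (at s within {\<sigma>0..S})"
proof -
  have s0: "0 < s" using s \<sigma>0 by linarith
  have q: "((\<lambda>s. sqrt s ^ CARD('d)) has_real_derivative CARD('d) / 2 * (sqrt s ^ CARD('d) / s)) (at s within {\<sigma>0..S})"
  proof -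
    have d: "((\<lambda>s. sqrt s ^ CARD('d)) has_real_derivative CARD('d) / 2 * (inverse (sqrt s) * sqrt s ^ (CARD('d) - 1))) (at s within {\<sigma>0..S})"
      using DERIV_power[OF DERIV_subset[OF DERIV_real_sqrt[OF s0]], of "{\<sigma>0..S}" "CARD('d)"] by (simp add: mult_ac)
    have "sqrt s ^ CARD('d) = sqrt s ^ (CARD('d) - 1) * sqrt s" by (cases "CARD('d)") auto
    then have e: "inverse (sqrt s) * sqrt s ^ (CARD('d) - 1) = sqrt s ^ CARD('d) / s"
      using s0 by (simp add: field_simps)
    show ?thesis using d unfolding e .
  qed
  have sub: "(\<lambda>s. s * \<tau>) ` {\<sigma>0..S} \<subseteq> {0..}" using \<sigma>0 \<tau> by auto
  have s\<tau>: "0 \<le> s * \<tau>" using s0 \<tau> by simp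
  have lin\<tau>: "((\<lambda>s. s * \<tau>) has_real_derivative \<tau>) (at s within {\<sigma>0..S})"
    by (auto intro!: derivative_eq_intros)
  have d1: "((\<lambda>s. \<Phi> (s * \<tau>)) has_real_derivative \<Phi>' (s * \<tau>) * \<tau>) (at s within {\<sigma>0..S})"
    using DERIV_image_chain[OF DERIV_subset[OF D1[OF s\<tau>] sub] lin\<tau>] by (simp add: o_def)
  have d2: "((\<lambda>s. \<Phi>' (s * \<tau>)) has_real_derivative \<Phi>'' (s * \<tau>) * \<tau>) (at s within {\<sigma>0..S})"
    using DERIV_image_chain[OF DERIV_subset[OF D2[OF s\<tau>] sub] lin\<tau>] by (simp add: o_def)
  show "((\<lambda>s. sqrt s ^ CARD('d) * \<Phi> (s * \<tau>)) has_real_derivative Z1 s \<tau>) (at s within {\<sigma>0..S})"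
    using DERIV_mult[OF q d1] s0 by (simp add: Z1_def lin_def field_simps)
  have l: "((\<lambda>s. lin (s * \<tau>)) has_real_derivative (CARD('d) / 2 * \<Phi>' (s * \<tau>) + (\<Phi>' (s * \<tau>) + s * \<tau> * \<Phi>'' (s * \<tau>))) * \<tau>) (at s within {\<sigma>0..S})"
    unfolding lin_def
    by (rule derivative_eq_intros d1 d2 refl)+ (simp add: algebra_simps)
  have "((\<lambda>s. sqrt s ^ CARD('d) / s) has_real_derivative (CARD('d) / 2 - 1) * (sqrt s ^ CARD('d) / s\<^sup>2)) (at s within {\<sigma>0..S})"
    using DERIV_divide[OF q DERIV_ident] s0 by (simp add: field_simps power2_eq_square)
  from DERIV_mult[OF this l]
  show "((\<lambda>s. Z1 s \<tau>) has_real_derivative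
      (CARD('d) / 2 - 1) * (sqrt s ^ CARD('d) / s\<^sup>2) * lin (s * \<tau>)
      + sqrt s ^ CARD('d) / s * ((CARD('d) / 2 * \<Phi>' (s * \<tau>) + (\<Phi>' (s * \<tau>) + s * \<tau> * \<Phi>'' (s * \<tau>))) * \<tau>)) (at s within {\<sigma>0..S})"
    unfolding Z1_def by (simp add: mult_ac add.commute)
qed

text \<open>The mean value inequality is used twice, for \<open>Z1\<close> and for \<open>Z\<close>
  minus its tangent. A bound on \<Phi>'' suffices for this, without continuity of \<Phi>''.\<close>

lemma Z_taylor_near:
  "\<exists>L\<ge>0. \<forall>\<tau> s s0. 0 \<le> \<tau> \<longrightarrow> \<tau> \<le> r\<^sup>2 \<longrightarrow> \<sigma>0 \<le> s \<longrightarrow> s \<le> S \<longrightarrow> \<sigma>0 \<le> s0 \<longrightarrow> s0 \<le> S \<longrightarrow>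
    \<bar>Z s \<tau> - Z s0 \<tau> - Z1 s0 \<tau> * (s - s0)\<bar> \<le> L * (s - s0)\<^sup>2"
proof -
  obtain Ml where Ml: "Ml > 0" "\<And>s. s \<ge> 0 \<Longrightarrow> \<bar>lin s\<bar> \<le> Ml"
    using bounded_by_compact_support[OF cont_lin lin_0] by auto
  obtain M1 where M1: "M1 > 0" "\<And>s. s \<ge> 0 \<Longrightarrow> \<bar>\<Phi>' s\<bar> \<le> M1"
    using bounded_by_compact_support[OF cont_\<Phi>' T(3)] by auto
  have B2_0: "B2 \<ge> 0" using B2[of 0] by simp
  define dd where "dd = real CARD('d) / 2"
  have dd: "dd \<ge> 0" by (simp add: dd_def)
  define Q where "Q = sqrt S ^ CARD('d)"
  \<comment> \<open>The formula for the second derivative in \<open>s\<close>, bounded factor by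
    factor.\<close>
  define L where "L = (dd + 1) * (Q / \<sigma>0\<^sup>2) * Ml + Q / \<sigma>0 * ((dd * M1 + (M1 + S * r\<^sup>2 * B2)) * r\<^sup>2)"
  show ?thesis
  proof (cases "\<sigma>0 \<le> S")
    case False
    then show ?thesis by (intro exI[of _ 0]) auto
  next
    case True
    have S: "0 \<le> S" using True \<sigma>0 by simp
    have Q: "0 \<le> Q" unfolding Q_def using S by simp
    have L: "0 \<le> L" unfolding L_def using Q Ml M1 B2_0 \<sigma>0 S dd by simp
    have L_bound: "\<bar>(CARD('d) / 2 - 1) * (sqrt s ^ CARD('d) / s\<^sup>2) * lin (s * \<tau>)
      + sqrt s ^ CARD('d) / s * ((CARD('d) / 2 * \<Phi>' (s * \<tau>) + (\<Phi>' (s * \<tau>) + s * \<tau> * \<Phi>'' (s * \<tau>))) * \<tau>)\<bar> \<le> L"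
      if s: "\<sigma>0 \<le> s" "s \<le> S" and \<tau>: "0 \<le> \<tau>" "\<tau> \<le> r\<^sup>2" for s \<tau>
    proof -
      have s0: "0 < s" using s \<sigma>0 by linarith
      have q: "0 \<le> sqrt s ^ CARD('d)" "sqrt s ^ CARD('d) \<le> Q"
        unfolding Q_def using s s0 by (auto intro!: power_mono)
      have s\<tau>: "0 \<le> s * \<tau>" "s * \<tau> \<le> S * r\<^sup>2" using s s0 \<tau> S by (auto intro!: mult_mono)
      have q1: "\<bar>sqrt s ^ CARD('d) / s\<bar> \<le> Q / \<sigma>0" "\<bar>sqrt s ^ CARD('d) / s\<^sup>2\<bar> \<le> Q / \<sigma>0\<^sup>2"
        using q s s0 \<sigma>0 Q by (auto intro!: frac_le power_mono)
      have "\<bar>(dd - 1) * (sqrt s ^ CARD('d) / s\<^sup>2) * lin (s * \<tau>)\<bar> \<le> (dd + 1) * (Q / \<sigma>0\<^sup>2) * Ml"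
        unfolding abs_mult by (intro mult_mono q1 Ml s\<tau>) (use dd Ml Q in auto)
      moreover have "\<bar>dd * \<Phi>' (s * \<tau>) + (\<Phi>' (s * \<tau>) + s * \<tau> * \<Phi>'' (s * \<tau>))\<bar> \<le> dd * M1 + (M1 + S * r\<^sup>2 * B2)"
      proof (intro order_trans[OF abs_triangle_ineq] add_mono)
        show "\<bar>dd * \<Phi>' (s * \<tau>)\<bar> \<le> dd * M1" unfolding abs_mult using dd M1 s\<tau> by (intro mult_mono) auto
        show "\<bar>\<Phi>' (s * \<tau>)\<bar> \<le> M1" using M1 s\<tau> by simp
        show "\<bar>s * \<tau> * \<Phi>'' (s * \<tau>)\<bar> \<le> S * r\<^sup>2 * B2"
          unfolding abs_mult[of "s * \<tau>"] by (intro mult_mono) (use s\<tau> B2[OF s\<tau>(1)] S in auto)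
      qed
      then have "\<bar>sqrt s ^ CARD('d) / s * ((dd * \<Phi>' (s * \<tau>) + (\<Phi>' (s * \<tau>) + s * \<tau> * \<Phi>'' (s * \<tau>))) * \<tau>)\<bar>
        \<le> Q / \<sigma>0 * ((dd * M1 + (M1 + S * r\<^sup>2 * B2)) * r\<^sup>2)"
        unfolding abs_mult[of "sqrt s ^ CARD('d) / s"] abs_mult[of _ \<tau>]
        by (intro mult_mono q1) (use \<tau> q Q dd M1 B2_0 S \<sigma>0 in auto)
      ultimately show ?thesis unfolding L_def dd_def[symmetric] by linarith
    qed
    show ?thesis
    proof (intro exI[of _ L] conjI allI impI L)
      fix \<tau> s s0 :: real
      assume \<tau>: "0 \<le> \<tau>" "\<tau> \<le> r\<^sup>2" and s: "\<sigma>0 \<le> s" "s \<le> S" and s0: "\<sigma>0 \<le> s0" "s0 \<le> S"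
      define I where "I = {min s s0..max s s0}"
      have I: "I \<subseteq> {\<sigma>0..S}" "convex I" "s \<in> I" "s0 \<in> I" unfolding I_def using s s0 by auto
      have Z1_lip: "\<bar>Z1 x \<tau> - Z1 y \<tau>\<bar> \<le> L * \<bar>x - y\<bar>" if "x \<in> {\<sigma>0..S}" "y \<in> {\<sigma>0..S}" for x y
        unfolding real_norm_def[symmetric]
        by (rule field_differentiable_bound[OF _ Z_DERIV(2)]) (use L_bound \<tau> that in auto)
      define g where "g x = sqrt x ^ CARD('d) * \<Phi> (x * \<tau>) - Z1 s0 \<tau> * x" for x
      have "norm (g s - g s0) \<le> (L * \<bar>s - s0\<bar>) * norm (s - s0)"
      proof (rule field_differentiable_bound[OF I(2) _ _ I(3,4)])
        fix x assume x: "x \<in> I"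
        then have x': "\<sigma>0 \<le> x" "x \<le> S" using I by auto
        show "(g has_real_derivative Z1 x \<tau> - Z1 s0 \<tau>) (at x within I)"
          unfolding g_def
          by (intro DERIV_diff DERIV_subset[OF Z_DERIV(1)[OF x' \<tau>(1)] I(1)] DERIV_cmult_Id)
        have "\<bar>Z1 x \<tau> - Z1 s0 \<tau>\<bar> \<le> L * \<bar>x - s0\<bar>" using Z1_lip x' s0 by auto
        also have "\<dots> \<le> L * \<bar>s - s0\<bar>"
          using x unfolding I_def by (intro mult_left_mono L) (auto simp: min_def max_def split: if_splits)
        finally show "norm (Z1 x \<tau> - Z1 s0 \<tau>) \<le> L * \<bar>s - s0\<bar>" by simp
      qed
      moreover have "Z x \<tau> = sqrt x ^ CARD('d) * \<Phi> (x * \<tau>)" if "\<sigma>0 \<le> x" for x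
        using \<alpha>_sqrt[OF that] that \<sigma>0 by (simp add: Z_def)
      ultimately show "\<bar>Z s \<tau> - Z s0 \<tau> - Z1 s0 \<tau> * (s - s0)\<bar> \<le> L * (s - s0)\<^sup>2"
        using s s0 by (simp add: g_def power2_eq_square algebra_simps abs_mult)
    qed
  qed
qed

text \<open>If \<open>s\<close> is at least \<eta> away from \<open>s0\<close>, then
  \<open>(s - s0)^2 / \<eta>^2\<close> is at least 1 and absorbs everything bounded, including the
  clipped range. Beyond \<open>A\<close>, where \<alpha> is unbounded, a power of \<open>s\<close>
  remains for the exponential moment to handle.\<close>

lemma Z_taylor:
  assumes A: "Cf + \<eta> \<le> A" "1 \<le> A" "\<sigma>0 \<le> A"
  shows "\<exists>C\<ge>0. \<forall>\<tau> s s0. 0 \<le> \<tau> \<longrightarrow> \<tau> \<le> r\<^sup>2 \<longrightarrow> 0 \<le> s \<longrightarrow> \<sigma>0 + \<eta> \<le> s0 \<longrightarrow> s0 \<le> Cf \<longrightarrow>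
    \<bar>Z s \<tau> - Z s0 \<tau> - Z1 s0 \<tau> * (s - s0)\<bar> \<le> C * ((s - s0)\<^sup>2 + (if A < s then s ^ CARD('d) else 0)) \<and>
    \<bar>Z1 s0 \<tau>\<bar> \<le> C"
proof -
  obtain L where L: "L \<ge> 0" and near: "\<forall>\<tau> s s0. 0 \<le> \<tau> \<longrightarrow> \<tau> \<le> r\<^sup>2 \<longrightarrow> \<sigma>0 \<le> s \<longrightarrow> s \<le> Cf + \<eta> \<longrightarrow> \<sigma>0 \<le> s0 \<longrightarrow> s0 \<le> Cf + \<eta> \<longrightarrow>
    \<bar>Z s \<tau> - Z s0 \<tau> - Z1 s0 \<tau> * (s - s0)\<bar> \<le> L * (s - s0)\<^sup>2"
    using Z_taylor_near[of "Cf + \<eta>"] by (elim exE conjE) (rule that)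
  obtain M0 where M0: "M0 > 0" "\<And>s. s \<ge> 0 \<Longrightarrow> \<bar>\<Phi> s\<bar> \<le> M0"
    using bounded_by_compact_support[OF cont_\<Phi> T(2)] by auto
  obtain Ml where Ml: "Ml > 0" "\<And>s. s \<ge> 0 \<Longrightarrow> \<bar>lin s\<bar> \<le> Ml"
    using bounded_by_compact_support[OF cont_lin lin_0] by auto
  have "compact (\<alpha> ` {0..A})"
    by (intro compact_continuous_image compact_Icc continuous_on_subset[OF \<alpha>_cont]) auto
  then obtain a where a: "a > 0" "\<And>s. s \<in> {0..A} \<Longrightarrow> \<bar>\<alpha> s\<bar> \<le> a"
    using compact_imp_bounded bounded_pos by (metis imageI real_norm_def)
  define P where "P = a ^ CARD('d) * M0"
  define N1 where "N1 = sqrt Cf ^ CARD('d) / \<sigma>0 * Ml"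
  have P: "P \<ge> 0" and N1: "N1 \<ge> 0" unfolding P_def N1_def using a M0 Ml Cf_nonneg \<sigma>0 by auto
  have ZP: "\<bar>Z s \<tau>\<bar> \<le> P" if "0 \<le> s" "s \<le> A" "0 \<le> \<tau>" for s \<tau>
    unfolding Z_def P_def abs_mult power_abs using a(2)[of s] M0 that by (intro mult_mono power_mono) auto
  have Z1N: "\<bar>Z1 s0 \<tau>\<bar> \<le> N1" if "\<sigma>0 + \<eta> \<le> s0" "s0 \<le> Cf" "0 \<le> \<tau>" for s0 \<tau>
  proof -
    have s0: "0 < s0" "\<sigma>0 \<le> s0" using that \<sigma>0 \<eta> by auto
    have "\<bar>sqrt s0 ^ CARD('d) / s0\<bar> \<le> sqrt Cf ^ CARD('d) / \<sigma>0"
      using s0 that \<sigma>0 Cf_nonneg by (auto intro!: frac_le power_mono)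
    then show ?thesis unfolding Z1_def N1_def abs_mult
      by (intro mult_mono Ml) (use s0 that Cf_nonneg \<sigma>0 in auto)
  qed
  define C where "C = L + (2 * P / \<eta>\<^sup>2 + N1 / \<eta>) + M0 + N1"
  have C: "0 \<le> C" "L \<le> C" "2 * P / \<eta>\<^sup>2 + N1 / \<eta> \<le> C" "M0 \<le> C" "N1 \<le> C"
    unfolding C_def using L P N1 M0 \<eta> by auto
  show ?thesis
  proof (intro exI[of _ C] conjI allI impI C(1))
    fix \<tau> s s0 :: real
    assume \<tau>: "0 \<le> \<tau>" "\<tau> \<le> r\<^sup>2" and s: "0 \<le> s" and s0: "\<sigma>0 + \<eta> \<le> s0" "s0 \<le> Cf"
    show "\<bar>Z1 s0 \<tau>\<bar> \<le> C" using Z1N[OF s0 \<tau>(1)] C by simp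
    have s0': "0 \<le> s0" "s0 \<le> A" "\<sigma>0 \<le> s0" using s0 \<sigma>0 \<eta> A by auto
    have tail: "0 \<le> (if A < s then s ^ CARD('d) else 0)" using s by simp
    show "\<bar>Z s \<tau> - Z s0 \<tau> - Z1 s0 \<tau> * (s - s0)\<bar> \<le> C * ((s - s0)\<^sup>2 + (if A < s then s ^ CARD('d) else 0))"
    proof (cases "\<bar>s - s0\<bar> < \<eta>")
      case True
      then have "\<sigma>0 \<le> s" "s \<le> Cf + \<eta>" using s0 by auto
      from near[rule_format, OF \<tau> this s0'(3)] have "\<bar>Z s \<tau> - Z s0 \<tau> - Z1 s0 \<tau> * (s - s0)\<bar> \<le> L * (s - s0)\<^sup>2"
        using s0 \<eta> by simp
      also have "\<dots> \<le> C * ((s - s0)\<^sup>2 + (if A < s then s ^ CARD('d) else 0))"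
        using C tail by (intro mult_mono) auto
      finally show ?thesis .
    next
      case False
      have far: "1 \<le> (s - s0)\<^sup>2 / \<eta>\<^sup>2" "\<bar>s - s0\<bar> \<le> (s - s0)\<^sup>2 / \<eta>"
      proof -
        have "\<eta>\<^sup>2 \<le> \<bar>s - s0\<bar>\<^sup>2" using False \<eta> by (intro power_mono) auto
        then show "1 \<le> (s - s0)\<^sup>2 / \<eta>\<^sup>2" using \<eta> by simp
        have "\<bar>s - s0\<bar> * \<eta> \<le> \<bar>s - s0\<bar> * \<bar>s - s0\<bar>" using False by (intro mult_left_mono) auto
        then show "\<bar>s - s0\<bar> \<le> (s - s0)\<^sup>2 / \<eta>" using \<eta> by (simp add: pos_le_divide_eq power2_eq_square)
      qed
      have lin_part: "\<bar>Z s0 \<tau>\<bar> + \<bar>Z1 s0 \<tau> * (s - s0)\<bar> \<le> P * ((s - s0)\<^sup>2 / \<eta>\<^sup>2) + N1 * ((s - s0)\<^sup>2 / \<eta>)"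
      proof (rule add_mono)
        show "\<bar>Z s0 \<tau>\<bar> \<le> P * ((s - s0)\<^sup>2 / \<eta>\<^sup>2)"
          using ZP[OF s0'(1,2) \<tau>(1)] mult_left_mono[OF far(1) P] by simp
        show "\<bar>Z1 s0 \<tau> * (s - s0)\<bar> \<le> N1 * ((s - s0)\<^sup>2 / \<eta>)"
          unfolding abs_mult by (intro mult_mono Z1N[OF s0 \<tau>(1)] far N1) simp
      qed
      have Z_part: "\<bar>Z s \<tau>\<bar> \<le> P * ((s - s0)\<^sup>2 / \<eta>\<^sup>2) + M0 * (if A < s then s ^ CARD('d) else 0)"
      proof (cases "A < s")
        case True
        then have s1: "1 \<le> s" "\<sigma>0 \<le> s" using A by auto
        \<comment> \<open>Trades the power \<open>d / 2\<close> of \<open>s\<close> for the integer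
          power \<open>d\<close>.\<close>
        have "sqrt s \<le> s" using s1(1) real_le_lsqrt[of s s] by (simp add: power2_eq_square mult_le_cancel_right1)
        then have "\<bar>Z s \<tau>\<bar> \<le> s ^ CARD('d) * M0"
          unfolding Z_def abs_mult \<alpha>_sqrt[OF s1(2)] power_abs using s s1 M0 \<tau>
          by (intro mult_mono power_mono) auto
        then show ?thesis using True P by (simp add: mult.commute add_increasing)
      next
        case False
        then have "\<bar>Z s \<tau>\<bar> \<le> P" using ZP s \<tau> by simp
        then show ?thesis using False mult_left_mono[OF far(1) P] by simp
      qed
      have "\<bar>Z s \<tau> - Z s0 \<tau> - Z1 s0 \<tau> * (s - s0)\<bar> \<le> \<bar>Z s \<tau>\<bar> + (\<bar>Z s0 \<tau>\<bar> + \<bar>Z1 s0 \<tau> * (s - s0)\<bar>)"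
        by linarith
      also have "\<dots> \<le> (2 * P / \<eta>\<^sup>2 + N1 / \<eta>) * (s - s0)\<^sup>2 + M0 * (if A < s then s ^ CARD('d) else 0)"
      proof -
        have "(2 * P / \<eta>\<^sup>2 + N1 / \<eta>) * (s - s0)\<^sup>2 = P * ((s - s0)\<^sup>2 / \<eta>\<^sup>2) + (P * ((s - s0)\<^sup>2 / \<eta>\<^sup>2) + N1 * ((s - s0)\<^sup>2 / \<eta>))"
          by (simp add: distrib_right)
        then show ?thesis using lin_part Z_part by linarith
      qed
      also have "\<dots> \<le> C * (s - s0)\<^sup>2 + C * (if A < s then s ^ CARD('d) else 0)"
        using C tail by (intro add_mono mult_right_mono) auto
      finally show ?thesis by (simp add: distrib_left)
    qed
  qed
qed

end

section \<open>The pilot estimator at a fixed point\<close>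

lemma sum_squared_le: "(x + y)\<^sup>2 \<le> 2 * x\<^sup>2 + 2 * (y :: real)\<^sup>2"
  using zero_le_power2[of "x - y"] by (simp add: power2_eq_square algebra_simps)

locale sample = variable_bandwidth \<Phi> \<Phi>' \<Phi>'' B2 T K f t Cf \<sigma>0 \<eta> \<rho> r \<alpha> c + prob_space M
  for \<Phi> \<Phi>' \<Phi>'' :: "real \<Rightarrow> real" and B2 T :: real and K :: "real ^ 'd::finite \<Rightarrow> real"
    and f :: "real ^ 'd \<Rightarrow> real" and t :: "real ^ 'd" and Cf \<sigma>0 \<eta> \<rho> r :: real
    and \<alpha> :: "real \<Rightarrow> real" and c :: real and M :: "'w measure" +
  fixes X :: "nat \<Rightarrow> 'w \<Rightarrow> real ^ 'd"
  assumes indep: "indep_vars (\<lambda>_. borel) X {1..}"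
    and dist: "\<And>i. 1 \<le> i \<Longrightarrow> distributed M lborel (X i) (\<lambda>x. ennreal (f x))"
begin

definition smoothed :: "real \<Rightarrow> real ^ 'd \<Rightarrow> real"
  where "smoothed h y = (\<integral>w. K w * f (y - h *\<^sub>R w) \<partial>lborel)"

text \<open>The pilot estimator at \<open>y\<close> given that the remaining sample point sits at \<open>y\<close> itself, which
  contributes the term \<open>K 0\<close>.\<close>

definition pilot :: "nat set \<Rightarrow> nat \<Rightarrow> real \<Rightarrow> real ^ 'd \<Rightarrow> 'w \<Rightarrow> real"
  where "pilot J n h y \<omega> = (K 0 + (\<Sum>j\<in>J. K ((1 / h) *\<^sub>R (y - X j \<omega>)))) / (n * h ^ CARD('d))"

lemma smoothed_eq: "smoothed h y = bias h y + f y"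
  by (simp add: smoothed_def bias_def)

lemma smoothed_bounds: "0 \<le> smoothed h y" "smoothed h y \<le> Cf"
proof -
  show "0 \<le> smoothed h y"
    unfolding smoothed_def by (intro Bochner_Integration.integral_nonneg) (simp add: K_nonneg f_nonneg)
  have "\<bar>smoothed h y\<bar> \<le> Cf"
    unfolding smoothed_def
    by (rule K_weighted_bound) (use f_le f_nonneg in \<open>auto intro!: shift_integrable f_comp_cont continuous_intros\<close>)
  then show "smoothed h y \<le> Cf" by simp
qed

lemma X_rv: "1 \<le> i \<Longrightarrow> random_variable borel (X i)"
  using indep unfolding indep_vars_def by auto

lemma expectation_kernel:
  assumes "1 \<le> j" "0 < h"
  shows "expectation (\<lambda>\<omega>. K ((1 / h) *\<^sub>R (y - X j \<omega>))) = h ^ CARD('d) * smoothed h y"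
proof -
  have m: "(\<lambda>x. K ((1 / h) *\<^sub>R (y - x))) \<in> borel_measurable borel"
    by (intro borel_measurable_continuous_onI continuous_on_compose2[OF cont_K[of UNIV]] continuous_intros) auto
  have fm: "f \<in> borel_measurable borel" by (rule borel_measurable_continuous_onI[OF f_cont])
  have "expectation (\<lambda>\<omega>. K ((1 / h) *\<^sub>R (y - X j \<omega>))) = (\<integral>x. f x * K ((1 / h) *\<^sub>R (y - x)) \<partial>lborel)"
    using distributed_integral[OF dist[OF assms(1)], of "\<lambda>x. K ((1 / h) *\<^sub>R (y - x))"] m f_nonneg by simp
  also have "\<dots> = \<bar>- h\<bar> ^ CARD('d) * (\<integral>w. f (y + (- h) *\<^sub>R w) * K ((1 / h) *\<^sub>R (y - (y + (- h) *\<^sub>R w))) \<partial>lborel)"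
    by (rule integral_lborel_affine) (use fm m assms in auto)
  also have "\<dots> = h ^ CARD('d) * smoothed h y"
    using assms by (simp add: smoothed_def mult.commute)
  finally show ?thesis .
qed

text \<open>The constants are uniform in \<open>n\<close>, \<open>i\<close>, \<open>h\<close> and
  \<open>y\<close>, because the estimates are later integrated over \<open>y\<close>. The threshold
  \<open>A = exp BK * Cf\<close> is the one that compensates \<open>exp_sum_bound\<close>, whose
  exponent is at most \<open>N * A\<close>.\<close>

lemma pilot_estimates:
  assumes BK: "\<And>z. K z \<le> BK"
  shows "\<exists>C\<ge>0. \<forall>n i (h :: real) y. i \<in> {1..n} \<longrightarrow> 0 < h \<longrightarrow> h \<le> 1 \<longrightarrow> 1 \<le> n * h ^ CARD('d) \<longrightarrow>
    (let D = pilot ({1..n} - {i}) n h y; N = n * h ^ CARD('d); A = exp BK * Cf in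
      \<bar>expectation D - f y - bias h y\<bar> \<le> C / N \<and>
      expectation (\<lambda>\<omega>. (D \<omega> - f y)\<^sup>2) \<le> C * (1 / N + h ^ 4) \<and>
      expectation (\<lambda>\<omega>. exp (N * (D \<omega> - A))) \<le> C)"
proof -
  have BK0: "0 \<le> BK" using BK[of 0] K_nonneg[of 0] by linarith
  define Cb where "Cb = CARD('d) ^ 2 * T * Cf"
  define C where "C = 2 * (BK * Cf) + 4 * Cb ^ 2 + 4 * (BK + Cf) ^ 2 + (BK + Cf) + exp BK"
  have C: "0 \<le> C" "BK + Cf \<le> C" "2 * (BK * Cf) + 4 * (BK + Cf) ^ 2 \<le> C" "4 * Cb ^ 2 \<le> C" "exp BK \<le> C"
    unfolding C_def using BK0 Cf_nonneg by (auto intro!: add_nonneg_nonneg simp: add_increasing)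
  show ?thesis
  proof (intro exI[of _ C] conjI allI impI C(1))
    fix n i :: nat and h :: real and y :: "real ^ 'd"
    assume i: "i \<in> {1..n}" and h: "0 < h" "h \<le> 1" and N1: "1 \<le> n * h ^ CARD('d)"
    define N where "N = n * h ^ CARD('d)"
    have n: "1 \<le> n" using i by simp
    define J where "J = {1..n} - {i}"
    define D where "D = pilot J n h y"
    define Y where "Y j \<omega> = K ((1 / h) *\<^sub>R (y - X j \<omega>))" for j \<omega>
    define S where "S \<omega> = (\<Sum>j\<in>J. Y j \<omega>)" for \<omega>
    define m where "m = h ^ CARD('d) * smoothed h y"
    have N: "1 \<le> N" using N1 by (simp add: N_def)
    have J: "finite J" "J \<subseteq> {1..}" "real (card J) = real n - 1" "card J \<le> n" using i n by (auto simp: J_def)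
    have m: "0 \<le> m" "n * m \<le> N * Cf" "m \<le> Cf"
    proof -
      show "0 \<le> m" unfolding m_def using h smoothed_bounds(1) by simp
      have "N * smoothed h y \<le> N * Cf" using N smoothed_bounds by (intro mult_left_mono) auto
      then show "n * m \<le> N * Cf" by (simp add: m_def N_def)
      have "h ^ CARD('d) * smoothed h y \<le> 1 * Cf"
        using h smoothed_bounds by (intro mult_mono power_le_one) auto
      then show "m \<le> Cf" by (simp add: m_def)
    qed
    have cardm: "card J * m \<le> N * Cf" using mult_right_mono[of "card J" n m] J m by simp
    have Km: "(\<lambda>x. K ((1 / h) *\<^sub>R (y - x))) \<in> borel_measurable borel"
      by (intro borel_measurable_continuous_onI continuous_on_compose2[OF cont_K[of UNIV]] continuous_intros) auto
    have indY: "indep_vars (\<lambda>_. borel) Y J"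
      unfolding Y_def by (rule indep_vars_compose2[OF indep_vars_subset[OF indep J(2)] Km])
    have Yb: "0 \<le> Y j \<omega> \<and> Y j \<omega> \<le> BK" for j \<omega> unfolding Y_def using K_nonneg BK by simp
    have Ye: "expectation (Y j) = m" if "j \<in> J" for j
      unfolding Y_def m_def using expectation_kernel[of j h y] that J h by auto
    have Yrv: "random_variable borel (Y j)" if "j \<in> J" for j
      using indY that unfolding indep_vars_def by auto
    have Srv: "random_variable borel S" unfolding S_def using Yrv by simp
    have Sb: "0 \<le> S \<omega>" "S \<omega> \<le> card J * BK" for \<omega>
      unfolding S_def using Yb sum_bounded_above[of J "\<lambda>j. Y j \<omega>" BK] by (auto intro!: sum_nonneg)
    have Sint: "integrable M S"
      by (rule integrable_const_bound[of _ "card J * BK"]) (use Sb Srv in auto)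
    have Sexp: "expectation S = card J * m"
    proof -
      have "integrable M (Y j)" if "j \<in> J" for j
        by (rule integrable_const_bound[of _ BK]) (use Yb Yrv[OF that] in auto)
      then show ?thesis unfolding S_def by (subst Bochner_Integration.integral_sum) (simp_all add: Ye)
    qed
    have D: "D \<omega> = (K 0 + S \<omega>) / N" for \<omega>
      unfolding D_def pilot_def S_def Y_def N_def by simp
    \<comment> \<open>One of the \<open>n\<close> summands is the constant \<open>K 0\<close>
      instead of a variable with mean \<open>m\<close>, which shifts the mean by this
      amount.\<close>
    define e where "e = (K 0 - m) / N"
    have mean: "(K 0 + card J * m) / N = f y + bias h y + e"
    proof -
      have "n * m = N * smoothed h y" by (simp add: m_def N_def)
      then have "K 0 + (real n - 1) * m = N * (bias h y + f y) + (K 0 - m)"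
        by (simp add: smoothed_eq algebra_simps)
      then have "K 0 + card J * m = N * (bias h y + f y) + (K 0 - m)"
        unfolding J(3) .
      then show ?thesis using N by (simp add: e_def field_simps)
    qed
    have e_le: "\<bar>e\<bar> \<le> (BK + Cf) / N"
    proof -
      have "\<bar>K 0 - m\<bar> \<le> BK + Cf" using K_nonneg[of 0] BK[of 0] m Cf_nonneg BK0 by linarith
      then show ?thesis using N by (simp add: e_def divide_right_mono)
    qed
    have "expectation D = f y + bias h y + e"
      unfolding D mean[symmetric] using Sint Sexp prob_space by simp
    then have 1: "\<bar>expectation D - f y - bias h y\<bar> \<le> C / N"
      using e_le divide_right_mono[OF C(2), of N] N by simp
    have 2: "expectation (\<lambda>\<omega>. (D \<omega> - f y)\<^sup>2) \<le> C * (1 / N + h ^ 4)"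
    proof -
      define V where "V \<omega> = (S \<omega> - card J * m)\<^sup>2" for \<omega>
      have Vint: "integrable M V"
      proof (rule integrable_const_bound[of _ "(card J * BK + card J * m)\<^sup>2"])
        have "\<bar>S \<omega> - card J * m\<bar> \<le> card J * BK + card J * m" for \<omega>
        proof -
          have "0 \<le> card J * m" using m(1) by simp
          then show ?thesis unfolding abs_le_iff using Sb[of \<omega>] by linarith
        qed
        then show "AE \<omega> in M. norm (V \<omega>) \<le> (card J * BK + card J * m)\<^sup>2"
          unfolding V_def by (intro AE_I2) (simp add: abs_le_square_iff[symmetric] m BK0)
      qed (use Srv in \<open>simp add: V_def[abs_def]\<close>)
      have Vexp: "expectation V \<le> N * (BK * Cf)"
      proof -
        have "expectation V \<le> card J * (BK * m)"
          unfolding V_def S_def by (rule sum_variance_bound[OF J(1) indY Yb Ye])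
        also have "\<dots> = BK * (card J * m)" by simp
        also have "\<dots> \<le> BK * (N * Cf)" using cardm BK0 by (intro mult_left_mono)
        finally show ?thesis by (simp add: mult_ac)
      qed
      have be: "(bias h y + e)\<^sup>2 \<le> 2 * Cb\<^sup>2 * h ^ 4 + 2 * (BK + Cf)\<^sup>2 / N"
      proof -
        have "(bias h y + e)\<^sup>2 \<le> 2 * (bias h y)\<^sup>2 + 2 * e\<^sup>2"
          by (rule sum_squared_le)
        moreover have "(bias h y)\<^sup>2 \<le> (Cb * h\<^sup>2)\<^sup>2"
          using bias_bound[of h y] unfolding Cb_def by (simp add: abs_le_square_iff[symmetric] T(1) less_imp_le Cf_nonneg abs_mult)
        moreover have "e\<^sup>2 \<le> ((BK + Cf) / N)\<^sup>2"
          using power_mono[OF e_le, of 2] by simp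
        \<comment> \<open>\<open>N \<ge> 1\<close> weakens the squared shift to the order
          \<open>1 / N\<close> of the variance.\<close>
        moreover have "((BK + Cf) / N)\<^sup>2 \<le> (BK + Cf)\<^sup>2 / N"
          using N by (simp add: power_divide power2_eq_square[of N] divide_simps mult_le_cancel_left1)
        ultimately show ?thesis by (simp add: power_mult_distrib)
      qed
      have "expectation (\<lambda>\<omega>. (D \<omega> - f y)\<^sup>2) \<le> expectation (\<lambda>\<omega>. 2 / N\<^sup>2 * V \<omega> + 2 * (bias h y + e)\<^sup>2)"
      proof (rule Bochner_Integration.integral_mono)
        show "integrable M (\<lambda>\<omega>. 2 / N\<^sup>2 * V \<omega> + 2 * (bias h y + e)\<^sup>2)" using Vint by simp
        have eq: "D \<omega> - f y = (S \<omega> - card J * m) / N + (bias h y + e)" for \<omega>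
          unfolding D using mean by (simp add: diff_divide_distrib add_divide_distrib)
        have "(D \<omega> - f y)\<^sup>2 \<le> 2 * ((S \<omega> - card J * m) / N)\<^sup>2 + 2 * (bias h y + e)\<^sup>2" for \<omega>
          unfolding eq by (rule sum_squared_le)
        then show le: "(D \<omega> - f y)\<^sup>2 \<le> 2 / N\<^sup>2 * V \<omega> + 2 * (bias h y + e)\<^sup>2" for \<omega>
          by (simp add: V_def power_divide)
        show "integrable M (\<lambda>\<omega>. (D \<omega> - f y)\<^sup>2)"
          by (rule Bochner_Integration.integrable_bound[of M "\<lambda>\<omega>. 2 / N\<^sup>2 * V \<omega> + 2 * (bias h y + e)\<^sup>2"])
            (use Vint le Srv in \<open>auto simp: D intro!: AE_I2 order_trans[OF _ abs_ge_self]\<close>)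
      qed
      also have "\<dots> = 2 / N\<^sup>2 * expectation V + 2 * (bias h y + e)\<^sup>2" using Vint prob_space by simp
      also have "\<dots> \<le> 2 / N\<^sup>2 * (N * (BK * Cf)) + 2 * (2 * Cb\<^sup>2 * h ^ 4 + 2 * (BK + Cf)\<^sup>2 / N)"
        using Vexp be by (intro add_mono mult_left_mono) auto
      also have "\<dots> = (2 * (BK * Cf) + 4 * (BK + Cf)\<^sup>2) * (1 / N) + 4 * Cb\<^sup>2 * h ^ 4"
        using N by (simp add: field_simps power2_eq_square)
      also have "\<dots> \<le> C * (1 / N) + C * h ^ 4"
        using C N h by (intro add_mono mult_right_mono) auto
      finally show ?thesis by (simp add: distrib_left)
    qed
    have 3: "expectation (\<lambda>\<omega>. exp (N * (D \<omega> - exp BK * Cf))) \<le> C"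
    proof -
      have "exp (N * (D \<omega> - exp BK * Cf)) = exp (K 0 - N * (exp BK * Cf)) * exp (S \<omega>)" for \<omega>
      proof -
        have "N * D \<omega> = K 0 + S \<omega>" using N by (simp add: D)
        then show ?thesis by (simp add: exp_add[symmetric] right_diff_distrib)
      qed
      then have "expectation (\<lambda>\<omega>. exp (N * (D \<omega> - exp BK * Cf))) = exp (K 0 - N * (exp BK * Cf)) * expectation (\<lambda>\<omega>. exp (S \<omega>))"
        by simp
      also have "\<dots> \<le> exp (K 0 - N * (exp BK * Cf)) * exp (card J * (exp BK * m))"
        unfolding S_def by (intro mult_left_mono exp_sum_bound[OF J(1) indY Yb Ye]) auto
      also have "\<dots> = exp (K 0 - N * (exp BK * Cf) + exp BK * (card J * m))"
        by (simp add: exp_add[symmetric] mult_ac)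
      also have "\<dots> \<le> exp BK"
      proof -
        have "exp BK * (card J * m) \<le> exp BK * (N * Cf)" by (rule mult_left_mono[OF cardm]) simp
        also have "\<dots> = N * (exp BK * Cf)" by (simp only: mult_ac)
        finally have "K 0 - N * (exp BK * Cf) + exp BK * (card J * m) \<le> BK" using BK[of 0] by linarith
        then show ?thesis by (simp only: exp_le_cancel_iff)
      qed
      finally show ?thesis using C by simp
    qed
    show "let D = pilot ({1..n} - {i}) n h y; N = n * h ^ CARD('d); A = exp BK * Cf in
      \<bar>expectation D - f y - bias h y\<bar> \<le> C / N \<and>
      expectation (\<lambda>\<omega>. (D \<omega> - f y)\<^sup>2) \<le> C * (1 / N + h ^ 4) \<and>
      expectation (\<lambda>\<omega>. exp (N * (D \<omega> - A))) \<le> C"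
      using 1 2 3 unfolding Let_def D_def J_def N_def by blast
  qed
qed

lemma integrable_comp_bounded:
  assumes "random_variable borel D" "\<And>\<omega>. 0 \<le> D \<omega>" "\<And>\<omega>. D \<omega> \<le> Dm" and \<phi>: "continuous_on UNIV (\<phi> :: real \<Rightarrow> real)"
  shows "integrable M (\<lambda>\<omega>. \<phi> (D \<omega>))"
proof -
  have "compact (\<phi> ` {0..Dm})"
    by (intro compact_continuous_image compact_Icc continuous_on_subset[OF \<phi>]) auto
  then obtain B where B: "\<And>s. s \<in> {0..Dm} \<Longrightarrow> \<bar>\<phi> s\<bar> \<le> B"
    using compact_imp_bounded bounded_iff by (metis imageI real_norm_def)
  show ?thesis
  proof (rule integrable_const_bound[of _ B])
    show "AE \<omega> in M. norm (\<phi> (D \<omega>)) \<le> B" using B assms(2,3) by (intro AE_I2) simp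
    show "random_variable borel (\<lambda>\<omega>. \<phi> (D \<omega>))"
      by (rule measurable_compose[OF assms(1) borel_measurable_continuous_onI[OF \<phi>]])
  qed
qed

lemma Z_cont: "0 \<le> \<tau> \<Longrightarrow> continuous_on UNIV (\<lambda>s. Z s \<tau>)"
  unfolding Z_def by (intro continuous_intros \<alpha>_cont continuous_on_compose2[OF cont_\<Phi>]) auto

lemma pilot_bounds:
  fixes BK :: real and h :: real
  assumes "\<And>z. K z \<le> BK" "1 \<le> n * h ^ CARD('d)"
  shows "0 \<le> pilot J n h y \<omega>" "pilot J n h y \<omega> \<le> K 0 + card J * BK"
proof -
  have "0 \<le> (\<Sum>j\<in>J. K ((1 / h) *\<^sub>R (y - X j \<omega>)))" by (intro sum_nonneg K_nonneg)
  moreover have "(\<Sum>j\<in>J. K ((1 / h) *\<^sub>R (y - X j \<omega>))) \<le> card J * BK"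
    by (rule sum_bounded_above) (rule assms)
  ultimately have "0 \<le> K 0 + (\<Sum>j\<in>J. K ((1 / h) *\<^sub>R (y - X j \<omega>)))"
    "K 0 + (\<Sum>j\<in>J. K ((1 / h) *\<^sub>R (y - X j \<omega>))) \<le> K 0 + card J * BK"
    using K_nonneg[of 0] by auto
  moreover from this(1) have "(K 0 + (\<Sum>j\<in>J. K ((1 / h) *\<^sub>R (y - X j \<omega>)))) / (n * h ^ CARD('d))
      \<le> (K 0 + (\<Sum>j\<in>J. K ((1 / h) *\<^sub>R (y - X j \<omega>)))) / 1"
    using assms(2) by (intro divide_left_mono) auto
  ultimately show "0 \<le> pilot J n h y \<omega>" "pilot J n h y \<omega> \<le> K 0 + card J * BK"
    unfolding pilot_def using assms(2) by (auto intro: divide_nonneg_nonneg)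
qed

lemma pilot_rv: "J \<subseteq> {1..} \<Longrightarrow> random_variable borel (pilot J n h y)"
proof -
  assume J: "J \<subseteq> {1..}"
  have Km: "(\<lambda>x. K ((1 / h) *\<^sub>R (y - x))) \<in> borel_measurable borel"
    by (intro borel_measurable_continuous_onI continuous_on_compose2[OF cont_K[of UNIV]] continuous_intros) auto
  have "random_variable borel (\<lambda>\<omega>. K ((1 / h) *\<^sub>R (y - X j \<omega>)))" if "j \<in> J" for j
    by (rule measurable_compose[OF X_rv Km]) (use J that in auto)
  then show ?thesis unfolding pilot_def[abs_def] by simp
qed

text \<open>The tangent expansion is averaged over the pilot value: the mean square error bounds the
  quadratic part, the exponential moment with its spare factor \<open>1 / N\<close> bounds the tail,
  and replacing the mean deviation by \<open>bias h y\<close> costs another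
  \<open>1 / N\<close>.\<close>

lemma expectation_Z:
  "\<exists>C\<ge>0. \<forall>n i (h :: real) y \<tau>. i \<in> {1..n} \<longrightarrow> 0 < h \<longrightarrow> h \<le> 1 \<longrightarrow> 1 \<le> n * h ^ CARD('d) \<longrightarrow>
    \<sigma>0 + \<eta> \<le> f y \<longrightarrow> 0 \<le> \<tau> \<longrightarrow> \<tau> \<le> r\<^sup>2 \<longrightarrow>
    \<bar>expectation (\<lambda>\<omega>. Z (pilot ({1..n} - {i}) n h y \<omega>) \<tau>) - Z (f y) \<tau> - Z1 (f y) \<tau> * bias h y\<bar>
      \<le> C * (1 / (n * h ^ CARD('d)) + h ^ 4)"
proof -
  obtain BK where BK: "BK > 0" "\<And>z. K z \<le> BK" by (rule K_bounded) (rule that)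
  define A0 where "A0 = exp BK * Cf"
  \<comment> \<open>Chosen so that \<open>2 * A1\<close> meets the three lower bounds of
    \<open>Z_taylor\<close>; being at least \<open>A0\<close>, it also lets the moment centred at
    \<open>A0\<close> dominate.\<close>
  define A1 where "A1 = A0 + Cf + \<eta> + \<sigma>0 + 1"
  have A0: "0 \<le> A0" unfolding A0_def using Cf_nonneg by simp
  have A1: "0 < A1" "A0 \<le> A1" "Cf + \<eta> \<le> 2 * A1" "1 \<le> 2 * A1" "\<sigma>0 \<le> 2 * A1"
    unfolding A1_def using A0 Cf_nonneg \<eta> \<sigma>0 by auto
  obtain C1 where C1: "C1 \<ge> 0" and pe: "\<forall>n i (h :: real) y. i \<in> {1..n} \<longrightarrow> 0 < h \<longrightarrow> h \<le> 1 \<longrightarrow> 1 \<le> n * h ^ CARD('d) \<longrightarrow>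
    (let D = pilot ({1..n} - {i}) n h y; N = n * h ^ CARD('d); A = exp BK * Cf in
      \<bar>expectation D - f y - bias h y\<bar> \<le> C1 / N \<and>
      expectation (\<lambda>\<omega>. (D \<omega> - f y)\<^sup>2) \<le> C1 * (1 / N + h ^ 4) \<and>
      expectation (\<lambda>\<omega>. exp (N * (D \<omega> - A))) \<le> C1)"
    using pilot_estimates[OF BK(2)] by (elim exE conjE) (rule that)
  obtain CZ where CZ: "CZ \<ge> 0" and zt: "\<forall>\<tau> s s0. 0 \<le> \<tau> \<longrightarrow> \<tau> \<le> r\<^sup>2 \<longrightarrow> 0 \<le> s \<longrightarrow> \<sigma>0 + \<eta> \<le> s0 \<longrightarrow> s0 \<le> Cf \<longrightarrow>
    \<bar>Z s \<tau> - Z s0 \<tau> - Z1 s0 \<tau> * (s - s0)\<bar> \<le> CZ * ((s - s0)\<^sup>2 + (if 2 * A1 < s then s ^ CARD('d) else 0)) \<and>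
    \<bar>Z1 s0 \<tau>\<bar> \<le> CZ"
    using Z_taylor[OF A1(3-5)] by (elim exE conjE) (rule that)
  define CP where "CP = 2 ^ Suc CARD('d) * fact (Suc CARD('d)) / (2 * A1)"
  have CP: "0 \<le> CP" unfolding CP_def using A1 by simp
  define C where "C = CZ * (C1 + CP * C1 + C1)"
  have C: "0 \<le> C" unfolding C_def using CZ C1 CP by simp
  show ?thesis
  proof (intro exI[of _ C] conjI allI impI C)
    fix n i :: nat and h \<tau> :: real and y :: "real ^ 'd"
    assume i: "i \<in> {1..n}" and h: "0 < h" "h \<le> 1" and N1: "1 \<le> n * h ^ CARD('d)"
      and fy: "\<sigma>0 + \<eta> \<le> f y" and \<tau>: "0 \<le> \<tau>" "\<tau> \<le> r\<^sup>2"
    define N where "N = n * h ^ CARD('d)"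
    have N: "1 \<le> N" using N1 by (simp add: N_def)
    define D where "D = pilot ({1..n} - {i}) n h y"
    from pe[rule_format, OF i h N1] have
      est: "\<bar>expectation D - f y - bias h y\<bar> \<le> C1 / N" "expectation (\<lambda>\<omega>. (D \<omega> - f y)\<^sup>2) \<le> C1 * (1 / N + h ^ 4)"
        "expectation (\<lambda>\<omega>. exp (N * (D \<omega> - A0))) \<le> C1"
      unfolding Let_def D_def N_def A0_def by auto
    have D_rv: "random_variable borel D" unfolding D_def by (rule pilot_rv) auto
    have D0: "0 \<le> D \<omega>" for \<omega> unfolding D_def by (rule pilot_bounds[OF BK(2) N1])
    have Db: "D \<omega> \<le> K 0 + card ({1..n} - {i}) * BK" for \<omega> unfolding D_def by (rule pilot_bounds[OF BK(2) N1])
    note int = integrable_comp_bounded[OF D_rv D0 Db]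
    have intD: "integrable M D" using int[of "\<lambda>x. x"] by simp
    have intZ: "integrable M (\<lambda>\<omega>. Z (D \<omega>) \<tau>)" using int[OF Z_cont[OF \<tau>(1)]] .
    have intsq: "integrable M (\<lambda>\<omega>. (D \<omega> - f y)\<^sup>2)" by (rule int) (intro continuous_intros)
    have intexp: "integrable M (\<lambda>\<omega>. exp (N * (D \<omega> - A0)))" by (rule int) (intro continuous_intros)
    have zt': "\<bar>Z (D \<omega>) \<tau> - Z (f y) \<tau> - Z1 (f y) \<tau> * (D \<omega> - f y)\<bar> \<le> CZ * (D \<omega> - f y)\<^sup>2 + CZ * CP / N * exp (N * (D \<omega> - A0))" for \<omega>
    proof -
      have "\<bar>Z (D \<omega>) \<tau> - Z (f y) \<tau> - Z1 (f y) \<tau> * (D \<omega> - f y)\<bar>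
        \<le> CZ * ((D \<omega> - f y)\<^sup>2 + (if 2 * A1 < D \<omega> then D \<omega> ^ CARD('d) else 0))"
        using zt[rule_format, OF \<tau> D0 fy f_le] by simp
      also have "\<dots> \<le> CZ * ((D \<omega> - f y)\<^sup>2 + CP * (exp (N * (D \<omega> - A0)) / N))"
      proof (intro mult_left_mono add_left_mono CZ)
        show "(if 2 * A1 < D \<omega> then D \<omega> ^ CARD('d) else 0) \<le> CP * (exp (N * (D \<omega> - A0)) / N)"
        proof (cases "2 * A1 < D \<omega>")
          case True
          then have "D \<omega> ^ CARD('d) \<le> CP * (exp (N * (D \<omega> - A1)) / N)"
            unfolding CP_def using N A1(1) by (intro power_le_exp_excess) auto
          also have "\<dots> \<le> CP * (exp (N * (D \<omega> - A0)) / N)"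
            using N A1(2) CP by (intro mult_left_mono divide_right_mono) auto
          finally show ?thesis using True by simp
        qed (use CP N in simp)
      qed
      finally show ?thesis by (simp add: algebra_simps)
    qed
    define W where "W \<omega> = Z (D \<omega>) \<tau> - Z (f y) \<tau> - Z1 (f y) \<tau> * (D \<omega> - f y)" for \<omega>
    have intW: "integrable M W"
      unfolding W_def using intD intZ by (intro Bochner_Integration.integrable_diff integrable_mult_right) auto
    have "expectation (\<lambda>\<omega>. Z (D \<omega>) \<tau>) - Z (f y) \<tau> - Z1 (f y) \<tau> * (expectation D - f y) = expectation W"
      unfolding W_def using intD intZ prob_space by simp
    also have "\<bar>expectation W\<bar> \<le> expectation (\<lambda>\<omega>. \<bar>W \<omega>\<bar>)"
      using integral_norm_bound[of M W] unfolding real_norm_def .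
    also have "\<dots> \<le> expectation (\<lambda>\<omega>. CZ * (D \<omega> - f y)\<^sup>2 + CZ * CP / N * exp (N * (D \<omega> - A0)))"
    proof (rule Bochner_Integration.integral_mono)
      show "integrable M (\<lambda>\<omega>. \<bar>W \<omega>\<bar>)" using intW by (rule integrable_abs)
      show "integrable M (\<lambda>\<omega>. CZ * (D \<omega> - f y)\<^sup>2 + CZ * CP / N * exp (N * (D \<omega> - A0)))"
        by (intro Bochner_Integration.integrable_add integrable_mult_right intsq intexp)
    qed (unfold W_def, rule zt')
    also have "\<dots> = CZ * expectation (\<lambda>\<omega>. (D \<omega> - f y)\<^sup>2) + CZ * CP / N * expectation (\<lambda>\<omega>. exp (N * (D \<omega> - A0)))"
      using intsq intexp by simp
    also have "\<dots> \<le> CZ * (C1 * (1 / N + h ^ 4)) + CZ * CP / N * C1"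
      using est CZ CP N by (intro add_mono mult_left_mono) auto
    finally have 1: "\<bar>expectation (\<lambda>\<omega>. Z (D \<omega>) \<tau>) - Z (f y) \<tau> - Z1 (f y) \<tau> * (expectation D - f y)\<bar>
      \<le> CZ * (C1 * (1 / N + h ^ 4)) + CZ * CP / N * C1" .
    define P where "P = expectation (\<lambda>\<omega>. Z (D \<omega>) \<tau>) - Z (f y) \<tau> - Z1 (f y) \<tau> * (expectation D - f y)"
    define Q where "Q = Z1 (f y) \<tau> * (expectation D - f y - bias h y)"
    have 2: "\<bar>Q\<bar> \<le> CZ * (C1 / N)"
      unfolding Q_def abs_mult
    proof (intro mult_mono est(1))
      show "\<bar>Z1 (f y) \<tau>\<bar> \<le> CZ" using zt[rule_format, OF \<tau> order.refl fy f_le] by blast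
    qed (use CZ in auto)
    have "expectation (\<lambda>\<omega>. Z (D \<omega>) \<tau>) - Z (f y) \<tau> - Z1 (f y) \<tau> * bias h y = P + Q"
      unfolding P_def Q_def by (simp add: right_diff_distrib)
    also have "\<bar>P + Q\<bar> \<le> CZ * (C1 * (1 / N + h ^ 4)) + CZ * CP / N * C1 + CZ * (C1 / N)"
      by (rule order_trans[OF abs_triangle_ineq add_mono[OF 1[folded P_def] 2]])
    also have "\<dots> = CZ * (C1 * (1 / N + h ^ 4)) + CZ * (CP * C1 + C1) * (1 / N)"
      by (simp add: algebra_simps)
    also have "\<dots> \<le> CZ * (C1 * (1 / N + h ^ 4)) + CZ * (CP * C1 + C1) * (1 / N + h ^ 4)"
      using CZ CP C1 h by (intro add_left_mono mult_left_mono) auto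
    also have "\<dots> = C * (1 / N + h ^ 4)" by (simp add: C_def algebra_simps)
    finally show "\<bar>expectation (\<lambda>\<omega>. Z (pilot ({1..n} - {i}) n h y \<omega>) \<tau>) - Z (f y) \<tau> - Z1 (f y) \<tau> * bias h y\<bar>
      \<le> C * (1 / (n * h ^ CARD('d)) + h ^ 4)" unfolding D_def N_def .
  qed
qed

end

section \<open>The expected value of the estimator\<close>

context sample
begin

lemma Z_eq_kernel: "Z s ((norm v)\<^sup>2) = \<alpha> s ^ CARD('d) * K (\<alpha> s *\<^sub>R v)"
  by (simp add: Z_def K power_mult_distrib)

text \<open>The scale factor never falls below \<open>c\<close>, so points at scaled distance
  \<open>r\<close> or more contribute nothing, whatever the pilot value.\<close>

lemma Z_0: "r\<^sup>2 \<le> \<tau> \<Longrightarrow> Z s \<tau> = 0"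
proof -
  assume \<tau>: "r\<^sup>2 \<le> \<tau>"
  have "T \<le> c\<^sup>2 * r\<^sup>2" by (rule T_le)
  also have "\<dots> \<le> (\<alpha> s)\<^sup>2 * \<tau>"
    using \<alpha>_ge[of s] c \<tau> by (intro mult_mono power_mono) auto
  finally show ?thesis by (simp add: Z_def T)
qed

lemma kde_eq_pilot:
  assumes "i \<in> {1..n}"
  shows "kde K n h (\<lambda>j. X j \<omega>) (X i \<omega>) = pilot ({1..n} - {i}) n h (X i \<omega>) \<omega>"
proof -
  have "(\<Sum>j=1..n. K ((1 / h) *\<^sub>R (X i \<omega> - X j \<omega>))) = K 0 + (\<Sum>j\<in>{1..n} - {i}. K ((1 / h) *\<^sub>R (X i \<omega> - X j \<omega>)))"
    using sum.remove[OF _ assms, of "\<lambda>j. K ((1 / h) *\<^sub>R (X i \<omega> - X j \<omega>))"] by simp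
  then show ?thesis unfolding kde_def pilot_def by simp
qed

lemma variable_kde_eq:
  "variable_kde K \<alpha> n h1 h2 (\<lambda>j. X j \<omega>) t = 1 / (n * h2 ^ CARD('d)) *
    (\<Sum>i=1..n. Z (pilot ({1..n} - {i}) n h1 (X i \<omega>) \<omega>) ((norm ((1 / h2) *\<^sub>R (t - X i \<omega>)))\<^sup>2))"
  unfolding variable_kde_def Z_eq_kernel
proof (rule arg_cong[where f = "\<lambda>s. 1 / (n * h2 ^ CARD('d)) * s"], rule sum.cong[OF refl])
  fix i assume i: "i \<in> {1..n}"
  show "K ((\<alpha> (kde K n h1 (\<lambda>j. X j \<omega>) (X i \<omega>)) / h2) *\<^sub>R (t - X i \<omega>)) * \<alpha> (kde K n h1 (\<lambda>j. X j \<omega>) (X i \<omega>)) ^ CARD('d)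
    = \<alpha> (pilot ({1..n} - {i}) n h1 (X i \<omega>) \<omega>) ^ CARD('d) * K (\<alpha> (pilot ({1..n} - {i}) n h1 (X i \<omega>) \<omega>) *\<^sub>R (1 / h2) *\<^sub>R (t - X i \<omega>))"
    unfolding kde_eq_pilot[OF i] by simp
qed

definition profile :: "nat \<Rightarrow> nat \<Rightarrow> real \<Rightarrow> real \<Rightarrow> real ^ 'd \<Rightarrow> real"
  where "profile n i h1 h2 u = f (t + h2 *\<^sub>R u) * expectation (\<lambda>\<omega>. Z (pilot ({1..n} - {i}) n h1 (t + h2 *\<^sub>R u) \<omega>) ((norm u)\<^sup>2))"

lemma sample_term:
  fixes h1 h2 :: real
  assumes i: "i \<in> {1..n}" and h1: "0 < h1" and N: "1 \<le> n * h1 ^ CARD('d)" and h2: "0 < h2"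
  shows "expectation (\<lambda>\<omega>. Z (pilot ({1..n} - {i}) n h1 (X i \<omega>) \<omega>) ((norm ((1 / h2) *\<^sub>R (t - X i \<omega>)))\<^sup>2))
      = h2 ^ CARD('d) * (\<integral>u. profile n i h1 h2 u \<partial>lborel)"
    and "integrable lborel (profile n i h1 h2)"
    and "integrable M (\<lambda>\<omega>. Z (pilot ({1..n} - {i}) n h1 (X i \<omega>) \<omega>) ((norm ((1 / h2) *\<^sub>R (t - X i \<omega>)))\<^sup>2))"
proof -
  define J where "J = {1..n} - {i}"
  have J: "finite J" "J \<subseteq> {1..}" "i \<notin> J" by (auto simp: J_def)
  define S where "S y x = (K 0 + (\<Sum>j\<in>J. K ((1 / h1) *\<^sub>R (y - x j)))) / (n * h1 ^ CARD('d))" for y :: "real ^ 'd" and x :: "nat \<Rightarrow> real ^ 'd"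
  define G where "G z = \<alpha> (S (fst z) (snd z)) ^ CARD('d) * K (\<alpha> (S (fst z) (snd z)) *\<^sub>R ((1 / h2) *\<^sub>R (t - fst z)))" for z
  have [measurable]: "K \<in> borel_measurable borel" by (rule borel_measurable_continuous_onI[OF cont_K])
  have [measurable]: "\<alpha> \<in> borel_measurable borel" by (rule borel_measurable_continuous_onI[OF \<alpha>_cont])
  have fm [measurable]: "f \<in> borel_measurable borel" by (rule borel_measurable_continuous_onI[OF f_cont])
  obtain BK where BK: "BK > 0" "\<And>z. K z \<le> BK" by (rule K_bounded) (rule that)
  have Sm: "(\<lambda>z. S (fst z) (snd z)) \<in> borel_measurable (borel \<Otimes>\<^sub>M Pi\<^sub>M J (\<lambda>_. borel))"
  proof -
    have "(\<lambda>z. K ((1 / h1) *\<^sub>R (fst z - snd z j))) \<in> borel_measurable (borel \<Otimes>\<^sub>M Pi\<^sub>M J (\<lambda>_. borel :: (real ^ 'd) measure))" if "j \<in> J" for j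
    proof -
      have [measurable]: "(\<lambda>z. snd z j) \<in> measurable ((borel :: (real ^ 'd) measure) \<Otimes>\<^sub>M Pi\<^sub>M J (\<lambda>_. borel :: (real ^ 'd) measure)) borel"
        by (rule measurable_compose[OF measurable_snd measurable_component_singleton[OF that]])
      show ?thesis by measurable
    qed
    then show ?thesis unfolding S_def by (intro borel_measurable_divide borel_measurable_add borel_measurable_sum) auto
  qed
  note [measurable] = Sm
  have Gm: "G \<in> borel_measurable (borel \<Otimes>\<^sub>M Pi\<^sub>M J (\<lambda>_. borel))"
    unfolding G_def[abs_def] by measurable
  have Sb: "S y x \<in> {0..K 0 + card J * BK}" for y x
  proof -
    have "0 \<le> (\<Sum>j\<in>J. K ((1 / h1) *\<^sub>R (y - x j)))" by (intro sum_nonneg K_nonneg)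
    moreover have "(\<Sum>j\<in>J. K ((1 / h1) *\<^sub>R (y - x j))) \<le> card J * BK"
      by (rule sum_bounded_above) (rule BK)
    ultimately have s: "0 \<le> K 0 + (\<Sum>j\<in>J. K ((1 / h1) *\<^sub>R (y - x j)))"
      "K 0 + (\<Sum>j\<in>J. K ((1 / h1) *\<^sub>R (y - x j))) \<le> K 0 + card J * BK"
      using K_nonneg[of 0] by auto
    moreover from s(1) have "S y x \<le> (K 0 + (\<Sum>j\<in>J. K ((1 / h1) *\<^sub>R (y - x j)))) / 1"
      unfolding S_def using N by (intro divide_left_mono) auto
    ultimately show ?thesis
      unfolding S_def using N by (auto intro: divide_nonneg_nonneg)
  qed
  \<comment> \<open>For fixed \<open>n\<close> and \<open>h1\<close> the pilot values lie in a
    compact interval, on which \<alpha> is bounded. The bound depends on \<open>n\<close> and serves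
    integrability alone.\<close>
  have "compact (\<alpha> ` {0..K 0 + card J * BK})"
    by (intro compact_continuous_image compact_Icc continuous_on_subset[OF \<alpha>_cont]) auto
  then obtain A where A: "\<And>s. s \<in> {0..K 0 + card J * BK} \<Longrightarrow> \<bar>\<alpha> s\<bar> \<le> A"
    using compact_imp_bounded bounded_iff by (metis imageI real_norm_def)
  define Gb where "Gb = \<bar>A\<bar> ^ CARD('d) * BK"
  have Gb: "\<bar>G z\<bar> \<le> Gb" for z
    unfolding G_def Gb_def abs_mult power_abs
    using order_trans[OF A[OF Sb[of "fst z" "snd z"]] abs_ge_self] K_nonneg BK by (intro mult_mono power_mono) auto
  have pilot: "pilot J n h1 y \<omega> = S y (\<lambda>j\<in>J. X j \<omega>)" for y \<omega>
    unfolding pilot_def S_def by simp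
  have GZ: "G (y, \<lambda>j\<in>J. X j \<omega>) = Z (pilot J n h1 y \<omega>) ((norm ((1 / h2) *\<^sub>R (t - y)))\<^sup>2)" for y \<omega>
    unfolding G_def pilot Z_eq_kernel by simp
  have iI: "i \<in> {1..}" "1 \<le> i" using i by auto
  note se = sample_expectation[OF indep iI(1) J(2,3) dist[OF iI(2)] f_nonneg fm Gm Gb]
  let ?g = "\<lambda>y. f y * expectation (\<lambda>\<omega>. G (y, \<lambda>j\<in>J. X j \<omega>))"
  have gm: "?g \<in> borel_measurable borel" using se(2) fm by simp
  have prof: "?g (t + h2 *\<^sub>R u) = profile n i h1 h2 u" for u
    unfolding profile_def GZ unfolding J_def using h2 by simp
  show "expectation (\<lambda>\<omega>. Z (pilot ({1..n} - {i}) n h1 (X i \<omega>) \<omega>) ((norm ((1 / h2) *\<^sub>R (t - X i \<omega>)))\<^sup>2))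
      = h2 ^ CARD('d) * (\<integral>u. profile n i h1 h2 u \<partial>lborel)"
    using se(1) integral_lborel_affine[OF gm, of h2 t] h2 unfolding prof unfolding GZ unfolding J_def by simp
  have X_rv_i: "random_variable borel (X i)" by (rule X_rv[OF iI(2)])
  have "random_variable (Pi\<^sub>M J (\<lambda>_. borel)) (\<lambda>\<omega>. \<lambda>j\<in>J. X j \<omega>)"
    by (rule measurable_restrict) (use X_rv J in auto)
  then have "random_variable borel (\<lambda>\<omega>. G (X i \<omega>, \<lambda>j\<in>J. X j \<omega>))"
    by (intro measurable_compose[OF measurable_Pair[OF X_rv_i] Gm])
  then have "integrable M (\<lambda>\<omega>. G (X i \<omega>, \<lambda>j\<in>J. X j \<omega>))"
    by (rule integrable_const_bound[of _ Gb, rotated]) (use Gb in auto)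
  then show "integrable M (\<lambda>\<omega>. Z (pilot ({1..n} - {i}) n h1 (X i \<omega>) \<omega>) ((norm ((1 / h2) *\<^sub>R (t - X i \<omega>)))\<^sup>2))"
    unfolding GZ unfolding J_def .
  have pm: "profile n i h1 h2 \<in> borel_measurable borel"
    unfolding prof[symmetric, abs_def] by (rule measurable_compose[OF _ gm]) simp
  have fin: "emeasure lborel (cball (0 :: real ^ 'd) r) < \<infinity>" by (rule emeasure_lborel_cball_finite)
  have Eb: "\<bar>expectation (\<lambda>\<omega>. G (y, \<lambda>j\<in>J. X j \<omega>))\<bar> \<le> Gb" for y
  proof -
    have "\<bar>expectation (\<lambda>\<omega>. G (y, \<lambda>j\<in>J. X j \<omega>))\<bar> \<le> expectation (\<lambda>\<omega>. \<bar>G (y, \<lambda>j\<in>J. X j \<omega>)\<bar>)"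
      using integral_norm_bound[of M "\<lambda>\<omega>. G (y, \<lambda>j\<in>J. X j \<omega>)"] by simp
    also have "\<dots> \<le> expectation (\<lambda>\<omega>. Gb)"
      by (rule integral_mono') (use Gb order_trans[OF abs_ge_zero Gb] in auto)
    finally show ?thesis by (simp add: prob_space)
  qed
  have "integrable lborel (\<lambda>u :: real ^ 'd. Cf * Gb * indicator (cball 0 r) u)"
    using fin by (intro integrable_mult_right) simp
  then show "integrable lborel (profile n i h1 h2)"
  proof (rule Bochner_Integration.integrable_bound)
    show "profile n i h1 h2 \<in> borel_measurable lborel" using pm by simp
    show "AE u in lborel. norm (profile n i h1 h2 u) \<le> norm (Cf * Gb * indicator (cball 0 r) u)"
    proof (rule AE_I2)
      fix u :: "real ^ 'd"
      show "norm (profile n i h1 h2 u) \<le> norm (Cf * Gb * indicator (cball 0 r) u)"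
      proof (cases "norm u \<le> r")
        case True
        have "\<bar>?g (t + h2 *\<^sub>R u)\<bar> \<le> Cf * Gb"
          unfolding abs_mult using f_nonneg f_le Eb Cf_nonneg by (intro mult_mono) auto
        also have "\<dots> \<le> \<bar>Cf * Gb\<bar>" by (rule abs_ge_self)
        finally show ?thesis using True unfolding prof by simp
      next
        case False
        then have "r\<^sup>2 \<le> (norm u)\<^sup>2" using r by (intro power_mono) auto
        then show ?thesis by (simp add: profile_def Z_0)
      qed
    qed
  qed
qed

lemma bias_measurable: "bias h \<in> borel_measurable borel"
proof -
  have "(\<lambda>z. K (snd z) * f (fst z - h *\<^sub>R snd z)) \<in> borel_measurable borel"
    by (intro borel_measurable_continuous_onI continuous_intros f_comp_cont continuous_on_compose2[OF cont_K[of UNIV]]) auto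
  then have "(\<lambda>z. K (snd z) * f (fst z - h *\<^sub>R snd z)) \<in> borel_measurable (borel \<Otimes>\<^sub>M lborel)"
    by (simp add: borel_prod[symmetric] cong: measurable_cong_sets)
  then have "(\<lambda>x. \<integral>w. K w * f (x - h *\<^sub>R w) \<partial>lborel) \<in> borel_measurable borel"
    by (intro lborel.borel_measurable_lebesgue_integral) (simp add: case_prod_unfold)
  then show ?thesis unfolding bias_def[abs_def]
    by (intro borel_measurable_diff borel_measurable_continuous_onI[OF f_cont])
qed

text \<open>Multiplied by the density, the tangent expansion reproduces the integrands of two
  \<open>smooth_int\<close> terms: the factor \<open>1 / s\<close> in \<open>Z1\<close> cancels
  against \<open>f y\<close>, which leaves \<open>Klin\<close> against the bias.\<close>

lemma profile_integral:
  "\<exists>W\<ge>0. \<forall>n i (h1 :: real) h2. i \<in> {1..n} \<longrightarrow> 0 < h1 \<longrightarrow> h1 \<le> 1 \<longrightarrow> 1 \<le> n * h1 ^ CARD('d) \<longrightarrow>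
    0 < h2 \<longrightarrow> h2 * r < \<rho> \<longrightarrow>
    \<bar>(\<integral>u. profile n i h1 h2 u \<partial>lborel) - smooth_int K h2 f - smooth_int Klin h2 (bias h1)\<bar>
      \<le> W * (1 / (n * h1 ^ CARD('d)) + h1 ^ 4)"
proof -
  obtain C where C: "C \<ge> 0" and ez: "\<forall>n i (h :: real) y \<tau>. i \<in> {1..n} \<longrightarrow> 0 < h \<longrightarrow> h \<le> 1 \<longrightarrow> 1 \<le> n * h ^ CARD('d) \<longrightarrow>
    \<sigma>0 + \<eta> \<le> f y \<longrightarrow> 0 \<le> \<tau> \<longrightarrow> \<tau> \<le> r\<^sup>2 \<longrightarrow>
    \<bar>expectation (\<lambda>\<omega>. Z (pilot ({1..n} - {i}) n h y \<omega>) \<tau>) - Z (f y) \<tau> - Z1 (f y) \<tau> * bias h y\<bar>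
      \<le> C * (1 / (n * h ^ CARD('d)) + h ^ 4)"
    using expectation_Z by (elim exE conjE) (rule that)
  define V where "V = measure lborel (cball (0 :: real ^ 'd) r)"
  have W: "0 \<le> Cf * C * V" using C Cf_nonneg by (simp add: V_def)
  show ?thesis
  proof (intro exI[of _ "Cf * C * V"] conjI allI impI W)
    fix n i :: nat and h1 h2 :: real
    assume i: "i \<in> {1..n}" and h1: "0 < h1" "h1 \<le> 1" and N: "1 \<le> n * h1 ^ CARD('d)"
      and h2: "0 < h2" "h2 * r < \<rho>"
    let ?I = "\<lambda>u. indicator (cball 0 r) u * (K (a h2 u *\<^sub>R u) * (a h2 u ^ CARD('d) * f (t + h2 *\<^sub>R u)))"
    let ?L = "\<lambda>u. indicator (cball 0 r) u * (Klin (a h2 u *\<^sub>R u) * (a h2 u ^ CARD('d) * bias h1 (t + h2 *\<^sub>R u)))"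
    let ?E = "1 / (n * h1 ^ CARD('d)) + h1 ^ 4"
    have intP: "integrable lborel (profile n i h1 h2)" by (rule sample_term(2)[OF i h1(1) N h2(1)])
    have intI: "integrable lborel ?I" by (rule smooth_integrable[OF cont_K f_cont])
    \<comment> \<open>For \<open>bias\<close> measurability and a uniform bound are at hand, hence
      domination instead of continuity.\<close>
    have intL: "integrable lborel ?L"
    proof -
      define g where "g u = Klin (a h2 u *\<^sub>R u) * a h2 u ^ CARD('d)" for u
      have g_cont: "continuous_on A g" for A
        unfolding g_def by (intro continuous_intros continuous_on_compose2[OF cont_Klin[of UNIV]] a_cont) auto
      have "integrable lborel (\<lambda>u. indicator (cball 0 r) u *\<^sub>R g u)"
        by (intro borel_integrable_compact compact_cball g_cont)
      then have "integrable lborel (\<lambda>u. (CARD('d) ^ 2 * T * Cf * h1 ^ 2) * (indicator (cball 0 r) u * g u))"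
        by simp
      then have "integrable lborel (\<lambda>u. indicator (cball 0 r) u * g u * bias h1 (t + h2 *\<^sub>R u))"
      proof (rule Bochner_Integration.integrable_bound)
        have m3: "(\<lambda>u. bias h1 (t + h2 *\<^sub>R u)) \<in> borel_measurable borel"
          by (rule measurable_compose[OF _ bias_measurable]) simp
        have m2: "g \<in> borel_measurable borel" by (rule borel_measurable_continuous_onI[OF g_cont])
        have m1: "(indicator (cball 0 r) :: real ^ 'd \<Rightarrow> real) \<in> borel_measurable borel"
          by (rule borel_measurable_indicator) simp
        show "(\<lambda>u. indicator (cball 0 r) u * g u * bias h1 (t + h2 *\<^sub>R u)) \<in> borel_measurable lborel"
          using borel_measurable_times[OF borel_measurable_times[OF m1 m2] m3] by simp
        have "0 \<le> CARD('d) ^ 2 * T * Cf * h1 ^ 2" using T(1) Cf_nonneg by simp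
        then show "AE u in lborel. norm (indicator (cball 0 r) u * g u * bias h1 (t + h2 *\<^sub>R u))
            \<le> norm ((CARD('d) ^ 2 * T * Cf * h1 ^ 2) * (indicator (cball 0 r) u * g u))"
          using bias_bound[of h1] unfolding real_norm_def abs_mult[of _ "bias h1 _"] abs_mult[of "CARD('d) ^ 2 * T * Cf * h1 ^ 2"]
          by (intro AE_I2) (auto simp: mult.commute intro!: mult_left_mono)
      qed
      then show ?thesis by (simp add: g_def mult_ac)
    qed
    have "\<bar>(\<integral>u. profile n i h1 h2 u \<partial>lborel) - smooth_int K h2 f - smooth_int Klin h2 (bias h1)\<bar>
      = \<bar>\<integral>u. profile n i h1 h2 u - ?I u - ?L u \<partial>lborel\<bar>"
      using Bochner_Integration.integral_diff[OF Bochner_Integration.integrable_diff[OF intP intI] intL]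
        Bochner_Integration.integral_diff[OF intP intI] by (simp only: smooth_int_def)
    also have "\<dots> \<le> (Cf * (C * ?E)) * V"
      unfolding V_def
    proof (rule integral_bound_cball)
      show "integrable lborel (\<lambda>u. profile n i h1 h2 u - ?I u - ?L u)"
        by (intro Bochner_Integration.integrable_diff intP intI intL)
      fix u :: "real ^ 'd"
      show "profile n i h1 h2 u - ?I u - ?L u = 0" if "norm u > r"
      proof -
        have "r\<^sup>2 \<le> (norm u)\<^sup>2" using r that by (intro power_mono) auto
        then show ?thesis using that by (simp add: profile_def Z_0)
      qed
      assume u: "norm u \<le> r"
      define y where "y = t + h2 *\<^sub>R u"
      have fy: "\<sigma>0 + \<eta> \<le> f y" unfolding y_def by (rule f_U[OF scaled_in_U[OF h2 u]])
      then have fy0: "0 < f y" "\<sigma>0 \<le> f y" using \<sigma>0 \<eta> by auto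
      have a_y: "a h2 u = sqrt (f y)" by (simp add: a_def y_def)
      have \<tau>: "0 \<le> (norm u)\<^sup>2" "(norm u)\<^sup>2 \<le> r\<^sup>2" using u by (auto intro: power_mono)
      have ZI: "f y * Z (f y) ((norm u)\<^sup>2) = ?I u"
        using u unfolding Z_eq_kernel \<alpha>_sqrt[OF fy0(2)] a_y y_def[symmetric] by simp
      have ZL: "f y * (Z1 (f y) ((norm u)\<^sup>2) * bias h1 y) = ?L u"
        using u fy0 unfolding Z1_def Klin_def a_y y_def[symmetric] by (simp add: power_mult_distrib)
      have "profile n i h1 h2 u - ?I u - ?L u = f y * (expectation (\<lambda>\<omega>. Z (pilot ({1..n} - {i}) n h1 y \<omega>) ((norm u)\<^sup>2))
          - Z (f y) ((norm u)\<^sup>2) - Z1 (f y) ((norm u)\<^sup>2) * bias h1 y)"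
        unfolding profile_def y_def[symmetric] by (simp only: right_diff_distrib ZI[folded y_def] ZL[folded y_def])
      also have "\<bar>\<dots>\<bar> \<le> Cf * (C * ?E)"
        unfolding abs_mult using ez[rule_format, OF i h1 N fy \<tau>] f_le[of y] fy0 Cf_nonneg by (intro mult_mono) auto
      finally show "\<bar>profile n i h1 h2 u - ?I u - ?L u\<bar> \<le> Cf * (C * ?E)" .
    qed
    also have "\<dots> = Cf * C * V * ?E" by (simp only: mult_ac)
    finally show "\<bar>(\<integral>u. profile n i h1 h2 u \<partial>lborel) - smooth_int K h2 f - smooth_int Klin h2 (bias h1)\<bar> \<le> Cf * C * V * ?E" .
  qed
qed

text \<open>Only the deterministic expansion has an error of type \<open>o\<close>, so
  \<open>W\<close> is fixed before \<open>e\<close>; the other errors are explicit in the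
  bandwidths.\<close>

lemma expectation_variable_kde:
  "\<exists>W\<ge>0. \<forall>e>0. \<exists>h0>0. \<forall>n (h1 :: real) h2. 1 \<le> n \<longrightarrow> 0 < h1 \<longrightarrow> h1 \<le> 1 \<longrightarrow> 1 \<le> n * h1 ^ CARD('d) \<longrightarrow>
    0 < h2 \<longrightarrow> h2 < h0 \<longrightarrow>
    \<bar>expectation (\<lambda>\<omega>. variable_kde K \<alpha> n h1 h2 (\<lambda>i. X i \<omega>) t) - f t
      - h2 ^ 4 * (\<integral>z. K z * dir_taylor 4 (\<lambda>x. 1 / f x) t z \<partial>lborel)\<bar>
      \<le> e * h2 ^ 4 + W * (h1\<^sup>2 * h2\<^sup>2 + 1 / (n * h1 ^ CARD('d)) + h1 ^ 4)"
proof -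
  let ?Q = "\<integral>z. K z * dir_taylor 4 (\<lambda>x. 1 / f x) t z \<partial>lborel"
  obtain W where W: "W \<ge> 0" and pi: "\<forall>n i (h1 :: real) h2. i \<in> {1..n} \<longrightarrow> 0 < h1 \<longrightarrow> h1 \<le> 1 \<longrightarrow> 1 \<le> n * h1 ^ CARD('d) \<longrightarrow>
    0 < h2 \<longrightarrow> h2 * r < \<rho> \<longrightarrow> \<bar>(\<integral>u. profile n i h1 h2 u \<partial>lborel) - smooth_int K h2 f - smooth_int Klin h2 (bias h1)\<bar> \<le> W * (1 / (n * h1 ^ CARD('d)) + h1 ^ 4)"
    using profile_integral by (elim exE conjE) (rule that)
  obtain C2 h0 where C2: "C2 \<ge> 0" "h0 > 0" and bl: "\<forall>h h1. 0 < h \<longrightarrow> h < h0 \<longrightarrow> \<bar>smooth_int Klin h (bias h1)\<bar> \<le> C2 * h1 ^ 2 * h ^ 2"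
    using bias_linear_term by (elim exE conjE) (rule that)
  have WC: "0 \<le> W + C2" using W C2 by simp
  show ?thesis
  proof (rule exI[of _ "W + C2"], intro conjI allI impI WC)
    fix e :: real assume e: "0 < e"
    obtain h0' where h0': "h0' > 0" and me: "\<forall>h. 0 < h \<and> h < h0' \<longrightarrow> \<bar>smooth_int K h f - f t - h ^ 4 * ?Q\<bar> \<le> e * h ^ 4"
      using main_expansion[OF int_K e] by (elim exE conjE) (rule that)
    show "\<exists>h0>0. \<forall>n (h1 :: real) h2. 1 \<le> n \<longrightarrow> 0 < h1 \<longrightarrow> h1 \<le> 1 \<longrightarrow> 1 \<le> n * h1 ^ CARD('d) \<longrightarrow>
      0 < h2 \<longrightarrow> h2 < h0 \<longrightarrow>
      \<bar>expectation (\<lambda>\<omega>. variable_kde K \<alpha> n h1 h2 (\<lambda>i. X i \<omega>) t) - f t - h2 ^ 4 * ?Q\<bar>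
      \<le> e * h2 ^ 4 + (W + C2) * (h1\<^sup>2 * h2\<^sup>2 + 1 / (n * h1 ^ CARD('d)) + h1 ^ 4)"
    proof (intro exI[of _ "min (min h0 h0') (\<rho> / r)"] conjI allI impI)
      show "0 < min (min h0 h0') (\<rho> / r)" using C2 h0' \<rho> r by simp
      fix n :: nat and h1 h2 :: real
      assume n: "1 \<le> n" and h1: "0 < h1" "h1 \<le> 1" and N: "1 \<le> n * h1 ^ CARD('d)"
        and h2: "0 < h2" "h2 < min (min h0 h0') (\<rho> / r)"
      have h2': "h2 < h0" "h2 < h0'" "h2 * r < \<rho>" using h2 r by (auto simp: pos_less_divide_eq)
      define E where "E = 1 / (n * h1 ^ CARD('d)) + h1 ^ 4"
      have "expectation (\<lambda>\<omega>. variable_kde K \<alpha> n h1 h2 (\<lambda>i. X i \<omega>) t)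
        = 1 / (n * h2 ^ CARD('d)) * (\<Sum>i=1..n. h2 ^ CARD('d) * (\<integral>u. profile n i h1 h2 u \<partial>lborel))"
        unfolding variable_kde_eq integral_mult_right_zero
      proof (subst Bochner_Integration.integral_sum)
        fix i assume "i \<in> {1..n}"
        then show "integrable M (\<lambda>\<omega>. Z (pilot ({1..n} - {i}) n h1 (X i \<omega>) \<omega>) ((norm ((1 / h2) *\<^sub>R (t - X i \<omega>)))\<^sup>2))"
          by (rule sample_term(3)[OF _ h1(1) N h2(1)])
      next
        show "1 / (n * h2 ^ CARD('d)) * (\<Sum>i = 1..n. expectation (\<lambda>\<omega>. Z (pilot ({1..n} - {i}) n h1 (X i \<omega>) \<omega>) ((norm ((1 / h2) *\<^sub>R (t - X i \<omega>)))\<^sup>2)))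
          = 1 / (n * h2 ^ CARD('d)) * (\<Sum>i=1..n. h2 ^ CARD('d) * (\<integral>u. profile n i h1 h2 u \<partial>lborel))"
          by (intro arg_cong[where f = "\<lambda>s. 1 / (n * h2 ^ CARD('d)) * s"] sum.cong refl sample_term(1)[OF _ h1(1) N h2(1)])
      qed
      also have "\<dots> = (\<Sum>i=1..n. (\<integral>u. profile n i h1 h2 u \<partial>lborel)) / n"
        using h2(1) by (simp add: sum_distrib_left[symmetric])
      finally have exp: "expectation (\<lambda>\<omega>. variable_kde K \<alpha> n h1 h2 (\<lambda>i. X i \<omega>) t) = (\<Sum>i=1..n. (\<integral>u. profile n i h1 h2 u \<partial>lborel)) / n" .
      have "(\<Sum>i=1..n. (\<integral>u. profile n i h1 h2 u \<partial>lborel)) / n - smooth_int K h2 f - smooth_int Klin h2 (bias h1)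
        = (\<Sum>i=1..n. (\<integral>u. profile n i h1 h2 u \<partial>lborel) - smooth_int K h2 f - smooth_int Klin h2 (bias h1)) / n"
        using n by (simp add: sum_subtractf diff_divide_distrib)
      also have "\<bar>\<dots>\<bar> \<le> (n * (W * E)) / n"
      proof -
        have "\<bar>\<Sum>i=1..n. (\<integral>u. profile n i h1 h2 u \<partial>lborel) - smooth_int K h2 f - smooth_int Klin h2 (bias h1)\<bar> \<le> (\<Sum>i=1..n. W * E)"
          unfolding E_def
          by (rule order_trans[OF sum_abs sum_mono]) (rule pi[rule_format, OF _ h1 N h2(1) h2'(3)])
        also have "(\<Sum>i=1..n. W * E) = n * (W * E)" by simp
        finally show ?thesis unfolding abs_divide abs_of_nat by (rule divide_right_mono) simp
      qed
      finally have 1: "\<bar>expectation (\<lambda>\<omega>. variable_kde K \<alpha> n h1 h2 (\<lambda>i. X i \<omega>) t) - smooth_int K h2 f - smooth_int Klin h2 (bias h1)\<bar> \<le> W * E"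
        unfolding exp using n by simp
      have 2: "\<bar>smooth_int K h2 f - f t - h2 ^ 4 * ?Q\<bar> \<le> e * h2 ^ 4" using me h2(1) h2'(2) by blast
      have 3: "\<bar>smooth_int Klin h2 (bias h1)\<bar> \<le> C2 * h1\<^sup>2 * h2\<^sup>2" using bl h2(1) h2'(1) by blast
      have E0: "0 \<le> E" unfolding E_def using h1 by simp
      have 4: "W * E \<le> (W + C2) * E" "C2 * h1\<^sup>2 * h2\<^sup>2 \<le> (W + C2) * (h1\<^sup>2 * h2\<^sup>2)"
        using W C2 E0 by (auto simp: algebra_simps)
      have "\<bar>expectation (\<lambda>\<omega>. variable_kde K \<alpha> n h1 h2 (\<lambda>i. X i \<omega>) t) - f t - h2 ^ 4 * ?Q\<bar>
        \<le> e * h2 ^ 4 + ((W + C2) * E + (W + C2) * (h1\<^sup>2 * h2\<^sup>2))"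
        using 1 2 3 4 by linarith
      then show "\<bar>expectation (\<lambda>\<omega>. variable_kde K \<alpha> n h1 h2 (\<lambda>i. X i \<omega>) t) - f t - h2 ^ 4 * ?Q\<bar>
        \<le> e * h2 ^ 4 + (W + C2) * (h1\<^sup>2 * h2\<^sup>2 + 1 / (n * h1 ^ CARD('d)) + h1 ^ 4)"
        by (simp add: E_def distrib_left add_ac)
    qed
  qed
qed

end

section \<open>The bias expansion\<close>

lemma smooth_densities_C_diff:
  assumes "f \<in> smooth_densities C k"
  shows "C_diff k UNIV f"
  using assms unfolding smooth_densities_def
  by (intro C_diffI_iter_partial) (auto intro: uniformly_continuous_imp_continuous)

lemma clip_scale_ge:
  assumes "clipping p t0" "0 < c"
  shows "c \<le> clip_scale c p s"
proof -
  have "1 \<le> p (s / c\<^sup>2)" using assms by (simp add: clipping_def)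
  then show ?thesis using assms by (simp add: clip_scale_def)
qed

lemma clip_scale_eq_sqrt:
  assumes "clipping p t0" "0 < c" "t0 * c\<^sup>2 \<le> s"
  shows "clip_scale c p s = sqrt s"
proof -
  have "p (s / c\<^sup>2) = s / c\<^sup>2" using assms by (simp add: clipping_def pos_le_divide_eq)
  then show ?thesis using assms by (simp add: clip_scale_def real_sqrt_divide)
qed

lemma clip_scale_continuous:
  assumes "smooth_derivs k p" "0 < k" "0 < c"
  shows "continuous_on UNIV (clip_scale c p)"
proof -
  have "(deriv ^^ 0) p differentiable (at x)" for x
    using assms unfolding smooth_derivs_def by blast
  then have "isCont p x" for x
    by (simp add: differentiable_imp_continuous_within)
  then have cont: "continuous_on UNIV p"
    by (simp add: continuous_at_imp_continuous_on)
  show ?thesis unfolding clip_scale_def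
    by (intro continuous_intros continuous_on_compose2[OF cont]) (use assms in auto)
qed

text \<open>Beyond \<open>T\<close> the profile vanishes on a neighbourhood of the point, hence so
  does its derivative. The shift by 1 makes room for that neighbourhood, and the maximum with 0
  keeps it inside the half-line.\<close>

lemma radial_profile_support:
  assumes supp: "closure {s \<in> {0..}. \<Phi> s \<noteq> 0} \<subseteq> {0..T}"
    and D1: "\<And>s. 0 \<le> s \<Longrightarrow> (\<Phi> has_real_derivative \<Phi>' s) (at s within {0..})"
    and s: "max T 0 + 1 \<le> s"
  shows "\<Phi> s = 0" "\<Phi>' s = 0"
proof -
  have zero: "\<Phi> x = 0" if "0 \<le> x" "T < x" for x
  proof (rule ccontr)
    assume "\<Phi> x \<noteq> 0"
    then have "x \<in> closure {s \<in> {0..}. \<Phi> s \<noteq> 0}" using that(1) by (intro subsetD[OF closure_subset]) simp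
    then show False using supp that(2) by auto
  qed
  then show "\<Phi> s = 0" using s by simp
  have "(\<Phi> has_real_derivative \<Phi>' s) (at s within {max T 0<..})"
    by (rule DERIV_subset[OF D1]) (use s in auto)
  then have "(\<Phi> has_real_derivative \<Phi>' s) (at s)"
    by (subst (asm) at_within_open) (use s in auto)
  moreover have "(\<Phi> has_real_derivative 0) (at s)"
    by (rule has_field_derivative_transform_within_open[of "\<lambda>_. 0" 0 s "{max T 0<..}"])
      (use s zero in auto)
  ultimately show "\<Phi>' s = 0" by (rule DERIV_unique)
qed

text \<open>For \<open>h \<le> exp (- 1)\<close> the logarithm is at least 1, so the square of the
  first summand bounds \<open>1 / (n h^d)\<close>. Both summands are nonnegative, so each is at most
  the rate.\<close>

lemma pilot_rate_consequences:
  assumes n: "0 < n" and h: "0 < h" "h \<le> exp (- 1)" and rate: "\<bar>pilot_rate d n h\<bar> \<le> e"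
  shows "1 / (n * h ^ d) \<le> e\<^sup>2" "h\<^sup>2 \<le> e"
proof -
  have "ln h \<le> ln (exp (- 1))" using h by (subst ln_le_cancel_iff) auto
  then have l: "1 \<le> ln (1 / h)" using h by (simp add: ln_div)
  have N: "0 < n * h ^ d" using n h by simp
  have s: "0 \<le> sqrt (ln (1 / h) / (n * h ^ d))" using l N by simp
  then show "h\<^sup>2 \<le> e" using rate unfolding pilot_rate_def by linarith
  have "sqrt (ln (1 / h) / (n * h ^ d)) \<le> e" using rate zero_le_power2[of h] unfolding pilot_rate_def by linarith
  then have "(sqrt (ln (1 / h) / (n * h ^ d)))\<^sup>2 \<le> e\<^sup>2" using s by (rule power_mono)
  then have "ln (1 / h) / (n * h ^ d) \<le> e\<^sup>2" using l N by simp
  moreover have "1 / (n * h ^ d) \<le> ln (1 / h) / (n * h ^ d)" using l N by (simp add: divide_right_mono)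
  ultimately show "1 / (n * h ^ d) \<le> e\<^sup>2" by linarith
qed

theorem proposition3p1:
  fixes M :: "'w measure" and X :: "nat \<Rightarrow> 'w \<Rightarrow> real ^ 'd::finite"
    and f K :: "real ^ 'd \<Rightarrow> real" and \<Phi> p :: "real \<Rightarrow> real"
    and C T c t0 :: real and h1 h2 :: "nat \<Rightarrow> real"
  assumes "prob_space M"
    and "prob_space.indep_vars M (\<lambda>_. borel) X {1..}"
    and "\<And>i. i \<ge> 1 \<Longrightarrow> distributed M lborel (X i) (\<lambda>x. ennreal (f x))"
    and "f \<in> smooth_densities C 4"
    and "clipping p t0" and "smooth_derivs 5 p" and "c > 0"
    and "\<And>t. K t = \<Phi> ((norm t)\<^sup>2)"
    and "bounded_second_deriv \<Phi>"
    and "closure {s \<in> {0..}. \<Phi> s \<noteq> 0} \<subseteq> {0..T}"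
    and "\<And>t. K t \<ge> 0" and "has_bochner_integral lborel K 1"
    and "\<And>n. h1 n > 0" and "\<And>n. h2 n > 0"
    and "h1 \<longlonglongrightarrow> 0" and "filterlim (\<lambda>n. real n * h1 n ^ CARD('d)) at_top sequentially"
    and "h2 \<longlonglongrightarrow> 0"
    and "(\<lambda>n. pilot_rate CARD('d) n (h1 n)) \<in> o(\<lambda>n. (h2 n)\<^sup>2)"
  shows "\<forall>r>0. \<forall>t \<in> region f t0 c r.
    (\<lambda>n. (\<integral>\<omega>. variable_kde K (clip_scale c p) n (h1 n) (h2 n) (\<lambda>i. X i \<omega>) t \<partial>M) - f t
        - (\<Sum>v | mi_order v = 4.
             kernel_moment K v * mi_deriv v (\<lambda>x. 1 / f x) t / mi_fact v) * h2 n ^ 4)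
      \<in> o(\<lambda>n. h2 n ^ 4)"
proof (intro allI impI ballI)
  fix s0 :: real and t :: "real ^ 'd"
  assume "0 < s0" and t: "t \<in> region f t0 c s0"
  from t have ft: "s0 < f t" and s0: "t0 * c\<^sup>2 < s0" by (auto simp: region_def)
  have t0: "1 \<le> t0" using assms(5) by (simp add: clipping_def)
  from assms(9) obtain \<Phi>' \<Phi>'' B where \<Phi>: "\<And>s. 0 \<le> s \<Longrightarrow> (\<Phi> has_real_derivative \<Phi>' s) (at s within {0..})"
    "\<And>s. 0 \<le> s \<Longrightarrow> (\<Phi>' has_real_derivative \<Phi>'' s) (at s within {0..})" "\<And>s. 0 \<le> s \<Longrightarrow> \<bar>\<Phi>'' s\<bar> \<le> B"
    unfolding bounded_second_deriv_def by blast
  define T' where "T' = max T 0 + 1"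
  define \<sigma>0 where "\<sigma>0 = t0 * c\<^sup>2"
  define \<eta> where "\<eta> = s0 - \<sigma>0"
  \<comment> \<open>Radius in the scaled variable, with \<open>c^2 r^2 = T'\<close>; the parameter
    of the region is called \<open>s0\<close> here.\<close>
  define r where "r = sqrt T' / c"
  have T': "0 < T'" by (simp add: T'_def)
  have \<sigma>0: "0 < \<sigma>0" "c\<^sup>2 \<le> \<sigma>0" unfolding \<sigma>0_def using t0 assms(7) by auto
  have \<eta>: "0 < \<eta>" "\<sigma>0 + \<eta> = s0" using s0 by (auto simp: \<eta>_def \<sigma>0_def)
  have r: "0 < r" "c\<^sup>2 * r\<^sup>2 = T'" using T' assms(7) by (auto simp: r_def power_divide)
  have f_C4: "C_diff 4 UNIV f" by (rule smooth_densities_C_diff[OF assms(4)])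
  have "isCont f t" using C_diff_imp_continuous_on[OF f_C4] by (simp add: continuous_on_eq_continuous_at)
  then obtain \<rho> where \<rho>: "0 < \<rho>" "\<And>x. dist x t < \<rho> \<Longrightarrow> dist (f x) (f t) < f t - s0"
    unfolding continuous_at_eps_delta using diff_gt_0_iff_gt[THEN iffD2, OF ft] by blast
  have f_low: "s0 \<le> f (t + w)" if "norm w < \<rho>" for w
    using \<rho>(2)[of "t + w"] that by (auto simp: dist_norm abs_less_iff)
  have f_bd: "\<bar>iter_partial is f x\<bar> \<le> C" if "length is \<le> 4" for "is" x
    using assms(4) that by (auto simp: smooth_densities_def)
  have f_nn: "0 \<le> f x" for x using assms(4) by (auto simp: smooth_densities_def)
  interpret sample \<Phi> \<Phi>' \<Phi>'' B T' K f t C \<sigma>0 \<eta> \<rho> r "clip_scale c p" c M X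
  proof (intro sample.intro variable_bandwidth.intro pilot_density.intro density_at.intro radial_kernel.intro
      density_at_axioms.intro pilot_density_axioms.intro variable_bandwidth_axioms.intro sample_axioms.intro)
    \<comment> \<open>\<open>c^2 \<le> \<sigma>0\<close> because \<open>t0 \<ge> 1\<close>; hence
      one radius serves both the clipped and the ideal bandwidth factor.\<close>
    show "T' \<le> (\<sigma>0 + \<eta>) * r\<^sup>2"
      unfolding r(2)[symmetric] using \<sigma>0 \<eta> by (intro mult_right_mono) auto
    show "\<Phi> s = 0" "\<Phi>' s = 0" if "T' \<le> s" for s
      using radial_profile_support[OF assms(10) \<Phi>(1)] that by (auto simp: T'_def)
    show "clip_scale c p s = sqrt s" if "\<sigma>0 \<le> s" for s
      using clip_scale_eq_sqrt[OF assms(5,7)] that by (simp add: \<sigma>0_def)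
    show "(\<integral>z. K z \<partial>lborel) = 1" using assms(12) by (rule has_bochner_integral_integral_eq)
    show "T' \<le> c\<^sup>2 * r\<^sup>2" using r(2) by simp
    show "\<sigma>0 + \<eta> \<le> f (t + w)" if "norm w < \<rho>" for w using f_low[OF that] \<eta>(2) by simp
    show "0 < \<sigma>0 + \<eta>" using \<sigma>0(1) \<eta>(1) by simp
    show "continuous_on UNIV (clip_scale c p)" by (rule clip_scale_continuous[OF assms(6) _ assms(7)]) simp
  qed (fact assms \<Phi> T' f_C4 f_bd f_nn \<rho>(1) \<eta>(1) r(1) \<sigma>0(1) clip_scale_ge[OF assms(5,7)]
      | rule assms \<Phi> f_bd, assumption)+
  obtain W where W: "0 \<le> W" and ev: "\<forall>e>0. \<exists>h0>0. \<forall>n (h1 :: real) h2. 1 \<le> n \<longrightarrow> 0 < h1 \<longrightarrow> h1 \<le> 1 \<longrightarrow> 1 \<le> n * h1 ^ CARD('d) \<longrightarrow>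
    0 < h2 \<longrightarrow> h2 < h0 \<longrightarrow>
    \<bar>expectation (\<lambda>\<omega>. variable_kde K (clip_scale c p) n h1 h2 (\<lambda>i. X i \<omega>) t) - f t
      - h2 ^ 4 * (\<integral>z. K z * dir_taylor 4 (\<lambda>x. 1 / f x) t z \<partial>lborel)\<bar>
      \<le> e * h2 ^ 4 + W * (h1\<^sup>2 * h2\<^sup>2 + 1 / (n * h1 ^ CARD('d)) + h1 ^ 4)"
    using expectation_variable_kde by (elim exE conjE) (rule that)
  have h_C4: "C_diff 4 U (\<lambda>x. 1 / f x)"
    unfolding divide_inverse by (intro C_diff_mult C_diff_const C_diff_inverse U local.f_C4) (auto dest: f_U_pos)
  let ?Q = "\<Sum>v | mi_order v = 4. kernel_moment K v * mi_deriv v (\<lambda>x. 1 / f x) t / mi_fact v"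
  let ?E = "\<lambda>n. expectation (\<lambda>\<omega>. variable_kde K (clip_scale c p) n (h1 n) (h2 n) (\<lambda>i. X i \<omega>) t)"
  have Q: "(\<integral>z. K z * dir_taylor 4 (\<lambda>x. 1 / f x) t z \<partial>lborel) = ?Q"
    by (rule integral_K_dir_taylor[OF U(1,2) h_C4])
  show "(\<lambda>n. ?E n - f t - ?Q * h2 n ^ 4) \<in> o(\<lambda>n. h2 n ^ 4)"
  proof (rule landau_o.smallI)
    fix e :: real
    assume e: "0 < e"
    \<comment> \<open>Each of the three remaining errors will be at most
      \<open>\<delta> h2^4\<close>, and \<open>W\<close> times their sum may use up
      \<open>e / 2\<close> of the budget. The cap at 1 gives
      \<open>\<delta>^2 \<le> \<delta>\<close>; the summand 1 avoids division by zero when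
      \<open>W = 0\<close>.\<close>
    define \<delta> where "\<delta> = min 1 (e / (2 * (3 * W + 1)))"
    have \<delta>: "0 < \<delta>" "\<delta> \<le> 1" "3 * W * \<delta> \<le> e / 2"
    proof -
      show "0 < \<delta>" "\<delta> \<le> 1" unfolding \<delta>_def using e W by auto
      have "3 * W * \<delta> \<le> (3 * W + 1) * (e / (2 * (3 * W + 1)))"
        using W e unfolding \<delta>_def by (intro mult_mono) auto
      also have "\<dots> = e / 2" using W by (simp add: field_simps)
      finally show "3 * W * \<delta> \<le> e / 2" .
    qed
    have e2: "0 < e / 2" using e by simp
    obtain h0 where h0: "0 < h0" and bd: "\<forall>n (h1 :: real) h2. 1 \<le> n \<longrightarrow> 0 < h1 \<longrightarrow> h1 \<le> 1 \<longrightarrow> 1 \<le> n * h1 ^ CARD('d) \<longrightarrow>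
      0 < h2 \<longrightarrow> h2 < h0 \<longrightarrow>
      \<bar>expectation (\<lambda>\<omega>. variable_kde K (clip_scale c p) n h1 h2 (\<lambda>i. X i \<omega>) t) - f t - h2 ^ 4 * ?Q\<bar>
      \<le> e / 2 * h2 ^ 4 + W * (h1\<^sup>2 * h2\<^sup>2 + 1 / (n * h1 ^ CARD('d)) + h1 ^ 4)"
      using ev[rule_format, OF e2] unfolding Q by (elim exE conjE) (rule that)
    have "eventually (\<lambda>n. 1 \<le> n) sequentially" by (rule eventually_ge_at_top)
    \<comment> \<open>Ensures that the logarithm in the rate is at least 1, and that
      \<open>h1 n \<le> 1\<close>.\<close>
    moreover have "eventually (\<lambda>n. h1 n < exp (- 1)) sequentially"
      using assms(15) by (rule order_tendstoD) simp
    moreover have "eventually (\<lambda>n. h2 n < h0) sequentially"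
      using assms(17) h0 by (rule order_tendstoD)
    moreover have "eventually (\<lambda>n. 1 \<le> real n * h1 n ^ CARD('d)) sequentially"
      using assms(16) by (simp add: filterlim_at_top)
    moreover have "eventually (\<lambda>n. norm (pilot_rate CARD('d) n (h1 n)) \<le> \<delta> * norm ((h2 n)\<^sup>2)) sequentially"
      using assms(18) \<delta>(1) by (rule landau_o.smallD)
    ultimately show "eventually (\<lambda>n. norm (?E n - f t - ?Q * h2 n ^ 4) \<le> e * norm (h2 n ^ 4)) sequentially"
    proof eventually_elim
      case (elim n)
      have n: "0 < n" using elim(1) by simp
      have e1: "exp (- 1) \<le> (1 :: real)" by simp
      have h1: "h1 n \<le> 1" "h1 n \<le> exp (- 1)" using elim(2) e1 by linarith+
      have rate: "\<bar>pilot_rate CARD('d) n (h1 n)\<bar> \<le> \<delta> * (h2 n)\<^sup>2" using elim(5) by simp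
      have N: "1 / (n * h1 n ^ CARD('d)) \<le> (\<delta> * (h2 n)\<^sup>2)\<^sup>2" and hh: "(h1 n)\<^sup>2 \<le> \<delta> * (h2 n)\<^sup>2"
        using pilot_rate_consequences[OF n assms(13) h1(2) rate] by auto
      have \<delta>2: "(\<delta> * (h2 n)\<^sup>2)\<^sup>2 \<le> \<delta> * h2 n ^ 4"
        using \<delta>(1,2) by (simp add: power_mult_distrib power2_eq_square[of \<delta>] mult_le_cancel_right1 mult_right_mono)
      have "(h1 n)\<^sup>2 * (h2 n)\<^sup>2 \<le> \<delta> * (h2 n)\<^sup>2 * (h2 n)\<^sup>2" using hh by (rule mult_right_mono) simp
      also have "\<dots> = \<delta> * h2 n ^ 4" by simp
      finally have 1: "(h1 n)\<^sup>2 * (h2 n)\<^sup>2 \<le> \<delta> * h2 n ^ 4" .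
      have "h1 n ^ 4 = ((h1 n)\<^sup>2)\<^sup>2" by simp
      also have "\<dots> \<le> (\<delta> * (h2 n)\<^sup>2)\<^sup>2" using hh by (rule power_mono) simp
      finally have 3: "h1 n ^ 4 \<le> \<delta> * h2 n ^ 4" using \<delta>2 by linarith
      have "W * ((h1 n)\<^sup>2 * (h2 n)\<^sup>2 + 1 / (n * h1 n ^ CARD('d)) + h1 n ^ 4) \<le> W * (3 * (\<delta> * h2 n ^ 4))"
        using 1 3 N \<delta>2 by (intro mult_left_mono W) linarith
      also have "\<dots> = 3 * W * \<delta> * h2 n ^ 4" by simp
      also have "\<dots> \<le> e / 2 * h2 n ^ 4" using \<delta>(3) by (rule mult_right_mono) simp
      finally have "W * ((h1 n)\<^sup>2 * (h2 n)\<^sup>2 + 1 / (n * h1 n ^ CARD('d)) + h1 n ^ 4) \<le> e / 2 * h2 n ^ 4" .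
      moreover have "\<bar>?E n - f t - h2 n ^ 4 * ?Q\<bar> \<le> e / 2 * h2 n ^ 4 + W * ((h1 n)\<^sup>2 * (h2 n)\<^sup>2 + 1 / (n * h1 n ^ CARD('d)) + h1 n ^ 4)"
        by (rule bd[rule_format, OF elim(1) assms(13) h1(1) elim(4) assms(14) elim(3)])
      ultimately have "\<bar>?E n - f t - h2 n ^ 4 * ?Q\<bar> \<le> e * h2 n ^ 4" by (simp add: field_simps)
      then show ?case by (simp add: mult.commute)
    qed
  qed
qed

end
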